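(* Let $\mathcal{M}$ be a separable factor with $\dim\mathcal{M}>1$. Assume further that $\mathcal{G}(\mathcal{M})=0$ if $\mathcal{M}$ is of type $\mathrm{II}_1$. Then a self-adjoint operator $A$ in $\mathcal{M}$ is the real part of a generator of $\mathcal{M}$ (that is, $A=\frac{1}{2}(T+T^* )$ for some $T\in\mathcal{M}$ with $W^*(T)=\mathcal{M}$) if and only if $A$ is not a scalar multiple of the identity.
   Context: A separable factor is a von Neumann algebra with trivial center and separable predual. $W^*(\mathcal{S})$ denotes the smallest von Neumann subalgebra of $\mathcal{M}$ (containing the identity $I$) that contains $\mathcal{S}$. Shen's invariant $\mathcal{G}$: let $\mathcal{M}$ be a separable type $\mathrm{II}_1$ factor with its tracial state $\tau$. For a finite family $\mathcal{P}=\{p_1,\dots,p_k\}$ of mutually orthogonal projections in $\mathcal{M}$ with $\sum_i p_i=I$ and $\tau(p_i)=1/k$ for all $i$, and a finite subset $X\subset\mathcal{M}$, put $\mathcal{I}(X;\mathcal{P})=\sum_{x\in X}\frac{1}{k^2}\,|\{(i,j): p_ixp_j\neq 0\}|$. Then $\mathcal{G}(\mathcal{M})$ is the infimum of $\mathcal{I}(X;\mathcal{P})$ over all such $\mathcal{P}$ (all $k\geqslant 1$) and all finite $X$ with $W^*(X)=\mathcal{M}$ ($\mathcal{G}(\mathcal{M})=\infty$ if $\mathcal{M}$ is not finitely generated). *)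

theory Defs
  imports "HOL-Analysis.Analysis"
begin

section \<open>Complex Hilbert spaces\<close>

text \<open>The inner product is linear in the first argument. The underlying real inner product, hence
  the norm, is its real part.\<close>

class complex_hilbert = real_inner + complete_space +
  fixes scaleC :: "complex \<Rightarrow> 'a \<Rightarrow> 'a"  (infixr "*\<^sub>C" 75)
    and cinner :: "'a \<Rightarrow> 'a \<Rightarrow> complex"
  assumes scaleC_add_right: "a *\<^sub>C (x + y) = a *\<^sub>C x + a *\<^sub>C y"
    and scaleC_add_left: "(a + b) *\<^sub>C x = a *\<^sub>C x + b *\<^sub>C x"
    and scaleC_scaleC: "a *\<^sub>C b *\<^sub>C x = (a * b) *\<^sub>C x"
    and scaleR_scaleC: "r *\<^sub>R x = complex_of_real r *\<^sub>C x"
    and cinner_add_left: "cinner (x + y) z = cinner x z + cinner y z"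
    and cinner_scaleC_left: "cinner (a *\<^sub>C x) y = a * cinner x y"
    and cinner_commute: "cinner x y = cnj (cinner y x)"
    and inner_cinner: "inner x y = Re (cinner x y)"

instantiation complex :: complex_hilbert
begin

definition scaleC_complex :: "complex \<Rightarrow> complex \<Rightarrow> complex"
  where "scaleC_complex a x = a * x"

definition cinner_complex :: "complex \<Rightarrow> complex \<Rightarrow> complex"
  where "cinner_complex x y = x * cnj y"

instance
  by standard (auto simp: scaleC_complex_def cinner_complex_def algebra_simps
      scaleR_conv_of_real inner_complex_def)

end

lemma norm_scaleC: "norm (a *\<^sub>C x) = cmod a * norm (x :: 'h::complex_hilbert)"
proof -
  have right: "cinner y (a *\<^sub>C z) = cnj a * cinner y z" for y z :: 'h
    by (metis cinner_commute cinner_scaleC_left complex_cnj_mult)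
  have "cinner (a *\<^sub>C x) (a *\<^sub>C x) = of_real ((cmod a)\<^sup>2) * cinner x x"
    using complex_norm_square[of a] by (simp add: cinner_scaleC_left right mult.assoc)
  then have "inner (a *\<^sub>C x) (a *\<^sub>C x) = (cmod a)\<^sup>2 * inner x x"
    by (simp add: inner_cinner)
  then show ?thesis
    by (simp add: norm_eq_sqrt_inner real_sqrt_mult)
qed

lemma bounded_linear_scaleC: "bounded_linear (\<lambda>x :: 'h::complex_hilbert. a *\<^sub>C x)"
proof (rule bounded_linear_intro[where K = "cmod a"])
  show "a *\<^sub>C (r *\<^sub>R x) = r *\<^sub>R (a *\<^sub>C x)" for r and x :: 'h
    by (simp add: scaleR_scaleC scaleC_scaleC mult.commute)
qed (simp_all add: scaleC_add_right norm_scaleC mult.commute)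


section \<open>Bounded operators\<close>

text \<open>Operators live in the library type of bounded real-linear maps, whose norm is the operator
  norm; \<open>clinear_op\<close> singles out the complex-linear ones.\<close>

type_synonym 'h operator = "'h \<Rightarrow>\<^sub>L 'h"

definition clinear_op :: "('h::complex_hilbert) operator \<Rightarrow> bool"
  where "clinear_op T \<longleftrightarrow> (\<forall>c x. T (c *\<^sub>C x) = c *\<^sub>C T x)"

lift_definition scale_op :: "complex \<Rightarrow> ('h::complex_hilbert) operator \<Rightarrow> 'h operator"
  is "\<lambda>c T x. c *\<^sub>C T x"
  by (rule bounded_linear_compose[OF bounded_linear_scaleC])

interpretation op: vector_space "scale_op :: complex \<Rightarrow> ('h::complex_hilbert) operator \<Rightarrow> _"
proof
  fix a b :: complex and S T :: "'h operator"
  show "scale_op a (S + T) = scale_op a S + scale_op a T"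
    by transfer (simp add: scaleC_add_right)
  show "scale_op (a + b) T = scale_op a T + scale_op b T"
    by transfer (simp add: scaleC_add_left)
  show "scale_op a (scale_op b T) = scale_op (a * b) T"
    by transfer (simp add: scaleC_scaleC)
  have "1 *\<^sub>C x = x" for x :: 'h
    using scaleR_scaleC[of 1 x] by simp
  then show "scale_op 1 T = T"
    by transfer simp
qed

text \<open>For a complex-linear operator the adjoint exists by the Riesz representation theorem.\<close>

definition adj :: "('h::complex_hilbert) operator \<Rightarrow> 'h operator"
  where "adj T = (THE S :: 'h operator. \<forall>x y. cinner (T x) y = cinner x (S y))"


section \<open>Von Neumann algebras\<close>

definition von_neumann_algebra :: "('h::complex_hilbert) operator set \<Rightarrow> bool"
  where "von_neumann_algebra M \<longleftrightarrow>
    (\<forall>T\<in>M. clinear_op T) \<and>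
    id_blinfun \<in> M \<and>
    (\<forall>S\<in>M. \<forall>T\<in>M. S + T \<in> M) \<and>
    (\<forall>c. \<forall>T\<in>M. scale_op c T \<in> M) \<and>
    (\<forall>S\<in>M. \<forall>T\<in>M. S o\<^sub>L T \<in> M) \<and>
    (\<forall>T\<in>M. adj T \<in> M) \<and>
    closedin strong_operator_topology M"

definition W_star :: "('h::complex_hilbert) operator set \<Rightarrow> 'h operator set \<Rightarrow> 'h operator set"
  where "W_star M X = (\<lambda>N. von_neumann_algebra N \<and> N \<subseteq> M) hull X"

definition center :: "('h::complex_hilbert) operator set \<Rightarrow> 'h operator set"
  where "center M = {S \<in> M. \<forall>T\<in>M. S o\<^sub>L T = T o\<^sub>L S}"

definition factor :: "('h::complex_hilbert) operator set \<Rightarrow> bool"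
  where "factor M \<longleftrightarrow> von_neumann_algebra M \<and> center M = range (\<lambda>c. scale_op c id_blinfun)"

text \<open>The initial topology of all functionals
  \<open>T \<mapsto> \<Sum>n. \<langle>T \<xi>\<^sub>n, \<eta>\<^sub>n\<rangle>\<close> with \<open>(\<xi>\<^sub>n)\<close> and \<open>(\<eta>\<^sub>n)\<close> square-summable.\<close>

definition ultraweak_topology :: "('h::complex_hilbert) operator topology"
  where "ultraweak_topology = pullback_topology UNIV
    (\<lambda>(T :: 'h operator) (\<xi> :: nat \<Rightarrow> 'h, \<eta> :: nat \<Rightarrow> 'h).
      if summable (\<lambda>n. (norm (\<xi> n))\<^sup>2) \<and> summable (\<lambda>n. (norm (\<eta> n))\<^sup>2)
      then \<Sum>n. cinner (T (\<xi> n)) (\<eta> n) else 0)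
    euclidean"

definition linear_functional_on ::
    "('h::complex_hilbert) operator set \<Rightarrow> ('h operator \<Rightarrow> complex) \<Rightarrow> bool"
  where "linear_functional_on M \<phi> \<longleftrightarrow>
    (\<forall>S\<in>M. \<forall>T\<in>M. \<phi> (S + T) = \<phi> S + \<phi> T) \<and>
    (\<forall>c. \<forall>T\<in>M. \<phi> (scale_op c T) = c * \<phi> T)"

text \<open>Only the values on \<open>M\<close> matter: elements of \<open>predual M\<close> that agree on \<open>M\<close> represent the same
  functional.\<close>

definition predual :: "('h::complex_hilbert) operator set \<Rightarrow> ('h operator \<Rightarrow> complex) set"
  where "predual M = {\<phi>. linear_functional_on M \<phi> \<and>
    continuous_map (subtopology ultraweak_topology M) euclidean \<phi>}"

text \<open>The inequality says that the norm of \<open>\<phi> - \<psi>\<close> as a functional on \<open>M\<close> is at most \<open>e\<close>.\<close>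

definition separable_predual :: "('h::complex_hilbert) operator set \<Rightarrow> bool"
  where "separable_predual M \<longleftrightarrow>
    (\<exists>D. countable D \<and> D \<subseteq> predual M \<and>
      (\<forall>\<phi>\<in>predual M. \<forall>e>0. \<exists>\<psi>\<in>D. \<forall>T\<in>M. cmod (\<phi> T - \<psi> T) \<le> e * norm T))"


section \<open>Factors of type II\<open>\<^sub>1\<close>\<close>

definition projection_in :: "('h::complex_hilbert) operator set \<Rightarrow> 'h operator \<Rightarrow> bool"
  where "projection_in M p \<longleftrightarrow> p \<in> M \<and> p o\<^sub>L p = p \<and> adj p = p"

definition mvn_equivalent ::
    "('h::complex_hilbert) operator set \<Rightarrow> 'h operator \<Rightarrow> 'h operator \<Rightarrow> bool"
  where "mvn_equivalent M p q \<longleftrightarrow> (\<exists>v\<in>M. adj v o\<^sub>L v = p \<and> v o\<^sub>L adj v = q)"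

text \<open>For projections, \<open>q \<le> p\<close> is expressed by \<open>p q = q\<close>.\<close>

definition finite_projection :: "('h::complex_hilbert) operator set \<Rightarrow> 'h operator \<Rightarrow> bool"
  where "finite_projection M p \<longleftrightarrow> projection_in M p \<and>
    (\<forall>q. projection_in M q \<and> p o\<^sub>L q = q \<and> mvn_equivalent M q p \<longrightarrow> q = p)"

definition abelian_projection :: "('h::complex_hilbert) operator set \<Rightarrow> 'h operator \<Rightarrow> bool"
  where "abelian_projection M p \<longleftrightarrow> projection_in M p \<and>
    (\<forall>S\<in>M. \<forall>T\<in>M. (p o\<^sub>L S o\<^sub>L p) o\<^sub>L (p o\<^sub>L T o\<^sub>L p) = (p o\<^sub>L T o\<^sub>L p) o\<^sub>L (p o\<^sub>L S o\<^sub>L p))"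

definition type_II1_factor :: "('h::complex_hilbert) operator set \<Rightarrow> bool"
  where "type_II1_factor M \<longleftrightarrow> factor M \<and> id_blinfun \<noteq> (0 :: 'h operator) \<and>
    finite_projection M id_blinfun \<and> (\<forall>p. abelian_projection M p \<longrightarrow> p = 0)"

definition tracial_state ::
    "('h::complex_hilbert) operator set \<Rightarrow> ('h operator \<Rightarrow> complex) \<Rightarrow> bool"
  where "tracial_state M \<tau> \<longleftrightarrow> linear_functional_on M \<tau> \<and>
    (\<forall>T\<in>M. \<tau> (adj T o\<^sub>L T) \<in> \<real>\<^sub>\<ge>\<^sub>0) \<and> \<tau> id_blinfun = 1 \<and>
    (\<forall>S\<in>M. \<forall>T\<in>M. \<tau> (S o\<^sub>L T) = \<tau> (T o\<^sub>L S))"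


section \<open>Shen's invariant\<close>

definition equal_partition :: "('h::complex_hilbert) operator set \<Rightarrow> ('h operator \<Rightarrow> complex) \<Rightarrow>
    nat \<Rightarrow> (nat \<Rightarrow> 'h operator) \<Rightarrow> bool"
  where "equal_partition M \<tau> k p \<longleftrightarrow> k \<ge> 1 \<and>
    (\<forall>i<k. projection_in M (p i)) \<and>
    (\<forall>i<k. \<forall>j<k. i \<noteq> j \<longrightarrow> p i o\<^sub>L p j = 0) \<and>
    (\<Sum>i<k. p i) = id_blinfun \<and>
    (\<forall>i<k. \<tau> (p i) = 1 / of_nat k)"

definition shen_I :: "('h::complex_hilbert) operator set \<Rightarrow> nat \<Rightarrow> (nat \<Rightarrow> 'h operator) \<Rightarrow> real"
  where "shen_I X k p =
    (\<Sum>x\<in>X. 1 / (real k)\<^sup>2 * real (card {(i, j). i < k \<and> j < k \<and> p i o\<^sub>L x o\<^sub>L p j \<noteq> 0}))"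

text \<open>A type II\<open>\<^sub>1\<close> factor has exactly one tracial state (up to its values outside \<open>M\<close>), so \<open>\<tau>\<close> below
  is the trace of \<open>M\<close>. The infimum of the empty set is \<open>\<infinity>\<close>.\<close>

definition shen_G :: "('h::complex_hilbert) operator set \<Rightarrow> ereal"
  where "shen_G M = Inf {ereal (shen_I X k p) | X k p.
    (\<exists>\<tau>. tracial_state M \<tau> \<and> equal_partition M \<tau> k p) \<and>
    finite X \<and> X \<subseteq> M \<and> W_star M X = M}"

end

theory Submission
  imports Defs
begin

text \<open>The von Neumann algebra generated by a self-adjoint \<open>A\<close> that is not a scalar contains a projection
  \<open>e\<close> different from \<open>0\<close> and \<open>1\<close>, so it suffices to find a self-adjoint \<open>B\<close> such that \<open>e\<close> and \<open>B\<close>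
  generate \<open>M\<close>; then \<open>T = A + \<i> B\<close> works. With respect to \<open>e\<close>, the operator \<open>B\<close> has two diagonal blocks and
  one off-diagonal block, all of which can be recovered from \<open>e\<close> and \<open>B\<close>. Fix a projection \<open>r \<le> e\<close> and
  decompose \<open>e\<close> and \<open>1 - e\<close> into copies of \<open>r\<close> and a smaller rest. Diagonal blocks with
  distinct eigenvalues on these copies single out all entries of the off-diagonal block. Some of the
  entries are used to obtain the partial isometries between the copies; the others can be chosen freely and
  must generate the corner \<open>r M r\<close>. If \<open>M\<close> has a minimal projection \<open>r\<close>, then this corner is scalar and nothing
  is needed. If \<open>M\<close> is infinite (and has no minimal projection), then \<open>r\<close> can be chosen
  with infinitely many free entries, which suffices because the predual is separable. In the remaining case
  \<open>M\<close> is of type II\<open>\<^sub>1\<close>; if \<open>r\<close> has trace \<open>1/k\<close>, then the number of free entries is of order \<open>k\<^sup>2\<close>, whereas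
  vanishing of Shen's invariant yields generators of \<open>r M r\<close> whose number is small compared to \<open>k\<^sup>2\<close>.\<close>

section \<open>Complex inner products, orthogonality and adjoints\<close>

text \<open>One row and one column of the off-diagonal block are spent on partial isometries, so
  \<open>m\<close> copies of \<open>r\<close> in \<open>e\<close> and \<open>n\<close> copies in
  \<open>1 - e\<close> leave \<open>(m - 1) * (n - 1)\<close> free positions. Nothing bounds
  \<open>e\<close> from below, and this shapes each case. For infinite \<open>M\<close> it is enough
  that one side holds two copies and the other infinitely many. For type II1 the generators of the
  corner come from a partition into \<open>k\<close> projections equivalent to \<open>r\<close>: if
  \<open>u i\<close> carries \<open>r\<close> onto the \<open>i\<close>-th one, then the entries
  \<open>star (u i) * x * u j\<close> of the generators \<open>x\<close> of \<open>M\<close>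
  generate the corner, and the number of nonzero ones is \<open>k\<^sup>2\<close> times the quantity
  in Shen's invariant. So \<open>m\<close> and \<open>n\<close> must both grow in proportion to
  \<open>k\<close>, with a factor known before \<open>k\<close>. It comes from covering
  \<open>1\<close> by finitely many copies of \<open>e\<close> and a smaller rest, which bounds the
  trace of \<open>e\<close> from below for all traces at once. Multiplicities are measured by
  maximal orthogonal families of copies; comparability makes what they leave over smaller than
  \<open>r\<close>.\<close>

instance complex_hilbert \<subseteq> banach ..

context complex_hilbert
begin

lemma cinner_add_right: "cinner x (y + z) = cinner x y + cinner x z"
  by (metis cinner_commute cinner_add_left complex_cnj_add)

lemma cinner_scaleC_right: "cinner x (a *\<^sub>C y) = cnj a * cinner x y"
  by (metis cinner_commute cinner_scaleC_left complex_cnj_mult)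

lemma cinner_conv_inner: "cinner x y = Complex (inner x y) (- inner (\<i> *\<^sub>C x) y)"
  by (simp add: complex_eq_iff inner_cinner cinner_scaleC_left)

end

lemma scaleC_one [simp]: "1 *\<^sub>C (x :: 'h::complex_hilbert) = x"
  using scaleR_scaleC[of 1 x] by simp

lemma scaleC_minus_one: "(- 1) *\<^sub>C (x :: 'h::complex_hilbert) = - x"
  using scaleR_scaleC[of "- 1" x] by simp

lemma inner_scaleC_right: "inner (x :: 'h::complex_hilbert) (a *\<^sub>C y) = inner (cnj a *\<^sub>C x) y"
  by (simp add: inner_cinner cinner_scaleC_left cinner_scaleC_right)

text \<open>Orthogonal projection of \<open>t\<close> onto the closure of \<open>L\<close> in the Hilbert space of \<open>I\<close>-tuples, stated
  without introducing that space as a type.\<close>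

lemma tuple_projection:
  fixes L :: "('i \<Rightarrow> 'a::{real_inner,complete_space}) set" and t :: "'i \<Rightarrow> 'a"
  assumes "finite I" "L \<noteq> {}"
    and add: "\<And>g h. g \<in> L \<Longrightarrow> h \<in> L \<Longrightarrow> (\<lambda>i. g i + h i) \<in> L"
    and scale: "\<And>g c. g \<in> L \<Longrightarrow> (\<lambda>i. c *\<^sub>R g i) \<in> L"
  obtains G :: "nat \<Rightarrow> 'i \<Rightarrow> 'a" and z :: "'i \<Rightarrow> 'a"
  where "\<And>k. G k \<in> L" "\<And>i. i \<in> I \<Longrightarrow> (\<lambda>k. G k i) \<longlonglongrightarrow> z i"
    "\<And>g. g \<in> L \<Longrightarrow> (\<Sum>i\<in>I. inner (g i) (t i - z i)) = 0"
proof -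
  define Q where "Q g = (\<Sum>i\<in>I. (norm (t i - g i))\<^sup>2)" for g
  define d where "d = (INF g\<in>L. Q g)"
  have bdd: "bdd_below (Q ` L)"
    by (rule bdd_belowI[of _ 0]) (auto simp: Q_def intro: sum_nonneg)
  have d_le: "d \<le> Q g" if "g \<in> L" for g
    unfolding d_def by (rule cINF_lower[OF bdd that])
  have "\<exists>g\<in>L. Q g < d + 1 / real (Suc k)" for k
  proof (rule ccontr)
    assume "\<not> ?thesis"
    then have "d + 1 / real (Suc k) \<le> d"
      unfolding d_def using \<open>L \<noteq> {}\<close> by (intro cINF_greatest) (auto simp: not_less d_def)
    then show False
      by (simp add: field_simps)
  qed
  then obtain G where G: "\<And>k. G k \<in> L" "\<And>k. Q (G k) < d + 1 / real (Suc k)"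
    by metis
  have para: "(\<Sum>i\<in>I. (norm (G k i - G l i))\<^sup>2) \<le> 2 / real (Suc k) + 2 / real (Suc l)" for k l
  proof -
    define m where "m = (\<lambda>i. (1/2) *\<^sub>R (G k i + G l i))"
    have "m \<in> L"
      unfolding m_def by (rule scale, rule add) (rule G)+
    \<comment> \<open>Parallelogram law for \<open>s - a\<close> and \<open>s - b\<close>. The
      midpoint \<open>m\<close> still has \<open>Q m \<ge> d\<close>, so near-minimisers are close
      to each other.\<close>
    have eq: "(norm (a - b))\<^sup>2 = 2 * (norm (s - a))\<^sup>2 + 2 * (norm (s - b))\<^sup>2 - 4 * (norm (s - (1/2) *\<^sub>R (a + b)))\<^sup>2"
      for a b s :: 'a
      unfolding power2_norm_eq_inner by (simp add: algebra_simps inner_commute)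
    have "(\<Sum>i\<in>I. (norm (G k i - G l i))\<^sup>2)
        = (\<Sum>i\<in>I. 2 * (norm (t i - G k i))\<^sup>2 + 2 * (norm (t i - G l i))\<^sup>2 - 4 * (norm (t i - m i))\<^sup>2)"
      by (rule sum.cong) (simp_all only: eq[of "G k _" "G l _" "t _"] m_def)
    also have "\<dots> = 2 * Q (G k) + 2 * Q (G l) - 4 * Q m"
      by (simp add: Q_def sum.distrib sum_subtractf sum_distrib_left)
    finally have "(\<Sum>i\<in>I. (norm (G k i - G l i))\<^sup>2) = 2 * Q (G k) + 2 * Q (G l) - 4 * Q m" .
    then show ?thesis
      using d_le[OF \<open>m \<in> L\<close>] G(2)[of k] G(2)[of l] by simp
  qed
  have "Cauchy (\<lambda>k. G k i)" if "i \<in> I" for i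
  proof (rule metric_CauchyI)
    fix e :: real
    assume "e > 0"
    then obtain N where N: "real N > 4 / e\<^sup>2"
      using reals_Archimedean2 by blast
    have "dist (G k i) (G l i) < e" if "k \<ge> N" "l \<ge> N" for k l
    proof -
      have "(norm (G k i - G l i))\<^sup>2 \<le> (\<Sum>i\<in>I. (norm (G k i - G l i))\<^sup>2)"
        using \<open>finite I\<close> \<open>i \<in> I\<close> by (intro member_le_sum) auto
      also have "\<dots> \<le> 2 / real (Suc k) + 2 / real (Suc l)"
        by (rule para)
      also have "\<dots> \<le> 2 / real (Suc N) + 2 / real (Suc N)"
        using that by (intro add_mono divide_left_mono) auto
      also have "\<dots> < e\<^sup>2"
      proof -
        have "4 < real N * e\<^sup>2"
          using N \<open>e > 0\<close> by (simp add: field_simps)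
        also have "\<dots> \<le> real (Suc N) * e\<^sup>2"
          by (intro mult_right_mono) auto
        finally have "4 / real (Suc N) < e\<^sup>2"
          by (subst pos_divide_less_eq) (simp_all add: mult.commute del: of_nat_Suc)
        then show ?thesis
          by simp
      qed
      finally show ?thesis
        using \<open>e > 0\<close> by (simp add: dist_norm power2_less_imp_less)
    qed
    then show "\<exists>M. \<forall>m\<ge>M. \<forall>n\<ge>M. dist (G m i) (G n i) < e"
      by blast
  qed
  then have "\<forall>i\<in>I. \<exists>z. (\<lambda>k. G k i) \<longlonglongrightarrow> z"
    by (auto simp: Cauchy_convergent_iff convergent_def)
  then obtain z where z: "\<And>i. i \<in> I \<Longrightarrow> (\<lambda>k. G k i) \<longlonglongrightarrow> z i"
    by metis
  have "(\<Sum>i\<in>I. inner (g i) (t i - z i)) = 0" if "g \<in> L" for g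
  proof -
    define b where "b = (\<Sum>i\<in>I. inner (g i) (t i - z i))"
    define c where "c = (\<Sum>i\<in>I. inner (g i) (g i))"
    have "c \<ge> 0"
      unfolding c_def by (intro sum_nonneg) auto
    have lim1: "(\<lambda>k. Q (G k)) \<longlonglongrightarrow> d"
    proof (rule real_tendsto_sandwich[of "\<lambda>_. d" _ _ "\<lambda>k. d + 1 / real (Suc k)"])
      show "(\<lambda>k. d + 1 / real (Suc k)) \<longlonglongrightarrow> d"
        using tendsto_add[OF tendsto_const LIMSEQ_Suc[OF lim_1_over_n], of d] by simp
    qed (use d_le G in \<open>auto intro!: always_eventually less_imp_le\<close>)
    have key: "0 \<le> - 2 * s * b + s\<^sup>2 * c" for s
    proof -
      have "(\<lambda>i. G k i + s *\<^sub>R g i) \<in> L" for k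
        by (intro add G(1) scale that)
      then have "d \<le> Q (\<lambda>i. G k i + s *\<^sub>R g i)" for k
        by (rule d_le)
      moreover have "Q (\<lambda>i. G k i + s *\<^sub>R g i)
          = Q (G k) - 2 * s * (\<Sum>i\<in>I. inner (g i) (t i - G k i)) + s\<^sup>2 * c" for k
        unfolding Q_def c_def power2_norm_eq_inner
        by (simp add: sum.distrib sum_subtractf sum_distrib_left algebra_simps inner_commute power2_eq_square)
      ultimately have le: "d \<le> Q (G k) - 2 * s * (\<Sum>i\<in>I. inner (g i) (t i - G k i)) + s\<^sup>2 * c" for k
        by simp
      have "(\<lambda>k. Q (G k) - 2 * s * (\<Sum>i\<in>I. inner (g i) (t i - G k i)) + s\<^sup>2 * c)
          \<longlonglongrightarrow> d - 2 * s * b + s\<^sup>2 * c"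
        unfolding b_def by (intro tendsto_intros lim1 z)
      then have "d \<le> d - 2 * s * b + s\<^sup>2 * c"
        by (rule LIMSEQ_le_const) (use le in auto)
      then show ?thesis
        by simp
    qed
    have "b = 0"
    proof (rule ccontr)
      assume "b \<noteq> 0"
      \<comment> \<open>The quadratic \<open>- 2 * s * b + s\<^sup>2 * c\<close> would be negative
        near \<open>s = b / c\<close>; \<open>c + 1\<close> replaces the divisor \<open>c\<close>,
        which may vanish.\<close>
      define u where "u = c + 1"
      have "u > 0" "c \<le> u"
        using \<open>c \<ge> 0\<close> by (auto simp: u_def)
      have "(b / u)\<^sup>2 * c \<le> (b / u)\<^sup>2 * u"
        using \<open>c \<le> u\<close> by (intro mult_left_mono) auto
      also have "\<dots> = b\<^sup>2 / u"
        using \<open>u > 0\<close> by (simp add: power2_eq_square)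
      finally have "0 \<le> - 2 * (b / u) * b + b\<^sup>2 / u"
        using key[of "b / u"] by linarith
      also have "\<dots> = - (b\<^sup>2 / u)"
        by (simp add: power2_eq_square)
      also have "\<dots> < 0"
        using \<open>b \<noteq> 0\<close> \<open>u > 0\<close> by simp
      finally show False
        by simp
    qed
    then show ?thesis
      by (simp add: b_def)
  qed
  with G(1) z show ?thesis
    by (rule that)
qed

text \<open>The kernel of \<open>f\<close> enters \<open>tuple_projection\<close> as a space of
  \<open>unit\<close>-tuples and is closed by continuity. A vector of value 1 minus its projection
  is orthogonal to the kernel; rescaled, it represents \<open>f\<close>.\<close>

lemma riesz_representation:
  fixes f :: "'a::{real_inner,complete_space} \<Rightarrow> real"
  assumes "bounded_linear f"
  shows "\<exists>z. \<forall>x. f x = inner x z"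
proof (cases "\<forall>x. f x = 0")
  case True
  then show ?thesis
    by (intro exI[of _ 0]) simp
next
  case False
  interpret f: bounded_linear f by fact
  from False obtain t0 where "f t0 \<noteq> 0" by blast
  define t where "t = (1 / f t0) *\<^sub>R t0"
  have "f t = 1"
    using \<open>f t0 \<noteq> 0\<close> by (simp add: t_def f.scaleR)
  define L where "L = {g :: unit \<Rightarrow> 'a. f (g ()) = 0}"
  obtain G z where G: "\<And>k. G k \<in> L" "\<And>i. i \<in> {()} \<Longrightarrow> (\<lambda>k. G k i) \<longlonglongrightarrow> z i"
    "\<And>g. g \<in> L \<Longrightarrow> (\<Sum>i\<in>{()}. inner (g i) (t - z i)) = 0"
  proof (rule tuple_projection[of "{()}" L "\<lambda>_. t"])
    have "(\<lambda>_. 0) \<in> L"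
      by (simp add: L_def f.zero)
    then show "L \<noteq> {}"
      by blast
  qed (auto simp: L_def f.add f.scaleR)
  define y where "y = t - z ()"
  have "(\<lambda>k. f (G k ())) \<longlonglongrightarrow> f (z ())"
    by (rule f.tendsto) (use G(2) in auto)
  moreover have "f (G k ()) = 0" for k
    using G(1)[of k] by (simp add: L_def)
  ultimately have "f (z ()) = 0"
    by (simp add: LIMSEQ_const_iff)
  then have "f y = 1"
    by (simp add: y_def f.diff \<open>f t = 1\<close>)
  then have "y \<noteq> 0"
    using f.zero by auto
  have "f x = inner x ((1 / inner y y) *\<^sub>R y)" for x
  proof -
    have "(\<lambda>_. x - f x *\<^sub>R y) \<in> L"
      by (simp add: L_def f.diff f.scaleR \<open>f y = 1\<close>)
    from G(3)[OF this] show ?thesis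
      using \<open>y \<noteq> 0\<close> by (simp add: y_def[symmetric] inner_diff_left)
  qed
  then show ?thesis
    by blast
qed

text \<open>Riesz for the real inner product only gives the real adjoint. The imaginary part of
  \<open>cinner x y\<close> is \<open>- inner (\<i> *\<^sub>C x) y\<close>, so for complex-linear
  \<open>T\<close> the real adjoint is already the complex one.\<close>

lemma adjoint_exists:
  fixes T :: "('h::complex_hilbert) operator"
  assumes "clinear_op T"
  shows "\<exists>S. clinear_op S \<and> (\<forall>x y. cinner (T x) y = cinner x (S y))"
proof -
  have "\<exists>z. \<forall>x. inner (T x) y = inner x z" for y
    by (rule riesz_representation) (intro bounded_linear_intros)
  then obtain S where S: "\<And>x y. inner (T x) y = inner x (S y)"
    by metis
  have inj: "u = v" if "\<And>x. inner x u = inner x (v :: 'h)" for u v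
  proof -
    have "inner (u - v) (u - v) = inner (u - v) u - inner (u - v) v"
      by (rule inner_diff_right)
    also have "\<dots> = 0"
      using that[of "u - v"] by (rule right_minus_eq[THEN iffD2])
    finally show "u = v"
      by (simp only: inner_eq_zero_iff right_minus_eq)
  qed
  have Sadd: "S (x + y) = S x + S y" for x y
    by (rule inj) (simp add: inner_add_right S[symmetric])
  have SscaleC: "S (a *\<^sub>C y) = a *\<^sub>C S y" for a y
    using assms by (intro inj) (simp add: inner_scaleC_right S[symmetric] clinear_op_def)
  have "norm (S y) \<le> norm y * norm T" for y
  proof -
    have "(norm (S y))\<^sup>2 = inner (T (S y)) y"
      by (simp add: S power2_norm_eq_inner)
    also have "\<dots> \<le> norm (T (S y)) * norm y"
      by (rule norm_cauchy_schwarz)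
    also have "\<dots> \<le> norm T * norm (S y) * norm y"
      by (intro mult_right_mono norm_blinfun) auto
    finally have "norm (S y) * norm (S y) \<le> norm (S y) * (norm y * norm T)"
      by (simp add: power2_eq_square mult_ac)
    then show ?thesis
      by (cases "norm (S y) = 0") auto
  qed
  then have "bounded_linear S"
    by (intro bounded_linear_intro[where K = "norm T"]) (auto simp: Sadd SscaleC scaleR_scaleC)
  then have "clinear_op (Blinfun S)" "cinner (T x) y = cinner x (Blinfun S y)" for x y
  proof -
    show "clinear_op (Blinfun S)"
      using \<open>bounded_linear S\<close> by (simp add: clinear_op_def bounded_linear_Blinfun_apply SscaleC)
    have "\<i> *\<^sub>C T x = T (\<i> *\<^sub>C x)"
      using assms by (simp add: clinear_op_def)
    then show "cinner (T x) y = cinner x (Blinfun S y)"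
      using \<open>bounded_linear S\<close> by (simp add: bounded_linear_Blinfun_apply cinner_conv_inner S)
  qed
  then show ?thesis
    by blast
qed

lemma cinner_eqI:
  fixes u v :: "'h::complex_hilbert"
  assumes "\<And>x. cinner x u = cinner x v"
  shows "u = v"
proof -
  have "inner (u - v) u = inner (u - v) v"
    by (simp add: inner_cinner assms)
  then have "inner (u - v) (u - v) = 0"
    by (simp only: inner_diff_right right_minus_eq)
  then show ?thesis
    by (simp only: inner_eq_zero_iff right_minus_eq)
qed

lemma adj_eqI:
  fixes S T :: "('h::complex_hilbert) operator"
  assumes "\<And>x y. cinner (T x) y = cinner x (S y)"
  shows "adj T = S"
  unfolding adj_def
proof (rule the_equality)
  show "R = S" if "\<forall>x y. cinner (T x) y = cinner x (R y)" for R :: "'h operator"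
  proof (rule blinfun_eqI, rule cinner_eqI)
    show "cinner x (R y) = cinner x (S y)" for x y
      using assms[of x y] that by simp
  qed
qed (use assms in auto)

lemma
  fixes T :: "('h::complex_hilbert) operator"
  assumes "clinear_op T"
  shows clinear_op_adj: "clinear_op (adj T)"
    and cinner_adj: "cinner (T x) y = cinner x (adj T y)"
proof -
  obtain S where "clinear_op S" "\<And>x y. cinner (T x) y = cinner x (S y)"
    using adjoint_exists[OF assms] by blast
  with adj_eqI[of T S] show "clinear_op (adj T)" "cinner (T x) y = cinner x (adj T y)"
    by simp_all
qed

section \<open>The algebra of complex-linear operators\<close>

text \<open>Every element of this type has an adjoint, so a total \<open>star\<close> becomes
  available together with the ring and Banach space structure.\<close>

typedef (overloaded) 'h cop = "{T :: ('h::complex_hilbert) operator. clinear_op T}"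
  by (rule exI[of _ 0]) (simp add: clinear_op_def, metis scaleC_scaleC scaleR_scaleC mult_zero_right of_real_0 scaleR_zero_left)

setup_lifting type_definition_cop

lemma scaleC_zero_right [simp]: "a *\<^sub>C (0 :: 'h::complex_hilbert) = 0"
  using scaleC_add_right[of a 0 "0 :: 'h"] by simp

lemma scaleC_minus_right: "a *\<^sub>C (- x :: 'h::complex_hilbert) = - (a *\<^sub>C x)"
  using scaleC_add_right[of a x "- x"] by (simp add: eq_neg_iff_add_eq_0 add.commute)

lemma scaleC_diff_right: "a *\<^sub>C (x - y :: 'h::complex_hilbert) = a *\<^sub>C x - a *\<^sub>C y"
  using scaleC_add_right[of a x "- y"] by (simp add: scaleC_minus_right)

instantiation cop :: (complex_hilbert) "{ring, monoid_mult, real_normed_algebra}"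
begin

lift_definition zero_cop :: "'a cop" is 0 by (simp add: clinear_op_def)
lift_definition one_cop :: "'a cop" is id_blinfun by (simp add: clinear_op_def)
lift_definition plus_cop :: "'a cop \<Rightarrow> 'a cop \<Rightarrow> 'a cop" is "(+)"
  by (simp add: clinear_op_def scaleC_add_right blinfun.add_left)
lift_definition minus_cop :: "'a cop \<Rightarrow> 'a cop \<Rightarrow> 'a cop" is "(-)"
  by (simp add: clinear_op_def scaleC_diff_right blinfun.diff_left)
lift_definition uminus_cop :: "'a cop \<Rightarrow> 'a cop" is "uminus"
  by (simp add: clinear_op_def scaleC_minus_right blinfun.minus_left)
lift_definition times_cop :: "'a cop \<Rightarrow> 'a cop \<Rightarrow> 'a cop" is "(o\<^sub>L)"
  by (simp add: clinear_op_def)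
lift_definition scaleR_cop :: "real \<Rightarrow> 'a cop \<Rightarrow> 'a cop" is "(*\<^sub>R)"
  by (simp add: clinear_op_def blinfun.scaleR_left scaleR_scaleC scaleC_scaleC mult.commute)
lift_definition norm_cop :: "'a cop \<Rightarrow> real" is norm .
definition dist_cop :: "'a cop \<Rightarrow> 'a cop \<Rightarrow> real" where "dist_cop a b = norm (a - b)"
definition uniformity_cop :: "('a cop \<times> 'a cop) filter"
  where "uniformity_cop = (INF e\<in>{0<..}. principal {(x, y). dist x y < e})"
definition open_cop :: "'a cop set \<Rightarrow> bool"
  where "open_cop U = (\<forall>x\<in>U. \<forall>\<^sub>F (x', y) in uniformity. x' = x \<longrightarrow> y \<in> U)"
definition sgn_cop :: "'a cop \<Rightarrow> 'a cop" where "sgn_cop x = scaleR (inverse (norm x)) x"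

instance
proof
  fix a b c :: "'a cop" and r s :: real
  show "a * b * c = a * (b * c)" by transfer (auto intro: blinfun_eqI)
  show "a + b + c = a + (b + c)" "a + b = b + a" "0 + a = a" "- a + a = 0" "a - b = a + - b"
    by (transfer; simp)+
  show "(a + b) * c = a * c + b * c" "a * (b + c) = a * b + a * c"
    by (transfer; simp add: bounded_bilinear.add_left[OF bounded_bilinear_blinfun_compose] bounded_bilinear.add_right[OF bounded_bilinear_blinfun_compose])+
  show "1 * a = a" "a * 1 = a" by (transfer; auto intro: blinfun_eqI)+
  show "r *\<^sub>R (a + b) = r *\<^sub>R a + r *\<^sub>R b" "(r + s) *\<^sub>R a = r *\<^sub>R a + s *\<^sub>R a"
    "r *\<^sub>R s *\<^sub>R a = (r * s) *\<^sub>R a" "1 *\<^sub>R a = a"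
    by (transfer; simp add: scaleR_add_right scaleR_add_left)+
  show "r *\<^sub>R a * b = r *\<^sub>R (a * b)" "a * r *\<^sub>R b = r *\<^sub>R (a * b)"
    by (transfer; simp add: bounded_bilinear.scaleR_left[OF bounded_bilinear_blinfun_compose] bounded_bilinear.scaleR_right[OF bounded_bilinear_blinfun_compose])+
  show "norm a = 0 \<longleftrightarrow> a = 0" "norm (a + b) \<le> norm a + norm b" "norm (r *\<^sub>R a) = \<bar>r\<bar> * norm a"
    by (transfer; simp add: norm_triangle_ineq)+
  show "norm (a * b) \<le> norm a * norm b"
    by (transfer; rule norm_blinfun_compose)
qed (simp_all add: dist_cop_def uniformity_cop_def open_cop_def sgn_cop_def)

end

lift_definition ap :: "('h::complex_hilbert) cop \<Rightarrow> 'h \<Rightarrow> 'h"  (infixl "\<cdot>" 90)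
  is blinfun_apply .

lift_definition star :: "('h::complex_hilbert) cop \<Rightarrow> 'h cop"
  is adj by (rule clinear_op_adj)

lift_definition cscale :: "complex \<Rightarrow> ('h::complex_hilbert) cop \<Rightarrow> 'h cop"
  is scale_op by (simp add: clinear_op_def scale_op.rep_eq scaleC_scaleC mult.commute)

lemma cop_eqI: "(\<And>x. S \<cdot> x = T \<cdot> x) \<Longrightarrow> S = T"
  by transfer (auto intro: blinfun_eqI)

lemma bounded_linear_ap: "bounded_linear (ap T)"
  by transfer (rule blinfun.bounded_linear_right)

lemma norm_ap: "norm (T \<cdot> x) \<le> norm T * norm x"
  by transfer (rule norm_blinfun)

lemma norm_le_ap:
  assumes "K \<ge> 0" "\<And>x. norm (T \<cdot> x) \<le> K * norm x"
  shows "norm T \<le> K"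
  using assms by transfer (rule norm_blinfun_bound)

lemma ap_linear [simp]:
  "(S + T) \<cdot> x = S \<cdot> x + T \<cdot> x" "(S - T) \<cdot> x = S \<cdot> x - T \<cdot> x" "(- S) \<cdot> x = - (S \<cdot> x)"
  "(S * T) \<cdot> x = S \<cdot> (T \<cdot> x)" "1 \<cdot> x = x" "0 \<cdot> x = 0" "(r *\<^sub>R S) \<cdot> x = r *\<^sub>R (S \<cdot> x)"
  "cscale c S \<cdot> x = c *\<^sub>C (S \<cdot> x)"
  by (transfer; simp add: blinfun.bilinear_simps scale_op.rep_eq)+

lemma ap_linear_right [simp]:
  "S \<cdot> (x + y) = S \<cdot> x + S \<cdot> y" "S \<cdot> (x - y) = S \<cdot> x - S \<cdot> y" "S \<cdot> (- x) = - (S \<cdot> x)"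
  "S \<cdot> 0 = 0" "S \<cdot> (r *\<^sub>R x) = r *\<^sub>R (S \<cdot> x)" "S \<cdot> (c *\<^sub>C x) = c *\<^sub>C (S \<cdot> x)"
  by (transfer; simp add: blinfun.bilinear_simps clinear_op_def)+

lemma Cauchy_cop: "Cauchy X \<Longrightarrow> convergent (X :: nat \<Rightarrow> 'h::complex_hilbert cop)"
proof -
  assume X: "Cauchy X"
  have C: "Cauchy (\<lambda>n. Rep_cop (X n))"
    using X unfolding Cauchy_iff by transfer simp
  then obtain T where T: "(\<lambda>n. Rep_cop (X n)) \<longlonglongrightarrow> T"
    by (auto simp: Cauchy_convergent_iff convergent_def)
  have "clinear_op T"
    unfolding clinear_op_def
  proof (intro allI)
    fix c x
    have "(\<lambda>n. blinfun_apply (Rep_cop (X n)) (c *\<^sub>C x)) \<longlonglongrightarrow> blinfun_apply T (c *\<^sub>C x)"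
      by (intro blinfun.tendsto T tendsto_const)
    moreover have "blinfun_apply (Rep_cop (X n)) (c *\<^sub>C x) = c *\<^sub>C blinfun_apply (Rep_cop (X n)) x" for n
      using Rep_cop[of "X n"] by (simp add: clinear_op_def)
    moreover have "(\<lambda>n. c *\<^sub>C blinfun_apply (Rep_cop (X n)) x) \<longlonglongrightarrow> c *\<^sub>C blinfun_apply T x"
      by (intro bounded_linear.tendsto[OF bounded_linear_scaleC] blinfun.tendsto T tendsto_const)
    ultimately show "blinfun_apply T (c *\<^sub>C x) = c *\<^sub>C blinfun_apply T x"
      using LIMSEQ_unique by fastforce
  qed
  then have "X \<longlonglongrightarrow> Abs_cop T"
    using T unfolding LIMSEQ_iff by (simp add: norm_cop.rep_eq minus_cop.rep_eq Abs_cop_inverse)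
  then show ?thesis
    by (auto simp: convergent_def)
qed

instance cop :: (complex_hilbert) banach
  by standard (rule Cauchy_cop)

lemma cinner_star: "cinner (T \<cdot> x) y = cinner x (star T \<cdot> y)"
  by transfer (rule cinner_adj)

lemma inner_star: "inner (T \<cdot> x) y = inner x (star T \<cdot> y)"
  by (simp add: inner_cinner cinner_star)

lemma star_eqI: "(\<And>x y. cinner (T \<cdot> x) y = cinner x (S \<cdot> y)) \<Longrightarrow> star T = S"
  by transfer (rule adj_eqI)

lemma star_star [simp]: "star (star T) = T"
  by (rule star_eqI) (metis cinner_commute cinner_star)

lemma star_mult [simp]: "star (S * T) = star T * star S"
  by (rule star_eqI) (simp add: cinner_star)

lemma star_add [simp]: "star (S + T) = star S + star T"
  by (rule star_eqI) (simp add: cinner_star cinner_add_left cinner_add_right)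

lemma star_scaleR [simp]: "star (r *\<^sub>R S) = r *\<^sub>R star S"
  by (rule star_eqI) (simp add: cinner_star cinner_scaleC_left cinner_scaleC_right scaleR_scaleC)

lemma star_cscale [simp]: "star (cscale c S) = cscale (cnj c) (star S)"
  by (rule star_eqI) (simp add: cinner_star cinner_scaleC_left cinner_scaleC_right)

lemma star_one [simp]: "star 1 = 1"
  by (rule star_eqI) simp

lemma star_minus [simp]: "star (- S) = - star S"
  using star_scaleR[of "- 1" S] by simp

lemma star_diff [simp]: "star (S - T) = star S - star T"
  using star_add[of S "- T"] by simp

lemma star_zero [simp]: "star 0 = 0"
  using star_diff[of 0 0] by simp

lemma star_sum: "star (\<Sum>i\<in>I. S i) = (\<Sum>i\<in>I. star (S i))"
  by (induction I rule: infinite_finite_induct) auto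

lemma star_power: "star (S ^ n) = star S ^ n"
  by (induction n) (auto simp: power_commutes)

lemma star_eq_0_iff [simp]: "star S = 0 \<longleftrightarrow> S = 0"
  by (metis star_star star_zero)

lemma norm_star [simp]: "norm (star T) = norm T"
proof -
  have "norm (star T) \<le> norm T" for T :: "'a cop"
  proof (rule norm_le_ap)
    fix x
    have "(norm (star T \<cdot> x))\<^sup>2 = inner (T \<cdot> (star T \<cdot> x)) x"
      by (simp add: power2_norm_eq_inner inner_star)
    also have "\<dots> \<le> norm (T \<cdot> (star T \<cdot> x)) * norm x"
      by (rule norm_cauchy_schwarz)
    also have "\<dots> \<le> norm T * norm (star T \<cdot> x) * norm x"
      by (intro mult_right_mono norm_ap) auto
    finally have "norm (star T \<cdot> x) * norm (star T \<cdot> x) \<le> norm (star T \<cdot> x) * (norm T * norm x)"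
      by (simp add: power2_eq_square mult_ac)
    then show "norm (star T \<cdot> x) \<le> norm T * norm x"
      by (cases "norm (star T \<cdot> x) = 0") auto
  qed simp
  from this[of T] this[of "star T"] show ?thesis
    by simp
qed

lemma bounded_linear_star: "bounded_linear star"
  by (rule bounded_linear_intro[where K = 1]) auto

lemma norm_ap_eq: "(norm (T \<cdot> x))\<^sup>2 = inner ((star T * T) \<cdot> x) x"
  by (simp add: power2_norm_eq_inner inner_star)

lemma star_mult_self_eq_0 [simp]: "star T * T = 0 \<longleftrightarrow> T = 0"
proof
  assume "star T * T = 0"
  then have "norm (T \<cdot> x) = 0" for x
    using norm_ap_eq[of T x] by simp
  then show "T = 0"
    by (intro cop_eqI) simp
qed simp

text \<open>Polarisation at \<open>x\<close> and \<open>C \<cdot> x\<close>: the mixed term is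
  \<open>2 * inner (C \<cdot> x) (C \<cdot> x)\<close>.\<close>

lemma selfadjoint_eq_0:
  assumes "star C = C" "\<And>x. inner (C \<cdot> x) x = 0"
  shows "C = 0"
proof (rule cop_eqI)
  fix x
  have "inner (C \<cdot> (x + y)) (x + y) = inner (C \<cdot> x) x + 2 * inner (C \<cdot> x) y + inner (C \<cdot> y) y" for y
    using inner_star[of C y x] assms(1) by (simp add: inner_add_left inner_add_right inner_commute)
  from this[of "C \<cdot> x"] have "inner (C \<cdot> x) (C \<cdot> x) = 0"
    unfolding assms(2) by simp
  then show "C \<cdot> x = 0 \<cdot> x"
    by simp
qed

section \<open>Square roots, polar decomposition and orthogonal sums\<close>

text \<open>\<open>strongly_closed\<close> is closedness in the strong operator topology, expressed
  by its basic neighbourhoods: finitely many vectors and one radius.\<close>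

locale vna =
  fixes N :: "('h::complex_hilbert) cop set"
  assumes one [simp, intro]: "1 \<in> N"
    and add [simp, intro]: "S \<in> N \<Longrightarrow> T \<in> N \<Longrightarrow> S + T \<in> N"
    and mult [simp, intro]: "S \<in> N \<Longrightarrow> T \<in> N \<Longrightarrow> S * T \<in> N"
    and cscale [simp, intro]: "T \<in> N \<Longrightarrow> cscale c T \<in> N"
    and star [simp, intro]: "T \<in> N \<Longrightarrow> star T \<in> N"
    and strongly_closed:
      "(\<And>F e. finite F \<Longrightarrow> e > 0 \<Longrightarrow> \<exists>S\<in>N. \<forall>x\<in>F. norm (T \<cdot> x - S \<cdot> x) < e) \<Longrightarrow> T \<in> N"
begin

lemma scaleR [simp, intro]: "T \<in> N \<Longrightarrow> r *\<^sub>R T \<in> N"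
proof -
  assume "T \<in> N"
  have "r *\<^sub>R T = cscale (complex_of_real r) T"
    by (rule cop_eqI) (simp add: scaleR_scaleC)
  with \<open>T \<in> N\<close> show ?thesis
    by simp
qed

lemma zero [simp, intro]: "0 \<in> N"
  using scaleR[OF one, of 0] by simp

lemma uminus [simp, intro]: "T \<in> N \<Longrightarrow> - T \<in> N"
  using scaleR[of T "- 1"] by simp

lemma diff [simp, intro]: "S \<in> N \<Longrightarrow> T \<in> N \<Longrightarrow> S - T \<in> N"
  using add[of S "- T"] by simp

lemma sum [intro]: "(\<And>i. i \<in> I \<Longrightarrow> X i \<in> N) \<Longrightarrow> (\<Sum>i\<in>I. X i) \<in> N"
  by (induction I rule: infinite_finite_induct) auto

lemma power [simp, intro]: "T \<in> N \<Longrightarrow> T ^ n \<in> N"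
  by (induction n) auto

lemma strong_limit:
  assumes "\<And>n. X n \<in> N" "\<And>x. (\<lambda>n. X n \<cdot> x) \<longlonglongrightarrow> T \<cdot> x"
  shows "T \<in> N"
proof (rule strongly_closed)
  fix F :: "'h set" and e :: real
  assume "finite F" "e > 0"
  have "\<forall>x\<in>F. eventually (\<lambda>n. norm (T \<cdot> x - X n \<cdot> x) < e) sequentially"
    using assms(2) \<open>e > 0\<close> by (auto simp: tendsto_iff dist_norm norm_minus_commute)
  then have "eventually (\<lambda>n. \<forall>x\<in>F. norm (T \<cdot> x - X n \<cdot> x) < e) sequentially"
    by (rule eventually_ball_finite[OF \<open>finite F\<close>])
  then obtain n where "\<forall>x\<in>F. norm (T \<cdot> x - X n \<cdot> x) < e"
    by (auto simp: eventually_sequentially)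
  with assms(1) show "\<exists>S\<in>N. \<forall>x\<in>F. norm (T \<cdot> x - S \<cdot> x) < e"
    by blast
qed

text \<open>Weak and strong closure of a linear subspace coincide. The tuple of values of
  \<open>T\<close> on \<open>F\<close> is projected onto the closure of the tuples of values of
  \<open>N\<close>; the hypothesis, tested against the component \<open>T \<cdot> x - z x\<close>
  orthogonal to these tuples, makes that component vanish.\<close>

lemma weakly_closed:
  assumes "\<And>F \<eta> e. finite F \<Longrightarrow> e > 0 \<Longrightarrow> \<exists>S\<in>N. \<bar>\<Sum>x\<in>F. inner (T \<cdot> x - S \<cdot> x) (\<eta> x)\<bar> < e"
  shows "T \<in> N"
proof (rule strongly_closed)
  fix F :: "'h set" and e :: real
  assume "finite F" "e > 0"
  obtain G z where G: "\<And>k. G k \<in> ap ` N" "\<And>i. i \<in> F \<Longrightarrow> (\<lambda>k. G k i) \<longlonglongrightarrow> z i"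
    "\<And>g. g \<in> ap ` N \<Longrightarrow> (\<Sum>i\<in>F. inner (g i) (T \<cdot> i - z i)) = 0"
  proof (rule tuple_projection[OF \<open>finite F\<close>, of "ap ` N" "ap T"])
    show "(\<lambda>i. g i + h i) \<in> ap ` N" if "g \<in> ap ` N" "h \<in> ap ` N" for g h
      using that by (auto intro!: image_eqI[where x = "_ + _"])
    show "(\<lambda>i. c *\<^sub>R g i) \<in> ap ` N" if "g \<in> ap ` N" for g c
      using that by (auto intro!: image_eqI[where x = "c *\<^sub>R _"])
  qed auto
  have zero: "(\<Sum>x\<in>F. inner (T \<cdot> x) (T \<cdot> x - z x)) = 0"
  proof (rule ccontr)
    assume "\<not> ?thesis"
    then obtain S where "S \<in> N" and S: "\<bar>\<Sum>x\<in>F. inner (T \<cdot> x - S \<cdot> x) (T \<cdot> x - z x)\<bar>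
        < \<bar>\<Sum>x\<in>F. inner (T \<cdot> x) (T \<cdot> x - z x)\<bar>"
      using assms[OF \<open>finite F\<close>, of "\<bar>\<Sum>x\<in>F. inner (T \<cdot> x) (T \<cdot> x - z x)\<bar>" "\<lambda>x. T \<cdot> x - z x"]
      by auto
    have "(\<Sum>x\<in>F. inner (S \<cdot> x) (T \<cdot> x - z x)) = 0"
      using \<open>S \<in> N\<close> by (intro G(3)) auto
    with S show False
      by (simp add: inner_diff_left[of "T \<cdot> _" "S \<cdot> _"] sum_subtractf)
  qed
  have "(\<lambda>k. \<Sum>x\<in>F. inner (G k x) (T \<cdot> x - z x)) \<longlonglongrightarrow> (\<Sum>x\<in>F. inner (z x) (T \<cdot> x - z x))"
    by (intro tendsto_sum tendsto_inner G(2) tendsto_const)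
  then have "(\<Sum>x\<in>F. inner (z x) (T \<cdot> x - z x)) = 0"
    using G(3)[OF G(1)] by (simp add: LIMSEQ_const_iff)
  with zero have "(\<Sum>x\<in>F. inner (T \<cdot> x - z x) (T \<cdot> x - z x)) = 0"
    by (simp add: inner_diff_left[of "T \<cdot> _" "z _"] sum_subtractf)
  then have Tz: "\<forall>x\<in>F. T \<cdot> x = z x"
    using \<open>finite F\<close> by (subst (asm) sum_nonneg_eq_0_iff) auto
  have "\<forall>x\<in>F. eventually (\<lambda>k. norm (T \<cdot> x - G k x) < e) sequentially"
    using G(2) \<open>e > 0\<close> by (auto simp: tendsto_iff dist_norm norm_minus_commute Tz)
  then have "eventually (\<lambda>k. \<forall>x\<in>F. norm (T \<cdot> x - G k x) < e) sequentially"
    by (rule eventually_ball_finite[OF \<open>finite F\<close>])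
  then obtain k where k: "\<forall>x\<in>F. norm (T \<cdot> x - G k x) < e"
    by (auto simp: eventually_sequentially)
  obtain S where "S \<in> N" "G k = ap S"
    using G(1)[of k] by blast
  with k show "\<exists>S\<in>N. \<forall>x\<in>F. norm (T \<cdot> x - S \<cdot> x) < e"
    by auto
qed

end

section \<open>Limits of operators, intersections and commutants\<close>

lemma tendsto_ap: "X \<longlonglongrightarrow> T \<Longrightarrow> (\<lambda>n. X n \<cdot> x) \<longlonglongrightarrow> T \<cdot> x"
proof -
  have "bounded_linear (\<lambda>T. T \<cdot> x)"
    by (rule bounded_linear_intro[where K = "norm x"]) (auto simp: norm_ap)
  then show "X \<longlonglongrightarrow> T \<Longrightarrow> (\<lambda>n. X n \<cdot> x) \<longlonglongrightarrow> T \<cdot> x"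
    by (rule bounded_linear.tendsto)
qed

lemma tendsto_ap_right: "X \<longlonglongrightarrow> y \<Longrightarrow> (\<lambda>n. T \<cdot> X n) \<longlonglongrightarrow> T \<cdot> y"
  by (rule bounded_linear.tendsto[OF bounded_linear_ap])

lemma (in vna) norm_limit: "(\<And>n. X n \<in> N) \<Longrightarrow> X \<longlonglongrightarrow> T \<Longrightarrow> T \<in> N"
  by (rule strong_limit[of X]) (auto intro: tendsto_ap)

lemma (in vna) suminf_mem: "(\<And>n. X n \<in> N) \<Longrightarrow> summable X \<Longrightarrow> suminf X \<in> N"
  by (rule norm_limit[OF _ summable_LIMSEQ]) (auto intro: sum)

lemma vna_inter: "vna N1 \<Longrightarrow> vna N2 \<Longrightarrow> vna (N1 \<inter> N2)"
proof -
  assume "vna N1" "vna N2"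
  interpret N1: vna N1 by fact
  interpret N2: vna N2 by fact
  show ?thesis
  proof
    show "T \<in> N1 \<inter> N2"
      if "\<And>F e. finite F \<Longrightarrow> e > 0 \<Longrightarrow> \<exists>S\<in>N1 \<inter> N2. \<forall>x\<in>F. norm (T \<cdot> x - S \<cdot> x) < e" for T
    proof
      show "T \<in> N1"
        by (rule N1.strongly_closed) (use that in fast)
      show "T \<in> N2"
        by (rule N2.strongly_closed) (use that in fast)
    qed
  qed simp_all
qed

text \<open>For an element known to lie in every \<open>vna\<close> that contains some input, this
  turns membership into commutation, for instance of a square root of \<open>H * H\<close> with a
  self-adjoint \<open>H\<close>.\<close>

lemma vna_commutant:
  assumes "\<And>S. S \<in> X \<Longrightarrow> star S \<in> X"
  shows "vna {T. \<forall>S\<in>X. T * S = S * T}" (is "vna ?C")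
proof
  show "1 \<in> ?C"
    by simp
  show "S + T \<in> ?C" if "S \<in> ?C" "T \<in> ?C" for S T
    using that by (simp add: distrib_left distrib_right)
  show "S * T \<in> ?C" if "S \<in> ?C" "T \<in> ?C" for S T
  proof (intro CollectI ballI)
    fix R
    assume "R \<in> X"
    with that have "S * R = R * S" "T * R = R * T"
      by auto
    then show "S * T * R = R * (S * T)"
      by (metis mult.assoc)
  qed
  show "star T \<in> ?C" if "T \<in> ?C" for T
  proof (intro CollectI ballI)
    fix R
    assume "R \<in> X"
    then have "T * star R = star R * T"
      using that assms by simp
    then have "star (T * star R) = star (star R * T)"
      by simp
    then show "star T * R = R * star T"
      by simp
  qed
  show "cscale c T \<in> ?C" if "T \<in> ?C" for c T
  proof (intro CollectI ballI)
    fix R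
    assume "R \<in> X"
    with that have "T * R = R * T"
      by auto
    moreover have "cscale c T * R = cscale c (T * R)" "R * cscale c T = cscale c (R * T)"
      by (rule cop_eqI; simp)+
    ultimately show "cscale c T * R = R * cscale c T"
      by simp
  qed
  show "T \<in> ?C"
    if approx: "\<And>F e. finite F \<Longrightarrow> e > 0 \<Longrightarrow> \<exists>S\<in>?C. \<forall>x\<in>F. norm (T \<cdot> x - S \<cdot> x) < e" for T
  proof (intro CollectI ballI cop_eqI)
    fix S x
    assume "S \<in> X"
    have "norm ((T * S - S * T) \<cdot> x) \<le> 0 + e" if "e > 0" for e :: real
    proof -
      define d where "d = e / (1 + norm S)"
      have "1 + norm S > 0"
        by (simp add: add_pos_nonneg)
      then have "d > 0"
        using \<open>e > 0\<close> by (simp add: d_def)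
      then obtain R where "R \<in> ?C" "\<forall>y\<in>{x, S \<cdot> x}. norm (T \<cdot> y - R \<cdot> y) < d"
        using approx[of "{x, S \<cdot> x}" d] by blast
      then have R: "R * S = S * R" "norm (T \<cdot> x - R \<cdot> x) < d" "norm (T \<cdot> (S \<cdot> x) - R \<cdot> (S \<cdot> x)) < d"
        using \<open>S \<in> X\<close> by simp_all
      have "R \<cdot> (S \<cdot> x) = S \<cdot> (R \<cdot> x)"
        using arg_cong[OF R(1), of "\<lambda>A. A \<cdot> x"] by simp
      then have "(T * S - S * T) \<cdot> x = (T \<cdot> (S \<cdot> x) - R \<cdot> (S \<cdot> x)) - S \<cdot> (T \<cdot> x - R \<cdot> x)"
        by simp
      also have "norm \<dots> \<le> norm (T \<cdot> (S \<cdot> x) - R \<cdot> (S \<cdot> x)) + norm (S \<cdot> (T \<cdot> x - R \<cdot> x))"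
        by (rule norm_triangle_ineq4)
      also have "\<dots> \<le> d + norm S * d"
        using R by (intro add_mono order.trans[OF norm_ap] mult_left_mono) auto
      also have "\<dots> = (1 + norm S) * d"
        by (simp add: algebra_simps)
      also have "\<dots> = e"
        using \<open>1 + norm S > 0\<close> by (simp add: d_def)
      finally show ?thesis
        by simp
    qed
    then have "norm ((T * S - S * T) \<cdot> x) \<le> 0"
      by (rule field_le_epsilon)
    then show "(T * S) \<cdot> x = (S * T) \<cdot> x"
      by simp
  qed
qed

lemma strong_limit_exists:
  fixes X :: "nat \<Rightarrow> ('h::complex_hilbert) cop"
  assumes "\<And>n. norm (X n) \<le> K" "\<And>x. Cauchy (\<lambda>n. X n \<cdot> x)"
  obtains T where "norm T \<le> K" "\<And>x. (\<lambda>n. X n \<cdot> x) \<longlonglongrightarrow> T \<cdot> x"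
proof -
  have "\<forall>x. \<exists>y. (\<lambda>n. X n \<cdot> x) \<longlonglongrightarrow> y"
    using assms(2) by (simp add: Cauchy_convergent_iff convergent_def)
  then obtain f where f: "\<And>x. (\<lambda>n. X n \<cdot> x) \<longlonglongrightarrow> f x"
    by metis
  have "K \<ge> 0"
    using assms(1)[of 0] norm_ge_zero order_trans by blast
  have fK: "norm (f x) \<le> K * norm x" for x
  proof (rule LIMSEQ_le_const2[OF tendsto_norm[OF f]])
    have "norm (X n \<cdot> x) \<le> K * norm x" for n
      using norm_ap[of "X n" x] mult_right_mono[OF assms(1)[of n], of "norm x"] by simp
    then show "\<exists>N. \<forall>n\<ge>N. norm (X n \<cdot> x) \<le> K * norm x"
      by blast
  qed
  have fadd: "f (x + y) = f x + f y" for x y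
    using LIMSEQ_unique[OF f[of "x + y"]] tendsto_add[OF f[of x] f[of y]] by simp
  have fsc: "f (c *\<^sub>C x) = c *\<^sub>C f x" for c x
    using LIMSEQ_unique[OF f[of "c *\<^sub>C x"]] bounded_linear.tendsto[OF bounded_linear_scaleC f[of x]] by simp
  have "bounded_linear f"
    using fK by (intro bounded_linear_intro[where K = K]) (auto simp: fadd fsc scaleR_scaleC mult.commute)
  then have "clinear_op (Blinfun f)"
    by (simp add: clinear_op_def bounded_linear_Blinfun_apply fsc)
  then have ap: "Abs_cop (Blinfun f) \<cdot> x = f x" for x
    using \<open>bounded_linear f\<close> by (simp add: ap.rep_eq Abs_cop_inverse bounded_linear_Blinfun_apply)
  show thesis
    by (rule that[of "Abs_cop (Blinfun f)"]) (auto simp: ap f fK \<open>K \<ge> 0\<close> intro: norm_le_ap)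
qed

text \<open>The iteration \<open>Y\<^sub>n\<^sub>+\<^sub>1 = (X + Y\<^sub>n\<^sup>2) / 2\<close> with \<open>X = 1 - S\<close> is dominated in norm by the same
  iteration for the number \<open>1\<close> in place of \<open>X\<close>, hence it converges in norm.\<close>

lemma sqrt_exists:
  fixes S :: "('h::complex_hilbert) cop"
  assumes "star S = S" "norm (1 - S) \<le> 1"
  obtains R where "star R = R" "R * R = S" "norm (1 - R) \<le> 1" "\<And>N. vna N \<Longrightarrow> S \<in> N \<Longrightarrow> R \<in> N"
proof -
  define X where "X = 1 - S"
  define Y where "Y = rec_nat 0 (\<lambda>_ Y. (1/2) *\<^sub>R (X + Y * Y))"
  define y :: "nat \<Rightarrow> real" where "y = rec_nat 0 (\<lambda>_ y. (1 + y * y) / 2)"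
  have Y: "Y 0 = 0" "Y (Suc n) = (1/2) *\<^sub>R (X + Y n * Y n)" for n
    by (simp_all add: Y_def)
  have y: "y 0 = 0" "y (Suc n) = (1 + y n * y n) / 2" for n
    by (simp_all add: y_def)
  have y01: "0 \<le> y n" "y n \<le> 1" for n
  proof (induction n)
    case (Suc n)
    { case 1 then show ?case using Suc by (simp add: y) }
    { case 2
      have "y n * y n \<le> 1 * 1"
        using Suc by (intro mult_mono) auto
      then show ?case by (simp add: y) }
  qed (simp_all add: y)
  have comm: "Y n * Z = Z * Y n" if "X * Z = Z * X" for n Z
  proof (induction n)
    case (Suc n)
    have "Y n * Y n * Z = Z * (Y n * Y n)"
      by (metis Suc mult.assoc)
    with that show ?case
      by (simp add: Y algebra_simps)
  qed (simp add: Y)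
  have commY: "Y m * Y n = Y n * Y m" for m n
    by (rule comm) (rule comm[symmetric], simp)
  have normX: "norm X \<le> 1"
    using assms(2) by (simp add: X_def)
  have normY: "norm (Y n) \<le> y n" for n
  proof (induction n)
    case (Suc n)
    have "norm (X + Y n * Y n) \<le> norm X + norm (Y n) * norm (Y n)"
      using norm_triangle_ineq[of X "Y n * Y n"] norm_mult_ineq[of "Y n" "Y n"] by simp
    also have "\<dots> \<le> 1 + y n * y n"
      by (intro add_mono normX mult_mono Suc y01) auto
    finally show ?case
      by (simp add: Y y)
  qed (simp add: Y y)
  have normYd: "norm (Y (Suc n) - Y n) \<le> y (Suc n) - y n" for n
  proof (induction n)
    case 0
    then show ?case using normX by (simp add: Y y)
  next
    case (Suc n)
    have "Y (Suc (Suc n)) - Y (Suc n) = (1/2) *\<^sub>R (Y (Suc n) * Y (Suc n) - Y n * Y n)"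
      by (simp add: Y(2)[of "Suc n"] Y(2)[of n] scaleR_add_right scaleR_diff_right)
    \<comment> \<open>The iterates are polynomials in \<open>X\<close>, so they commute and the
      difference of squares factors as for numbers.\<close>
    also have "Y (Suc n) * Y (Suc n) - Y n * Y n = (Y (Suc n) - Y n) * (Y (Suc n) + Y n)"
      using commY[of "Suc n" n] by (simp add: algebra_simps)
    also have "norm ((1/2) *\<^sub>R ((Y (Suc n) - Y n) * (Y (Suc n) + Y n)))
        \<le> (1/2) * (norm (Y (Suc n) - Y n) * norm (Y (Suc n) + Y n))"
      using norm_mult_ineq by simp
    also have "\<dots> \<le> (1/2) * ((y (Suc n) - y n) * (y (Suc n) + y n))"
    proof (intro mult_left_mono mult_mono)
      show "norm (Y (Suc n) + Y n) \<le> y (Suc n) + y n"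
        using normY[of n] normY[of "Suc n"] norm_triangle_ineq[of "Y (Suc n)" "Y n"] by linarith
      show "0 \<le> y (Suc n) - y n"
        using Suc norm_ge_zero order_trans by blast
    qed (use Suc in auto)
    also have "\<dots> = y (Suc (Suc n)) - y (Suc n)"
      by (simp only: y(2)[of "Suc n"] y(2)[of n]) (simp add: field_simps)
    finally show ?case .
  qed
  have inc: "y n \<le> y (Suc n)" for n
    using normYd[of n] norm_ge_zero[of "Y (Suc n) - Y n"] by linarith
  have "Cauchy y"
    using incseq_SucI[of y] inc y01(2)
    by (metis Cauchy_convergent_iff incseq_convergent convergent_def)
  have normYkd: "norm (Y (n + k) - Y n) \<le> y (n + k) - y n" for n k
  proof (induction k)
    case (Suc k)
    have "norm (Y (n + Suc k) - Y n) \<le> norm (Y (Suc (n + k)) - Y (n + k)) + norm (Y (n + k) - Y n)"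
      using norm_triangle_ineq[of "Y (Suc (n + k)) - Y (n + k)" "Y (n + k) - Y n"] by simp
    with Suc normYd[of "n + k"] show ?case
      by simp
  qed simp
  have "Cauchy Y"
  proof (rule CauchyI')
    fix e :: real
    assume "e > 0"
    then obtain M where M: "\<And>m n. m \<ge> M \<Longrightarrow> n \<ge> M \<Longrightarrow> norm (y m - y n) < e"
      using \<open>Cauchy y\<close> unfolding Cauchy_iff by blast
    have "norm (Y m - Y n) < e" if "m \<ge> M" "n > m" for m n
    proof -
      have "norm (Y n - Y m) \<le> y n - y m"
        using normYkd[of m "n - m"] that by simp
      with M[of n m] that show ?thesis
        by (simp add: norm_minus_commute)
    qed
    then show "\<exists>M. \<forall>m\<ge>M. \<forall>n>m. dist (Y m) (Y n) < e"
      unfolding dist_norm by blast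
  qed
  then obtain L where L: "Y \<longlonglongrightarrow> L"
    by (auto simp: Cauchy_convergent_iff convergent_def)
  have "(\<lambda>n. (1/2) *\<^sub>R (X + Y n * Y n)) \<longlonglongrightarrow> (1/2) *\<^sub>R (X + L * L)"
    by (intro tendsto_intros L)
  moreover have "(\<lambda>n. (1/2) *\<^sub>R (X + Y n * Y n)) \<longlonglongrightarrow> L"
    using LIMSEQ_Suc[OF L] by (simp add: Y)
  ultimately have "(1/2) *\<^sub>R (X + L * L) = L"
    by (rule LIMSEQ_unique)
  then have "2 *\<^sub>R ((1/2) *\<^sub>R (X + L * L)) = 2 *\<^sub>R L"
    by simp
  \<comment> \<open>The fixed-point equation says that \<open>1 - L\<close> squares to
    \<open>1 - X = S\<close>.\<close>
  then have XL: "X + L * L = L + L"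
    by (simp add: scaleR_2)
  show thesis
  proof (rule that[of "1 - L"])
    show "star (1 - L) = 1 - L"
    proof -
      have starY: "star (Y n) = Y n" for n
        using assms(1) by (induction n) (auto simp: Y X_def)
      have "(\<lambda>n. star (Y n)) \<longlonglongrightarrow> star L"
        by (rule bounded_linear.tendsto[OF bounded_linear_star L])
      then have "star L = L"
        unfolding starY using L by (rule LIMSEQ_unique)
      then show ?thesis
        by simp
    qed
    have "(1 - L) * (1 - L) = 1 - (L + L) + L * L"
      by (simp add: algebra_simps)
    also have "\<dots> = S"
      by (simp add: XL[symmetric] X_def)
    finally show "(1 - L) * (1 - L) = S" .
    have "norm (Y n) \<le> 1" for n
      using normY[of n] y01(2)[of n] by simp
    then have "norm L \<le> 1"
      by (intro LIMSEQ_le_const2[OF tendsto_norm[OF L]]) auto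
    then show "norm (1 - (1 - L)) \<le> 1"
      by simp
    show "1 - L \<in> N" if "vna N" "S \<in> N" for N
    proof -
      interpret vna N by fact
      have "Y n \<in> N" for n
        using that by (induction n) (auto simp: Y X_def)
      then have "L \<in> N"
        by (rule norm_limit[OF _ L])
      then show ?thesis
        by simp
    qed
  qed
qed

text \<open>For \<open>0 \<le> C \<le> 1\<close> the moments \<open>a k\<close> decrease and are
  nonnegative, hence converge, and the squared distance of \<open>(C ^ m) \<cdot> x\<close> and
  \<open>(C ^ n) \<cdot> x\<close> is \<open>a (m + m) - 2 * a (m + n) + a (n + n)\<close>.\<close>

lemma powers_converge_strongly:
  fixes C :: "('h::complex_hilbert) cop"
  assumes "star C = C" "\<And>x. 0 \<le> inner (C \<cdot> x) x" "\<And>x. inner (C \<cdot> x) x \<le> inner x x"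
  shows "norm (C ^ n) \<le> 1" "Cauchy (\<lambda>n. (C ^ n) \<cdot> x)"
proof -
  have sym: "inner (C \<cdot> u) v = inner u (C \<cdot> v)" for u v
    by (simp add: inner_star assms(1))
  have sq: "inner (C \<cdot> u) (C \<cdot> u) \<le> inner (C \<cdot> u) u" for u
  proof -
    \<comment> \<open>Writes \<open>C - C * C\<close> as a sum of conjugates of the positive
      operators \<open>1 - C\<close> and \<open>C\<close>, which shows \<open>C * C \<le> C\<close>
      without a square root of \<open>C\<close>.\<close>
    have "C - C * C = C * (1 - C) * C + (1 - C) * C * (1 - C)"
      by (simp add: algebra_simps)
    from arg_cong[OF this, of "\<lambda>A. inner (A \<cdot> u) u"]
    have "inner (C \<cdot> u) u - inner (C \<cdot> u) (C \<cdot> u)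
        = (inner (C \<cdot> u) (C \<cdot> u) - inner (C \<cdot> (C \<cdot> u)) (C \<cdot> u))
          + inner (C \<cdot> (u - C \<cdot> u)) (u - C \<cdot> u)"
      by (simp add: inner_add_left inner_diff_left inner_diff_right sym)
    with assms(2)[of "u - C \<cdot> u"] assms(3)[of "C \<cdot> u"] show ?thesis
      by linarith
  qed
  have normC: "norm (C \<cdot> u) \<le> norm u" for u
    using sq[of u] assms(3)[of u] by (simp add: norm_eq_sqrt_inner)
  have normCn: "norm ((C ^ n) \<cdot> u) \<le> norm u" for n u
    by (induction n) (auto intro: order_trans[OF normC])
  show "norm (C ^ n) \<le> 1"
    by (rule norm_le_ap) (simp_all add: normCn)
  define a where "a k = inner ((C ^ k) \<cdot> x) x" for k
  have symn: "inner ((C ^ m) \<cdot> u) v = inner u ((C ^ m) \<cdot> v)" for m u v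
    by (simp add: inner_star star_power assms(1))
  have mn: "inner ((C ^ m) \<cdot> x) ((C ^ n) \<cdot> x) = a (n + m)" for m n
    by (simp add: a_def symn[symmetric] power_add)
  have "a (Suc k) \<le> a k" for k
  \<comment> \<open>Evaluated at \<open>(C ^ j) \<cdot> x\<close>, the even case is
    \<open>C \<le> 1\<close> and the odd case is \<open>C * C \<le> C\<close>.\<close>
  proof (cases "even k")
    case True
    then obtain j where "k = j + j"
      by (metis evenE mult_2)
    moreover have "a (Suc (j + j)) = inner (C \<cdot> ((C ^ j) \<cdot> x)) ((C ^ j) \<cdot> x)"
      using mn[of "Suc j" j] by simp
    ultimately show ?thesis
      using assms(3)[of "(C ^ j) \<cdot> x"] by (simp add: mn)
  next
    case False
    then obtain j where "k = Suc (j + j)"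
      by (metis oddE mult_2 Suc_eq_plus1)
    moreover have "a (Suc (j + j)) = inner (C \<cdot> ((C ^ j) \<cdot> x)) ((C ^ j) \<cdot> x)"
      using mn[of "Suc j" j] by simp
    moreover have "a (Suc (Suc (j + j))) = inner (C \<cdot> ((C ^ j) \<cdot> x)) (C \<cdot> ((C ^ j) \<cdot> x))"
      using mn[of "Suc j" "Suc j"] by simp
    ultimately show ?thesis
      using sq[of "(C ^ j) \<cdot> x"] by simp
  qed
  then have "decseq a"
    by (rule decseq_SucI)
  moreover have "0 \<le> a k" for k
  proof (cases "even k")
    case True
    then obtain j where "k = j + j"
      by (metis evenE mult_2)
    then show ?thesis
      using mn[of j j] by (metis inner_ge_zero)
  next
    case False
    then obtain j where "k = Suc (j + j)"
      by (metis oddE mult_2 Suc_eq_plus1)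
    moreover have "a (Suc (j + j)) = inner (C \<cdot> ((C ^ j) \<cdot> x)) ((C ^ j) \<cdot> x)"
      using mn[of "Suc j" j] by simp
    ultimately show ?thesis
      using assms(2)[of "(C ^ j) \<cdot> x"] by simp
  qed
  ultimately obtain l where l: "a \<longlonglongrightarrow> l"
    using decseq_convergent[of a 0] by metis
  show "Cauchy (\<lambda>n. (C ^ n) \<cdot> x)"
  proof (rule metric_CauchyI)
    fix e :: real
    assume "e > 0"
    then obtain M where M: "\<And>k. k \<ge> M \<Longrightarrow> \<bar>a k - l\<bar> < e\<^sup>2 / 4"
      using l[unfolded LIMSEQ_iff, rule_format, of "e\<^sup>2 / 4"] by auto
    have "dist ((C ^ m) \<cdot> x) ((C ^ n) \<cdot> x) < e" if "m \<ge> M" "n \<ge> M" for m n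
    proof -
      have "(norm ((C ^ m) \<cdot> x - (C ^ n) \<cdot> x))\<^sup>2 = a (m + m) - 2 * a (m + n) + a (n + n)"
        by (simp add: power2_norm_eq_inner inner_diff_left inner_diff_right mn add.commute)
      also have "\<dots> < e\<^sup>2"
        using M[of "m + m"] M[of "m + n"] M[of "n + n"] that by linarith
      finally show ?thesis
        using \<open>e > 0\<close> by (simp add: dist_norm power2_less_imp_less)
    qed
    then show "\<exists>M. \<forall>m\<ge>M. \<forall>n\<ge>M. dist ((C ^ m) \<cdot> x) ((C ^ n) \<cdot> x) < e"
      by blast
  qed
qed

text \<open>Makes \<open>star T * T\<close> admissible for \<open>sqrt_exists\<close>, which
  expresses \<open>0 \<le> S\<close> by the distance of \<open>S\<close> from 1.\<close>

lemma norm_one_minus_star_mult: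
  fixes T :: "('h::complex_hilbert) cop"
  assumes "norm T \<le> 1"
  shows "norm (1 - star T * T) \<le> 1"
proof (rule norm_le_ap)
  fix x
  have normT': "norm (star T \<cdot> y) \<le> norm y" for y
    using norm_ap[of "star T" y] mult_right_mono[OF assms, of "norm y"] by simp
  have "(norm ((1 - star T * T) \<cdot> x))\<^sup>2 = (norm x)\<^sup>2 - 2 * (norm (T \<cdot> x))\<^sup>2 + (norm (star T \<cdot> (T \<cdot> x)))\<^sup>2"
    by (simp add: norm_ap_eq[of T] power2_norm_eq_inner[of "x - _"] power2_norm_eq_inner[of x]
        power2_norm_eq_inner[of "star T \<cdot> _"] inner_diff_left inner_diff_right inner_commute)
  also have "\<dots> \<le> (norm x)\<^sup>2"
    using power_mono[OF normT'[of "T \<cdot> x"] norm_ge_zero, of 2] zero_le_power2[of "norm (T \<cdot> x)"]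
    by linarith
  finally show "norm ((1 - star T * T) \<cdot> x) \<le> 1 * norm x"
    unfolding mult_1 by (rule power2_le_imp_le) simp
qed simp

text \<open>With \<open>R = |T|\<close> and \<open>C = 1 - R\<close>, the partial isometry is the strong limit of
  \<open>T (1 + C + \<dots> + C\<^sup>n\<^sup>-\<^sup>1)\<close>: the sum times \<open>R\<close> is \<open>1 - C\<^sup>n\<close>, which converges to the
  projection onto the orthogonal complement of the kernel of \<open>T\<close>.\<close>

lemma polar_contraction:
  fixes T :: "('h::complex_hilbert) cop"
  assumes "norm T \<le> 1"
  obtains u where "T * (star u * u) = T" "u * star u * T = T" "u * star u * u = u"
    "\<And>z. T * z = 0 \<Longrightarrow> u * z = 0" "\<And>z. z * T = 0 \<Longrightarrow> z * u = 0"
    "\<And>N. vna N \<Longrightarrow> T \<in> N \<Longrightarrow> u \<in> N"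
proof -
  have normT: "norm (T \<cdot> x) \<le> norm x" for x
    using norm_ap[of T x] mult_right_mono[OF assms, of "norm x"] by simp
  obtain R where R: "star R = R" "R * R = star T * T" "norm (1 - R) \<le> 1"
      "\<And>N. vna N \<Longrightarrow> star T * T \<in> N \<Longrightarrow> R \<in> N"
    using sqrt_exists[of "star T * T"] norm_one_minus_star_mult[OF assms] by auto
  have normR: "norm (R \<cdot> x) = norm (T \<cdot> x)" for x
  proof (rule power2_eq_imp_eq)
    show "(norm (R \<cdot> x))\<^sup>2 = (norm (T \<cdot> x))\<^sup>2"
      unfolding norm_ap_eq R ..
  qed auto
  define C where "C = 1 - R"
  have C: "star C = C"
    by (simp add: C_def R)
  have C0: "0 \<le> inner (C \<cdot> x) x" for x
  proof -
    have "inner (R \<cdot> x) x \<le> norm (R \<cdot> x) * norm x"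
      by (rule norm_cauchy_schwarz)
    also have "\<dots> \<le> norm x * norm x"
      using normT by (intro mult_right_mono) (auto simp: normR)
    finally show ?thesis
      by (simp add: C_def inner_diff_left power2_norm_eq_inner[symmetric] power2_eq_square)
  qed
  have C1: "inner (C \<cdot> x) x \<le> inner x x" for x
  proof -
    have "inner (C \<cdot> x) x \<le> norm (C \<cdot> x) * norm x"
      by (rule norm_cauchy_schwarz)
    also have "\<dots> \<le> (1 * norm x) * norm x"
      using R(3) by (intro mult_right_mono order.trans[OF norm_ap]) (auto simp: C_def)
    finally show ?thesis
      by (simp add: power2_norm_eq_inner[symmetric] power2_eq_square)
  qed
  note conv = powers_converge_strongly[OF C C0 C1]
  obtain P where P: "norm P \<le> 1" "\<And>x. (\<lambda>n. (C ^ n) \<cdot> x) \<longlonglongrightarrow> P \<cdot> x"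
    using strong_limit_exists[of "\<lambda>n. C ^ n" 1] conv by blast
  define g where "g n = (\<Sum>k<n. C ^ k)" for n
  have R_eq: "R = 1 - C"
    by (simp add: C_def)
  have g_Suc: "g 0 = 0" "g (Suc n) = g n + C ^ n" for n
    by (simp_all add: g_def)
  have gR: "g n * R = 1 - C ^ n" for n
  proof (induction n)
    case (Suc n)
    have "g (Suc n) * R = g n * R + (C ^ n - C ^ n * C)"
      by (simp add: g_Suc distrib_right R_eq right_diff_distrib)
    then show ?case
      by (simp add: Suc power_commutes)
  qed (simp add: g_Suc)
  have Rg: "R * g n = 1 - C ^ n" for n
  proof (induction n)
    case (Suc n)
    have "R * g (Suc n) = R * g n + (C ^ n - C * C ^ n)"
      by (simp add: g_Suc distrib_left R_eq left_diff_distrib)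
    then show ?case
      by (simp add: Suc)
  qed (simp add: g_Suc)
  \<comment> \<open>\<open>T\<close> and \<open>R = |T|\<close> have equal norms on every vector, so
    the convergence of \<open>T * g n\<close> is that of \<open>R * g n = 1 - C ^ n\<close>.\<close>
  have norm_eq: "norm ((T * Z) \<cdot> x) = norm ((R * Z) \<cdot> x)" for Z x
    using normR[of "Z \<cdot> x"] by simp
  have norm_Tg: "norm ((T * g n) \<cdot> x) = norm (x - (C ^ n) \<cdot> x)" for n x
    by (subst norm_eq, subst Rg) simp
  have "norm (T * g n) \<le> 2" for n
  proof (rule norm_le_ap)
    fix x
    have "norm ((T * g n) \<cdot> x) = norm (x - (C ^ n) \<cdot> x)"
      by (rule norm_Tg)
    also have "\<dots> \<le> norm x + norm (C ^ n) * norm x"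
      using norm_triangle_ineq4[of x "(C ^ n) \<cdot> x"] norm_ap[of "C ^ n" x] by linarith
    also have "\<dots> \<le> norm x + 1 * norm x"
      using conv(1)[of n] by (intro add_mono mult_right_mono) auto
    finally show "norm ((T * g n) \<cdot> x) \<le> 2 * norm x"
      by simp
  qed simp
  moreover have "Cauchy (\<lambda>n. (T * g n) \<cdot> x)" for x
  proof (rule metric_CauchyI)
    fix e :: real
    assume "e > 0"
    then obtain M where M: "\<And>m n. m \<ge> M \<Longrightarrow> n \<ge> M \<Longrightarrow> dist ((C ^ m) \<cdot> x) ((C ^ n) \<cdot> x) < e"
      using metric_CauchyD[OF conv(2)[of x]] by blast
    have "dist ((T * g m) \<cdot> x) ((T * g n) \<cdot> x) = dist ((C ^ m) \<cdot> x) ((C ^ n) \<cdot> x)" for m n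
    proof -
      have "dist ((T * g m) \<cdot> x) ((T * g n) \<cdot> x) = norm ((T * (g m - g n)) \<cdot> x)"
        by (simp add: dist_norm)
      also have "\<dots> = norm ((R * g m) \<cdot> x - (R * g n) \<cdot> x)"
        by (subst norm_eq) simp
      also have "\<dots> = norm ((C ^ n) \<cdot> x - (C ^ m) \<cdot> x)"
        unfolding Rg by simp
      finally show ?thesis
        by (simp add: dist_norm norm_minus_commute)
    qed
    then show "\<exists>M. \<forall>m\<ge>M. \<forall>n\<ge>M. dist ((T * g m) \<cdot> x) ((T * g n) \<cdot> x) < e"
      using M by metis
  qed
  ultimately obtain u where u: "\<And>x. (\<lambda>n. (T * g n) \<cdot> x) \<longlonglongrightarrow> u \<cdot> x"
    using strong_limit_exists[of "\<lambda>n. T * g n" 2] by blast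
  have norm_u: "norm (u \<cdot> x) = norm ((1 - P) \<cdot> x)" for x
  proof (rule LIMSEQ_unique)
    show "(\<lambda>n. norm ((T * g n) \<cdot> x)) \<longlonglongrightarrow> norm (u \<cdot> x)"
      by (intro tendsto_norm u)
    have "(\<lambda>n. norm (x - (C ^ n) \<cdot> x)) \<longlonglongrightarrow> norm (x - P \<cdot> x)"
      by (intro tendsto_intros P)
    then show "(\<lambda>n. norm ((T * g n) \<cdot> x)) \<longlonglongrightarrow> norm ((1 - P) \<cdot> x)"
      unfolding norm_Tg by simp
  qed
  \<comment> \<open>\<open>C ^ (n + n)\<close> converges weakly to \<open>star P * P\<close> and, as
    a subsequence, to \<open>P\<close>; so \<open>P\<close> is a projection.\<close>
  have PP: "star P * P = P"
  proof -
    have "inner ((star P * P) \<cdot> x) y = inner (P \<cdot> x) y" for x y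
    proof (rule LIMSEQ_unique)
      have "(\<lambda>n. inner ((C ^ n) \<cdot> x) ((C ^ n) \<cdot> y)) \<longlonglongrightarrow> inner (P \<cdot> x) (P \<cdot> y)"
        by (intro tendsto_intros P)
      then show "(\<lambda>n. inner ((C ^ (n + n)) \<cdot> x) y) \<longlonglongrightarrow> inner ((star P * P) \<cdot> x) y"
        by (simp add: inner_star star_power C power_add)
      have "(\<lambda>n. (C ^ (n + n)) \<cdot> x) \<longlonglongrightarrow> P \<cdot> x"
        by (rule LIMSEQ_subseq_LIMSEQ[OF P(2), unfolded comp_def, of "\<lambda>n. n + n"])
          (simp add: strict_mono_def)
      then show "(\<lambda>n. inner ((C ^ (n + n)) \<cdot> x) y) \<longlonglongrightarrow> inner (P \<cdot> x) y"
        by (intro tendsto_intros)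
    qed
    then have "inner ((star P * P) \<cdot> x - P \<cdot> x) ((star P * P) \<cdot> x - P \<cdot> x) = 0" for x
      by (simp only: inner_diff_left)
    then show ?thesis
      by (intro cop_eqI) (simp only: inner_eq_zero_iff right_minus_eq)
  qed
  then have Psa: "star P = P"
    by (metis star_mult star_star)
  have "star u * u - (1 - P) = 0"
  proof (rule selfadjoint_eq_0)
    fix x
    have P1: "star (1 - P) * (1 - P) = 1 - P"
      using PP Psa by (simp add: algebra_simps)
    have "inner ((star u * u) \<cdot> x) x = inner ((star (1 - P) * (1 - P)) \<cdot> x) x"
      unfolding norm_ap_eq[symmetric] norm_u ..
    then show "inner ((star u * u - (1 - P)) \<cdot> x) x = 0"
      unfolding P1 ap_linear(2)[of "star u * u"] inner_diff_left by simp
  qed (simp add: Psa)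
  then have uu: "star u * u = 1 - P"
    by simp
  have RP: "R * P = 0"
  proof (rule cop_eqI)
    fix x
    have "(\<lambda>n. C \<cdot> ((C ^ n) \<cdot> x)) \<longlonglongrightarrow> C \<cdot> (P \<cdot> x)"
      by (rule tendsto_ap_right[OF P(2)])
    moreover have "(\<lambda>n. C \<cdot> ((C ^ n) \<cdot> x)) \<longlonglongrightarrow> P \<cdot> x"
      using LIMSEQ_Suc[OF P(2)[of x]] by simp
    ultimately have "C \<cdot> (P \<cdot> x) = P \<cdot> x"
      by (rule LIMSEQ_unique)
    then show "(R * P) \<cdot> x = 0 \<cdot> x"
      by (simp add: C_def)
  qed
  have TP: "T * P = 0"
    by (rule cop_eqI) (use norm_eq[of P] RP in simp)
  have uR: "u * R = T"
  proof (rule cop_eqI)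
    fix x
    have "(\<lambda>n. (T * g n) \<cdot> (R \<cdot> x)) \<longlonglongrightarrow> (u * R) \<cdot> x"
      using u[of "R \<cdot> x"] by simp
    moreover have "(T * g n) \<cdot> (R \<cdot> x) = T \<cdot> (x - (C ^ n) \<cdot> x)" for n
    proof -
      have "(T * g n) \<cdot> (R \<cdot> x) = T \<cdot> ((g n * R) \<cdot> x)"
        by simp
      then show ?thesis
        by (simp only: gR ap_linear)
    qed
    moreover have "(\<lambda>n. T \<cdot> (x - (C ^ n) \<cdot> x)) \<longlonglongrightarrow> T \<cdot> (x - P \<cdot> x)"
      by (intro tendsto_ap_right tendsto_intros P)
    ultimately have "(u * R) \<cdot> x = T \<cdot> (x - P \<cdot> x)"
      using LIMSEQ_unique by fastforce
    also have "\<dots> = T \<cdot> x - (T * P) \<cdot> x"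
      by simp
    finally show "(u * R) \<cdot> x = T \<cdot> x"
      by (simp add: TP)
  qed
  have uP: "u * P = 0"
  proof (rule cop_eqI)
    fix x
    have "(1 - P) * P = 0"
      using PP Psa by (simp add: algebra_simps)
    then have "(1 - P) \<cdot> (P \<cdot> x) = 0"
      by (metis ap_linear(4) ap_linear(6))
    then show "(u * P) \<cdot> x = 0 \<cdot> x"
      using norm_u[of "P \<cdot> x"] by simp
  qed
  have uuu: "u * star u * u = u"
    by (simp add: mult.assoc uu right_diff_distrib uP)
  show thesis
  proof (rule that[of u])
    show "T * (star u * u) = T"
      by (simp add: uu right_diff_distrib TP)
    show "u * star u * T = T"
      using uuu by (metis uR mult.assoc)
    show "u * star u * u = u"
      by (rule uuu)
    show "u * z = 0" if "T * z = 0" for z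
    proof (rule cop_eqI)
      fix x
      have "norm (R \<cdot> (z \<cdot> x)) = norm ((T * z) \<cdot> x)"
        by (simp add: normR)
      then have "R \<cdot> (z \<cdot> x) = 0"
        using that by simp
      then have "C \<cdot> (z \<cdot> x) = z \<cdot> x"
        by (simp add: C_def)
      then have "(C ^ n) \<cdot> (z \<cdot> x) = z \<cdot> x" for n
        by (induction n) simp_all
      then have "P \<cdot> (z \<cdot> x) = z \<cdot> x"
        using P(2)[of "z \<cdot> x"] by (simp add: LIMSEQ_const_iff)
      then show "(u * z) \<cdot> x = 0 \<cdot> x"
        using norm_u[of "z \<cdot> x"] by simp
    qed
    show "z * u = 0" if "z * T = 0" for z
    proof (rule cop_eqI)
      fix x
      have "(\<lambda>n. z \<cdot> ((T * g n) \<cdot> x)) \<longlonglongrightarrow> z \<cdot> (u \<cdot> x)"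
        by (rule tendsto_ap_right[OF u])
      moreover have "z \<cdot> ((T * g n) \<cdot> x) = (z * T) \<cdot> (g n \<cdot> x)" for n
        by simp
      ultimately show "(z * u) \<cdot> x = 0 \<cdot> x"
        using that by (simp add: LIMSEQ_const_iff)
    qed
    show "u \<in> N" if "vna N" "T \<in> N" for N
    proof -
      interpret vna N by fact
      have "R \<in> N"
        using that by (intro R(4)) auto
      then have "C \<in> N"
        by (simp add: C_def)
      then have "T * g n \<in> N" for n
        using that(2) by (auto simp: g_def intro!: sum)
      then show ?thesis
        by (rule strong_limit[OF _ u])
    qed
  qed
qed

text \<open>The clauses about \<open>z\<close> say algebraically that the kernel of \<open>u\<close>
  contains that of \<open>T\<close> and that the range of \<open>u\<close> lies in the closure of
  the range of \<open>T\<close>. The last clause places \<open>u\<close> in the von Neumann algebra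
  generated by \<open>T\<close>.\<close>

lemma polar:
  fixes T :: "('h::complex_hilbert) cop"
  obtains u where "T * (star u * u) = T" "u * star u * T = T" "u * star u * u = u"
    "\<And>z. T * z = 0 \<Longrightarrow> u * z = 0" "\<And>z. z * T = 0 \<Longrightarrow> z * u = 0"
    "\<And>N. vna N \<Longrightarrow> T \<in> N \<Longrightarrow> u \<in> N"
proof (cases "T = 0")
  case True
  then show ?thesis
    by (intro that[of 0]) (auto simp: vna.zero)
next
  case False
  define r where "r = 1 / norm T"
  have "r \<noteq> 0" "norm (r *\<^sub>R T) \<le> 1"
    using False by (simp_all add: r_def)
  show ?thesis
  proof (rule polar_contraction[OF \<open>norm (r *\<^sub>R T) \<le> 1\<close>])
    fix u
    assume u: "(r *\<^sub>R T) * (star u * u) = r *\<^sub>R T" "u * star u * (r *\<^sub>R T) = r *\<^sub>R T" "u * star u * u = u"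
      "\<And>z. (r *\<^sub>R T) * z = 0 \<Longrightarrow> u * z = 0" "\<And>z. z * (r *\<^sub>R T) = 0 \<Longrightarrow> z * u = 0"
      "\<And>N. vna N \<Longrightarrow> r *\<^sub>R T \<in> N \<Longrightarrow> u \<in> N"
    from u \<open>r \<noteq> 0\<close> show ?thesis
      by (intro that[of u]) (simp_all add: vna.scaleR)
  qed
qed

section \<open>Projections, partial isometries and their orthogonal sums\<close>

definition proj :: "('h::complex_hilbert) cop \<Rightarrow> bool"
  where "proj p \<longleftrightarrow> p * p = p \<and> star p = p"

definition pisom :: "('h::complex_hilbert) cop \<Rightarrow> bool"
  where "pisom u \<longleftrightarrow> u * star u * u = u"

lemma proj_simps: "proj p \<Longrightarrow> p * p = p" "proj p \<Longrightarrow> p * (p * z) = p * z" "proj p \<Longrightarrow> star p = p"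
  by (simp_all add: proj_def mult.assoc[symmetric])

lemma proj_star_self: "pisom u \<Longrightarrow> proj (star u * u)"
  by (simp add: proj_def pisom_def mult.assoc)

lemma pisom_star: "pisom u \<Longrightarrow> pisom (star u)"
proof -
  assume "pisom u"
  then have "star (u * star u * u) = star u"
    by (simp add: pisom_def)
  then show ?thesis
    by (simp add: pisom_def mult.assoc)
qed

lemma proj_self_star: "pisom u \<Longrightarrow> proj (u * star u)"
  using proj_star_self[OF pisom_star, of u] by simp

lemma proj_imp_pisom: "proj p \<Longrightarrow> pisom p"
  by (simp add: proj_def pisom_def)

lemma pisomI: "proj (star u * u) \<Longrightarrow> pisom u"
proof -
  assume p: "proj (star u * u)"
  have "star (u - u * (star u * u)) * (u - u * (star u * u)) = 0"
    using proj_simps(1)[OF p] by (simp add: left_diff_distrib right_diff_distrib mult.assoc)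
  then have "u - u * (star u * u) = 0"
    by (simp only: star_mult_self_eq_0)
  then show ?thesis
    by (simp add: pisom_def mult.assoc)
qed

lemma mult_star_self: "star u * u = p \<Longrightarrow> proj p \<Longrightarrow> u * p = u"
  using pisomI[of u] by (simp add: pisom_def mult.assoc)

lemma star_mult_eq_0: "star a * b = 0 \<Longrightarrow> star b * a = 0"
  by (metis star_mult star_star star_zero)

lemma proj_le_sym: "proj p \<Longrightarrow> proj q \<Longrightarrow> p * q = q \<Longrightarrow> q * p = q"
  by (metis proj_def star_mult)

lemma proj_diff: "proj p \<Longrightarrow> proj q \<Longrightarrow> p * q = q \<Longrightarrow> proj (p - q)"
  by (simp add: proj_def left_diff_distrib right_diff_distrib proj_le_sym[unfolded proj_def])

lemma proj_one [simp]: "proj 1"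
  by (simp add: proj_def)

lemma norm_proj_ap: "proj p \<Longrightarrow> norm (p \<cdot> x) \<le> norm x"
proof -
  assume p: "proj p"
  have "norm (p \<cdot> x) * norm (p \<cdot> x) = inner ((star p * p) \<cdot> x) x"
    by (metis norm_ap_eq power2_eq_square)
  also have "\<dots> = inner (p \<cdot> x) x"
    using p by (simp add: proj_simps)
  also have "\<dots> \<le> norm (p \<cdot> x) * norm x"
    by (rule norm_cauchy_schwarz)
  finally show ?thesis
    by (cases "norm (p \<cdot> x) = 0") auto
qed

lemma norm_proj: "proj p \<Longrightarrow> norm p \<le> 1"
  by (rule norm_le_ap) (simp_all add: norm_proj_ap)

text \<open>On each vector the squared norms of the partial sums increase and stay below
  \<open>(norm x)\<^sup>2\<close>. By orthogonality their differences are the squared distances of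
  the partial sums, which therefore converge.\<close>

lemma orthogonal_sum:
  fixes v :: "nat \<Rightarrow> ('h::complex_hilbert) cop"
  assumes pisom: "\<And>n. pisom (v n)"
    and orth: "\<And>m n. m \<noteq> n \<Longrightarrow> star (v m) * v n = 0" "\<And>m n. m \<noteq> n \<Longrightarrow> v m * star (v n) = 0"
  obtains u where "pisom u" "\<And>n. u * (star (v n) * v n) = v n" "\<And>n. v n * star (v n) * u = v n"
    "\<And>z. (\<And>n. z * v n = 0) \<Longrightarrow> z * u = 0" "\<And>z. (\<And>n. v n * z = 0) \<Longrightarrow> u * z = 0"
    "\<And>N. vna N \<Longrightarrow> (\<And>n. v n \<in> N) \<Longrightarrow> u \<in> N"
    "\<And>x. (\<lambda>k. (\<Sum>n<k. v n) \<cdot> x) \<longlonglongrightarrow> u \<cdot> x"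
proof -
  define U where "U k = (\<Sum>n<k. v n)" for k
  define Q where "Q k = (\<Sum>n<k. star (v n) * v n)" for k
  have U_Suc: "U 0 = 0" "U (Suc k) = U k + v k" for k
    by (simp_all add: U_def)
  have Q_Suc: "Q 0 = 0" "Q (Suc k) = Q k + star (v k) * v k" for k
    by (simp_all add: Q_def)
  have vU: "star (v n) * U k = (if n < k then star (v n) * v n else 0)" for n k
    by (induction k) (auto simp: U_Suc distrib_left orth less_Suc_eq)
  have vU2: "U k * star (v n) = (if n < k then v n * star (v n) else 0)" for n k
    by (induction k) (auto simp: U_Suc distrib_right orth less_Suc_eq)
  have UU: "star (U k) * U l = Q k" if "k \<le> l" for k l
    using that by (induction k) (auto simp: U_Suc Q_Suc distrib_right vU)
  have starQ: "star (Q k) = Q k" for k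
    by (simp add: Q_def star_sum)
  have UU': "star (U l) * U k = Q k" if "k \<le> l" for k l
    using arg_cong[OF UU[OF that], of star] by (simp add: starQ)
  have UQ: "U k * Q k = U k" for k
  proof -
    have "U k * (star (v n) * v n) = v n" if "n < k" for n k
      using that pisom[of n] by (simp add: mult.assoc[symmetric] vU2 pisom_def)
    then have "j \<le> k \<Longrightarrow> U k * Q j = U j" for j
      by (induction j) (auto simp: U_Suc Q_Suc distrib_left)
    then show ?thesis
      by simp
  qed
  have "proj (Q k)" for k
  proof -
    have "Q k * Q k = star (U k) * (U k * Q k)"
      by (simp add: UU[OF order_refl, of k, symmetric] mult.assoc)
    then show ?thesis
      by (simp add: proj_def UQ UU starQ)
  qed
  then have norm_U: "(norm (U k \<cdot> x))\<^sup>2 \<le> (norm x)\<^sup>2" for k x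
  proof -
    have "(norm (U k \<cdot> x))\<^sup>2 = inner (Q k \<cdot> x) x"
      unfolding norm_ap_eq by (simp only: UU[OF order_refl])
    also have "\<dots> \<le> norm (Q k \<cdot> x) * norm x"
      by (rule norm_cauchy_schwarz)
    also have "\<dots> \<le> norm x * norm x"
      by (intro mult_right_mono norm_proj_ap \<open>proj (Q k)\<close>) auto
    finally show ?thesis
      by (simp add: power2_eq_square)
  qed
  have norm_U1: "norm (U k) \<le> 1" for k
    by (rule norm_le_ap) (use norm_U in \<open>auto intro: power2_le_imp_le\<close>)
  have Cauchy_U: "Cauchy (\<lambda>k. U k \<cdot> x)" for x
  proof -
    define a where "a k = (norm (U k \<cdot> x))\<^sup>2" for k
    have diff: "(norm (U l \<cdot> x - U k \<cdot> x))\<^sup>2 = a l - a k" if "k \<le> l" for k l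
    proof -
      have *: "star (U l - U k) * (U l - U k) = star (U l) * U l - star (U k) * U k"
        using UU[OF that] UU'[OF that] UU[of k k] by (simp add: left_diff_distrib right_diff_distrib)
      have "(norm ((U l - U k) \<cdot> x))\<^sup>2 = a l - a k"
        unfolding a_def norm_ap_eq * ap_linear(2)[of "star (U l) * U l"] inner_diff_left ..
      then show ?thesis
        by simp
    qed
    have "incseq a"
    proof (rule incseq_SucI)
      show "a k \<le> a (Suc k)" for k
        using diff[of k "Suc k"] zero_le_power2[of "norm (U (Suc k) \<cdot> x - U k \<cdot> x)"] by simp
    qed
    then have "convergent a"
    proof -
      have "\<forall>k. a k \<le> (norm x)\<^sup>2"
        by (simp add: a_def norm_U)
      with \<open>incseq a\<close> obtain l where "a \<longlonglongrightarrow> l"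
        by (rule incseq_convergent)
      then show ?thesis
        by (auto simp: convergent_def)
    qed
    then have "Cauchy a"
      by (rule convergent_Cauchy)
    show ?thesis
    proof (rule CauchyI')
      fix e :: real
      assume "e > 0"
      then obtain M where M: "\<And>m n. m \<ge> M \<Longrightarrow> n \<ge> M \<Longrightarrow> norm (a m - a n) < e\<^sup>2"
        using \<open>Cauchy a\<close> unfolding Cauchy_iff by (metis zero_less_power)
      have "dist (U m \<cdot> x) (U n \<cdot> x) < e" if "m \<ge> M" "n > m" for m n
      proof -
        have "(norm (U n \<cdot> x - U m \<cdot> x))\<^sup>2 < e\<^sup>2"
          using M[of n m] that diff[of m n] by auto
        then show ?thesis
          using \<open>e > 0\<close> by (simp add: dist_norm norm_minus_commute power2_less_imp_less)
      qed
      then show "\<exists>M. \<forall>m\<ge>M. \<forall>n>m. dist (U m \<cdot> x) (U n \<cdot> x) < e"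
        by blast
    qed
  qed
  obtain u where u: "\<And>x. (\<lambda>k. U k \<cdot> x) \<longlonglongrightarrow> u \<cdot> x"
    using strong_limit_exists[OF norm_U1 Cauchy_U] by metis
  \<comment> \<open>An algebraic relation that holds for all late partial sums passes to the strong
    limit; the clauses about products with \<open>u\<close> come from this.\<close>
  have eventually_const: "a * u * b = c" if "\<And>k. k > n \<Longrightarrow> a * U k * b = c" for a b c n
  proof (rule cop_eqI)
    fix x
    have "(\<lambda>k. a \<cdot> (U k \<cdot> (b \<cdot> x))) \<longlonglongrightarrow> a \<cdot> (u \<cdot> (b \<cdot> x))"
      by (rule tendsto_ap_right[OF u])
    moreover have "a \<cdot> (U k \<cdot> (b \<cdot> x)) = c \<cdot> x" if "k > n" for k
      using arg_cong[OF \<open>\<And>k. k > n \<Longrightarrow> a * U k * b = c\<close>[OF that], of "\<lambda>A. A \<cdot> x"] by simp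
    then have "(\<lambda>k. a \<cdot> (U k \<cdot> (b \<cdot> x))) \<longlonglongrightarrow> c \<cdot> x"
      by (intro tendsto_eventually) (auto simp: eventually_at_top_dense)
    ultimately show "(a * u * b) \<cdot> x = c \<cdot> x"
      using LIMSEQ_unique by fastforce
  qed
  have 1: "u * (star (v n) * v n) = v n" for n
    using eventually_const[of n 1 "star (v n) * v n" "v n"] pisom[of n]
    by (simp add: mult.assoc[symmetric] vU2 pisom_def)
  have "star (v n) * u = star (v n) * v n" for n
    using eventually_const[of n "star (v n)" 1 "star (v n) * v n"] by (simp add: vU)
  then have 2: "v n * star (v n) * u = v n" for n
    using pisom[of n] by (simp add: mult.assoc pisom_def)
  have 3: "z * u = 0" if "\<And>n. z * v n = 0" for z
    using eventually_const[of 0 z 1 0] that by (simp add: U_def sum_distrib_left)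
  have 4: "u * z = 0" if "\<And>n. v n * z = 0" for z
    using eventually_const[of 0 1 z 0] that by (simp add: U_def sum_distrib_right)
  have "u * star (v n) = v n * star (v n)" for n
  proof -
    have "u * star (v n) = u * (star (v n) * v n) * star (v n)"
      using pisom_star[OF pisom[of n]] by (simp add: pisom_def mult.assoc)
    then show ?thesis
      by (simp add: 1)
  qed
  then have "v n * star u = v n * star (v n)" for n
    by (metis star_mult star_star)
  then have "v n * (star u * u - 1) = 0" for n
    using 2[of n] by (simp add: right_diff_distrib mult.assoc[symmetric])
  then have "u * (star u * u - 1) = 0"
    by (rule 4)
  then have 5: "pisom u"
    by (simp add: pisom_def right_diff_distrib mult.assoc)
  show thesis
  proof (rule that[OF 5 1 2 3 4])
    fix N
    assume "vna N" and v: "\<And>n. v n \<in> N"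
    interpret vna N by fact
    have "U k \<in> N" for k
      using v by (auto simp: U_def intro: sum)
    then show "u \<in> N"
      by (rule strong_limit[OF _ u])
  next
    show "(\<lambda>k. (\<Sum>n<k. v n) \<cdot> x) \<longlonglongrightarrow> u \<cdot> x" for x
      using u[of x] unfolding U_def .
  qed
qed

section \<open>Comparison of projections\<close>

text \<open>Zorn's lemma for exhaustion arguments. The seed \<open>V0\<close> lets the maximal
  family contain prescribed members.\<close>

lemma maximal_pairwise:
  assumes "V0 \<subseteq> A" "pairwise R V0"
  shows "\<exists>V. V0 \<subseteq> V \<and> V \<subseteq> A \<and> pairwise R V \<and> (\<forall>x\<in>A. pairwise R (insert x V) \<longrightarrow> x \<in> V)"
proof -
  define \<A> where "\<A> = {V. V0 \<subseteq> V \<and> V \<subseteq> A \<and> pairwise R V}"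
  have "V0 \<in> \<A>"
    using assms by (simp add: \<A>_def)
  have "\<exists>V\<in>\<A>. \<forall>X\<in>\<A>. V \<subseteq> X \<longrightarrow> X = V"
  proof (rule subset_Zorn_nonempty)
    fix \<C>
    assume "\<C> \<noteq> {}" and chain: "subset.chain \<A> \<C>"
    then have "\<C> \<subseteq> \<A>"
      by (simp add: subset.chain_def)
    have "pairwise R (\<Union>\<C>)"
    proof (rule pairwise_chain_Union)
      show "chain\<^sub>\<subseteq> \<C>"
        using chain unfolding subset.chain_def chain_subset_def by blast
    qed (use \<open>\<C> \<subseteq> \<A>\<close> in \<open>auto simp: \<A>_def\<close>)
    then show "\<Union>\<C> \<in> \<A>"
      using \<open>\<C> \<noteq> {}\<close> \<open>\<C> \<subseteq> \<A>\<close> by (auto simp: \<A>_def)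
  qed (use \<open>V0 \<in> \<A>\<close> in auto)
  then obtain V where V: "V \<in> \<A>" "\<And>X. X \<in> \<A> \<Longrightarrow> V \<subseteq> X \<Longrightarrow> X = V"
    by blast
  have "x \<in> V" if "x \<in> A" "pairwise R (insert x V)" for x
    using V(1) V(2)[of "insert x V"] that by (auto simp: \<A>_def)
  with V(1) show ?thesis
    by (auto simp: \<A>_def)
qed

text \<open>Padding with \<open>0\<close>, a partial isometry orthogonal to everything, turns finite
  and infinite families alike into sequences.\<close>

lemma enumerate_countable:
  fixes V :: "'a::zero set"
  assumes "countable V"
  obtains g :: "nat \<Rightarrow> 'a" where "\<And>n. g n \<in> insert 0 V" "V \<subseteq> range g"
    "\<And>m n. m \<noteq> n \<Longrightarrow> g m = g n \<Longrightarrow> g m = 0"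
proof
  define g where "g n = (if n \<in> to_nat_on V ` V then from_nat_into V n else 0)" for n
  show "g n \<in> insert 0 V" for n
    using from_nat_into[of V n] by (auto simp: g_def)
  show "V \<subseteq> range g"
  proof
    fix v
    assume "v \<in> V"
    then have "g (to_nat_on V v) = v"
      using assms by (simp add: g_def)
    then show "v \<in> range g"
      by (metis rangeI)
  qed
  show "g m = 0" if "m \<noteq> n" "g m = g n" for m n
  proof (rule ccontr)
    assume "g m \<noteq> 0"
    then have "m \<in> to_nat_on V ` V" "n \<in> to_nat_on V ` V"
      using that unfolding g_def by metis+
    then obtain v w where "v \<in> V" "w \<in> V" "m = to_nat_on V v" "n = to_nat_on V w"
      by blast
    with that assms show False
      by (simp add: g_def)
  qed
qed

text \<open>Separability of the predual enters only through a sequence of real functionals that approximate, in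
  norm on \<open>M\<close>, all finite sums of vector functionals.\<close>

locale separable_vna = vna M for M :: "('h::complex_hilbert) cop set" +
  fixes D :: "nat \<Rightarrow> 'h cop \<Rightarrow> real"
  assumes D_dense: "finite F \<Longrightarrow> e > 0 \<Longrightarrow>
    \<exists>n. \<forall>T\<in>M. \<bar>(\<Sum>x\<in>F. inner (T \<cdot> x) (\<eta> x)) - D n T\<bar> \<le> e * norm T"
begin

text \<open>Each \<open>v\<close> gets a unit vector \<open>y v\<close> in its range and an index
  \<open>n v\<close> whose functional is within 1/4 of the vector functional at \<open>y v\<close>
  on projections. A common index for \<open>v\<close> and \<open>w\<close> would give a number
  within 1/4 of both 1 and 0 as its value at \<open>v * star v\<close>.\<close>

lemma countable_orthogonal:
  assumes "V \<subseteq> M" "\<And>v. v \<in> V \<Longrightarrow> pisom v \<and> v \<noteq> 0" "pairwise (\<lambda>v w. star v * w = 0) V"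
  shows "countable V"
proof -
  have "\<exists>y. inner ((v * star v) \<cdot> y) y = 1 \<and> (\<forall>w\<in>V. w \<noteq> v \<longrightarrow> inner ((w * star w) \<cdot> y) y = 0)"
    if vV: "v \<in> V" for v
  proof -
    obtain x where x: "v \<cdot> x \<noteq> 0"
      using assms(2)[OF vV] cop_eqI[of v 0] by auto
    define y where "y = (1 / norm (v \<cdot> x)) *\<^sub>R (v \<cdot> x)"
    have "v * star v * v = v"
      using assms(2)[OF vV] by (simp add: pisom_def)
    from arg_cong[OF this, of "\<lambda>A. A \<cdot> x"] have "(v * star v) \<cdot> y = y"
      by (simp add: y_def)
    moreover have "inner y y = 1"
      using x by (simp add: y_def power2_norm_eq_inner[symmetric] power2_eq_square)
    moreover have "(w * star w) \<cdot> y = 0" if "w \<in> V" "w \<noteq> v" for w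
    proof -
      have "star w * v = 0"
        using assms(3) that \<open>v \<in> V\<close> by (simp add: pairwise_def)
      from arg_cong[OF this, of "\<lambda>A. A \<cdot> x"] show ?thesis
        by (simp add: y_def)
    qed
    ultimately show ?thesis
      by (intro exI[of _ y]) auto
  qed
  then obtain y where y: "\<And>v. v \<in> V \<Longrightarrow> inner ((v * star v) \<cdot> y v) (y v) = 1"
    "\<And>v w. v \<in> V \<Longrightarrow> w \<in> V \<Longrightarrow> w \<noteq> v \<Longrightarrow> inner ((w * star w) \<cdot> y v) (y v) = 0"
    by metis
  have "\<exists>n. \<forall>T\<in>M. \<bar>inner (T \<cdot> y v) (y v) - D n T\<bar> \<le> 1/4 * norm T" for v
    using D_dense[of "{y v}" "1/4" "\<lambda>_. y v"] by simp
  then obtain n where n: "\<And>v T. T \<in> M \<Longrightarrow> \<bar>inner (T \<cdot> y v) (y v) - D (n v) T\<bar> \<le> 1/4 * norm T"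
    by metis
  have "inj_on n V"
  proof (rule inj_onI, rule ccontr)
    fix v w
    assume vw: "v \<in> V" "w \<in> V" "n v = n w" "v \<noteq> w"
    define p where "p = v * star v"
    have "p \<in> M"
      using vw assms(1) by (auto simp: p_def)
    have "norm p \<le> 1"
      using assms(2)[OF vw(1)] by (simp add: p_def norm_proj proj_self_star)
    moreover have "\<bar>1 - D (n v) p\<bar> \<le> 1/4 * norm p"
      using n[OF \<open>p \<in> M\<close>, of v] y(1)[OF vw(1)] by (simp add: p_def)
    moreover have "\<bar>0 - D (n v) p\<bar> \<le> 1/4 * norm p"
      using n[OF \<open>p \<in> M\<close>, of w] y(2)[OF vw(2) vw(1)] vw by (simp add: p_def)
    ultimately show False
      by linarith
  qed
  then show ?thesis
    by (rule countableI)
qed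

text \<open>Every \<open>D n\<close> maps the unit ball to a separable set of reals, so countably
  many operators are dense for all \<open>D n\<close>. A finite sum of vector functionals is close
  to a single \<open>D n\<close>, hence density for one functional at a time is enough.\<close>

lemma weakly_dense_sequence:
  obtains S :: "nat \<Rightarrow> 'h cop" where "range S \<subseteq> M"
    "\<And>T F \<eta> e. T \<in> M \<Longrightarrow> norm T \<le> 1 \<Longrightarrow> finite F \<Longrightarrow> e > 0 \<Longrightarrow>
      \<exists>k. \<bar>\<Sum>x\<in>F. inner (T \<cdot> x - S k \<cdot> x) (\<eta> x)\<bar> < e"
proof -
  define B where "B = {T \<in> M. norm T \<le> 1}"
  have "\<exists>A. countable A \<and> A \<subseteq> B \<and> D n ` B \<subseteq> closure (D n ` A)" for n
  proof -
    obtain C where C: "countable C" "C \<subseteq> D n ` B" "D n ` B \<subseteq> closure C"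
      using separable[of "D n ` B"] by blast
    obtain A where "countable A" "A \<subseteq> B" "C = D n ` A"
      using countable_subset_image[of C "D n" B] C by blast
    with C show ?thesis
      by blast
  qed
  then obtain A where A: "\<And>n. countable (A n)" "\<And>n. A n \<subseteq> B" "\<And>n. D n ` B \<subseteq> closure (D n ` A n)"
    by metis
  define S where "S = from_nat_into (insert 0 (\<Union>n. A n))"
  have "0 \<in> B"
    by (simp add: B_def)
  have rangeS: "range S = insert 0 (\<Union>n. A n)"
    unfolding S_def by (rule range_from_nat_into) (use A in auto)
  then have SB: "range S \<subseteq> B"
    using A(2) \<open>0 \<in> B\<close> by auto
  show thesis
  proof (rule that[of S])
    show "range S \<subseteq> M"
      using SB by (auto simp: B_def)
    fix T :: "'h cop" and F :: "'h set" and \<eta> and e :: real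
    assume T: "T \<in> M" "norm T \<le> 1" and F: "finite F" "e > 0"
    then have "T \<in> B"
      by (simp add: B_def)
    obtain n where n: "\<And>T. T \<in> M \<Longrightarrow> \<bar>(\<Sum>x\<in>F. inner (T \<cdot> x) (\<eta> x)) - D n T\<bar> \<le> e / 4 * norm T"
      using D_dense[of F "e / 4" \<eta>] F by auto
    have "D n T \<in> closure (D n ` A n)"
      using A(3) \<open>T \<in> B\<close> by blast
    then obtain R where R: "R \<in> A n" "\<bar>D n R - D n T\<bar> < e / 4"
      using F(2) unfolding closure_approachable dist_real_def
      by (metis (no_types, lifting) imageE zero_less_divide_iff zero_less_numeral)
    obtain k where k: "S k = R"
      using rangeS R(1) by (metis UN_I UNIV_I imageE insertI2)
    have "R \<in> M" "norm R \<le> 1"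
      using A(2) R(1) by (auto simp: B_def)
    have le: "\<bar>(\<Sum>x\<in>F. inner (X \<cdot> x) (\<eta> x)) - D n X\<bar> \<le> e / 4" if "X \<in> M" "norm X \<le> 1" for X
    proof -
      have "e / 4 * norm X \<le> e / 4 * 1"
        using that(2) F(2) by (intro mult_left_mono) auto
      with n[OF that(1)] show ?thesis
        by linarith
    qed
    have "(\<Sum>x\<in>F. inner (T \<cdot> x - S k \<cdot> x) (\<eta> x))
        = (\<Sum>x\<in>F. inner (T \<cdot> x) (\<eta> x)) - (\<Sum>x\<in>F. inner (R \<cdot> x) (\<eta> x))"
      by (simp add: k inner_diff_left sum_subtractf)
    then show "\<exists>k. \<bar>\<Sum>x\<in>F. inner (T \<cdot> x - S k \<cdot> x) (\<eta> x)\<bar> < e"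
      using le[OF T] le[OF \<open>R \<in> M\<close> \<open>norm R \<le> 1\<close>] R(2) F(2) by (intro exI[of _ k]) linarith
  qed
qed

lemma countable_sum:
  assumes "V \<subseteq> M" "\<And>v. v \<in> V \<Longrightarrow> pisom v"
    and orth: "pairwise (\<lambda>v w. star v * w = 0 \<and> v * star w = 0) V"
  obtains u where "u \<in> M" "pisom u" "\<And>v. v \<in> V \<Longrightarrow> u * (star v * v) = v" "\<And>v. v \<in> V \<Longrightarrow> v * star v * u = v"
    "\<And>z. (\<And>v. v \<in> V \<Longrightarrow> z * v = 0) \<Longrightarrow> z * u = 0" "\<And>z. (\<And>v. v \<in> V \<Longrightarrow> v * z = 0) \<Longrightarrow> u * z = 0"
proof -
  have "countable (V - {0})"
    using assms by (intro countable_orthogonal) (auto simp: pairwise_def)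
  then obtain g :: "nat \<Rightarrow> 'h cop" where g: "\<And>n. g n \<in> insert 0 (V - {0})" "V - {0} \<subseteq> range g"
    "\<And>m n. m \<noteq> n \<Longrightarrow> g m = g n \<Longrightarrow> g m = 0"
    by (rule enumerate_countable) (rule that)
  have gV: "g n = 0 \<or> g n \<in> V" for n
    using g(1)[of n] by auto
  have o: "star (g m) * g n = 0 \<and> g m * star (g n) = 0" if "m \<noteq> n" for m n
  proof (cases "g m = 0 \<or> g n = 0")
    case False
    then have "g m \<noteq> g n"
      using g(3) that by metis
    then show ?thesis
      using False gV[of m] gV[of n] orth unfolding pairwise_def by blast
  qed auto
  have "pisom (g n)" for n
    using gV[of n] assms(2) by (auto simp: pisom_def)
  then obtain u where u: "pisom u" "\<And>n. u * (star (g n) * g n) = g n" "\<And>n. g n * star (g n) * u = g n"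
    "\<And>z. (\<And>n. z * g n = 0) \<Longrightarrow> z * u = 0" "\<And>z. (\<And>n. g n * z = 0) \<Longrightarrow> u * z = 0"
    "\<And>N. vna N \<Longrightarrow> (\<And>n. g n \<in> N) \<Longrightarrow> u \<in> N"
    using orthogonal_sum[of g] o by metis
  have gM: "g n \<in> M" for n
    using gV[of n] assms(1) by auto
  have rg: "v = 0 \<or> v \<in> range g" if "v \<in> V" for v
    using g(2) that by auto
  show thesis
  proof (rule that[OF _ u(1)])
    show "u \<in> M"
      by (rule u(6)) (use gM vna_axioms in auto)
    show "u * (star v * v) = v" "v * star v * u = v" if "v \<in> V" for v
      using rg[OF that] u(2,3) by auto
    show "z * u = 0" if "\<And>v. v \<in> V \<Longrightarrow> z * v = 0" for z
      by (rule u(4)) (use that gV in force)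
    show "u * z = 0" if "\<And>v. v \<in> V \<Longrightarrow> v * z = 0" for z
      by (rule u(5)) (use that gV in force)
  qed
qed

text \<open>Sums the range projections instead of the \<open>v\<close> themselves, because copies of
  one projection share their initial projection and only their ranges are orthogonal.\<close>

lemma final_sum:
  assumes "V \<subseteq> M" and pisom: "\<And>v. v \<in> V \<Longrightarrow> pisom v" and orth_V: "pairwise (\<lambda>v w. star v * w = 0) V"
  obtains Z where "Z \<in> M" "proj Z" "\<And>v. v \<in> V \<Longrightarrow> Z * v = v"
    "\<And>z. (\<And>v. v \<in> V \<Longrightarrow> z * v = 0) \<Longrightarrow> z * Z = 0"
proof -
  define P where "P = (\<lambda>v. v * star v) ` V"
  have P: "P \<subseteq> M" "\<And>p. p \<in> P \<Longrightarrow> proj p"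
    using assms by (auto simp: P_def proj_self_star)
  have orth: "pairwise (\<lambda>v w. star v * w = 0 \<and> v * star w = 0) P"
    unfolding P_def
  proof (rule pairwise_imageI)
    fix x y
    assume "x \<in> V" "y \<in> V" "x \<noteq> y"
    then have "star x * y = 0"
      using orth_V by (simp add: pairwise_def)
    then have "x * star x * (y * star y) = 0"
      by (metis mult.assoc mult_zero_left mult_zero_right)
    then show "star (x * star x) * (y * star y) = 0 \<and> x * star x * star (y * star y) = 0"
      by simp
  qed
  obtain u where u: "u \<in> M" "pisom u" "\<And>p. p \<in> P \<Longrightarrow> u * (star p * p) = p" "\<And>p. p \<in> P \<Longrightarrow> p * star p * u = p"
    "\<And>z. (\<And>p. p \<in> P \<Longrightarrow> z * p = 0) \<Longrightarrow> z * u = 0" "\<And>z. (\<And>p. p \<in> P \<Longrightarrow> p * z = 0) \<Longrightarrow> u * z = 0"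
  proof (rule countable_sum[OF P(1) _ orth])
    show "pisom p" if "p \<in> P" for p
      using P(2)[OF that] by (rule proj_imp_pisom)
  qed auto
  define Z where "Z = u * star u"
  have Z: "Z \<in> M" "proj Z"
    using u by (simp_all add: Z_def proj_self_star)
  have Zv: "Z * v = v" if "v \<in> V" for v
  proof -
    define p where "p = v * star v"
    have "p \<in> P"
      using that by (simp add: p_def P_def)
    have "star p = p" "p * p = p"
      using P(2)[OF \<open>p \<in> P\<close>] by (simp_all add: proj_def)
    then have "u * p = p"
      using u(3)[OF \<open>p \<in> P\<close>] by simp
    then have "Z * p = p"
      using u(2) unfolding Z_def pisom_def by (metis mult.assoc)
    moreover have "p * v = v"
      using pisom[OF that] by (simp add: p_def pisom_def)
    ultimately show ?thesis
      by (metis mult.assoc)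
  qed
  show thesis
  proof (rule that[OF Z Zv])
    show "z * Z = 0" if "\<And>v. v \<in> V \<Longrightarrow> z * v = 0" for z
    proof -
      have "z * u = 0"
        by (rule u(5)) (use that in \<open>auto simp: P_def mult.assoc[symmetric]\<close>)
      then show ?thesis
        by (simp add: Z_def mult.assoc[symmetric])
    qed
  qed
qed

end

text \<open>Murray-von Neumann subequivalence.\<close>

definition subeq :: "('h::complex_hilbert) cop set \<Rightarrow> 'h cop \<Rightarrow> 'h cop \<Rightarrow> bool"
  where "subeq M p q \<longleftrightarrow> (\<exists>u\<in>M. star u * u = p \<and> q * u = u)"

text \<open>A copy of \<open>r\<close> below \<open>e\<close> is recorded by the partial isometry
  that carries \<open>r\<close> onto it; \<open>star v * w = 0\<close> then means that the two
  copies are orthogonal.\<close>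

definition copies :: "('h::complex_hilbert) cop set \<Rightarrow> 'h cop \<Rightarrow> 'h cop \<Rightarrow> 'h cop set"
  where "copies M r e = {v \<in> M. star v * v = r \<and> e * v = v}"

locale separable_factor = separable_vna M D for M :: "('h::complex_hilbert) cop set" and D +
  assumes trivial_center: "Z \<in> M \<Longrightarrow> (\<And>T. T \<in> M \<Longrightarrow> Z * T = T * Z) \<Longrightarrow> \<exists>c. Z = cscale c 1"
begin

text \<open>The largest projection \<open>z\<close> with \<open>p M z = 0\<close> is central.\<close>

lemma corner_nonzero:
  assumes p: "p \<in> M" "proj p" "p \<noteq> 0" and q: "q \<in> M" "proj q" "q \<noteq> 0"
  shows "\<exists>T\<in>M. p * T * q \<noteq> 0"
proof (rule ccontr)
  assume "\<not> ?thesis"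
  then have pq: "p * T * q = 0" if "T \<in> M" for T
    using that by blast
  define A where "A = {f \<in> M. proj f \<and> (\<forall>T\<in>M. p * T * f = 0)}"
  obtain V where V: "{q} \<subseteq> V" "V \<subseteq> A" "pairwise (\<lambda>f g. f * g = 0) V"
    "\<And>x. x \<in> A \<Longrightarrow> pairwise (\<lambda>f g. f * g = 0) (insert x V) \<Longrightarrow> x \<in> V"
    using maximal_pairwise[of "{q}" A "\<lambda>f g. f * g = 0"] pq q by (auto simp: A_def)
  have projV: "proj f" "star f = f" "f \<in> M" "f * f = f" if "f \<in> V" for f
    using V(2) that by (auto simp: A_def proj_def)
  obtain u where u: "u \<in> M" "pisom u" "\<And>v. v \<in> V \<Longrightarrow> u * (star v * v) = v" "\<And>v. v \<in> V \<Longrightarrow> v * star v * u = v"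
    "\<And>z. (\<And>v. v \<in> V \<Longrightarrow> z * v = 0) \<Longrightarrow> z * u = 0" "\<And>z. (\<And>v. v \<in> V \<Longrightarrow> v * z = 0) \<Longrightarrow> u * z = 0"
  proof (rule countable_sum)
    show "pairwise (\<lambda>v w. star v * w = 0 \<and> v * star w = 0) V"
      using V(3) projV(2) by (simp add: pairwise_def)
  qed (use projV in \<open>auto simp: proj_imp_pisom\<close>)
  define z where "z = u * star u"
  have z: "proj z" "z \<in> M"
    using u by (simp_all add: z_def proj_self_star)
  have fz: "f * z = f" if "f \<in> V" for f
  proof -
    have "f * u = f" "u * f = f"
      using u(3,4)[OF that] projV[OF that] by simp_all
    then have "f * star u = f"
      using projV(2)[OF that] by (metis star_mult)
    then show ?thesis
      using \<open>f * u = f\<close> by (simp add: z_def mult.assoc[symmetric])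
  qed
  have pz: "p * T * z = 0" if "T \<in> M" for T
  proof -
    have "p * T * u = 0"
      by (rule u(5)) (use V(2) that in \<open>auto simp: A_def\<close>)
    then show ?thesis
      by (simp add: z_def mult.assoc[symmetric])
  qed
  have Tz: "T * z = z * T * z" if "T \<in> M" for T
  proof -
    \<comment> \<open>The part of \<open>T * z\<close> outside \<open>z\<close>. Its range
      projection \<open>l\<close> lies in \<open>A\<close> and is orthogonal to \<open>V\<close>, so
      maximality forces it to vanish.\<close>
    define B where "B = (1 - z) * T * z"
    obtain w where w: "w * star w * B = B" "w * star w * w = w" "\<And>y. y * B = 0 \<Longrightarrow> y * w = 0"
      "\<And>N. vna N \<Longrightarrow> B \<in> N \<Longrightarrow> w \<in> N"
      by (rule polar[of B]) (rule that)
    have "w \<in> M"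
      by (rule w(4)) (use vna_axioms z that in \<open>auto simp: B_def\<close>)
    define l where "l = w * star w"
    have l: "l \<in> M" "proj l"
      using \<open>w \<in> M\<close> w(2) by (simp_all add: l_def proj_self_star pisom_def)
    have "p * S * l = 0" if "S \<in> M" for S
    proof -
      have "p * S * B = p * (S * T) * z - p * (S * z * T) * z"
        by (simp add: B_def right_diff_distrib left_diff_distrib mult.assoc)
      also have "\<dots> = 0"
        using pz[of "S * T"] pz[of "S * z * T"] that \<open>T \<in> M\<close> z by simp
      finally have "p * S * w = 0"
        by (rule w(3))
      then show ?thesis
        by (simp add: l_def mult.assoc[symmetric])
    qed
    then have "l \<in> A"
      using l by (simp add: A_def)
    moreover have fl: "f * l = 0" if "f \<in> V" for f
    proof -
      have "f * B = (f - f * z) * T * z"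
        by (simp add: B_def right_diff_distrib left_diff_distrib mult.assoc)
      then have "f * w = 0"
        using fz[OF that] by (intro w(3)) simp
      then show ?thesis
        by (simp add: l_def mult.assoc[symmetric])
    qed
    moreover have "l * f = 0" if "f \<in> V" for f
      using arg_cong[OF fl[OF that], of star] projV(2)[OF that] l(2) by (simp add: proj_def)
    ultimately have "l \<in> V"
      using V(3) by (intro V(4)) (auto simp: pairwise_insert)
    then have "l = 0"
      using fl[of l] l(2) by (simp add: proj_def)
    then have "B = 0"
      using w(1) by (simp add: l_def)
    then show ?thesis
      by (simp add: B_def left_diff_distrib)
  qed
  have "z * T = T * z" if "T \<in> M" for T
  proof -
    have "star (star T * z) = star (z * star T * z)"
      using Tz[of "star T"] that by simp
    then have "z * T = z * T * z"
      using z(1) by (simp add: proj_def mult.assoc)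
    with Tz[OF that] show ?thesis
      by simp
  qed
  then obtain c where c: "z = cscale c 1"
    using trivial_center z(2) by blast
  have "z \<noteq> 0"
    using fz[of q] V(1) q by auto
  have "p * z = cscale c p"
    by (rule cop_eqI) (simp add: c)
  with pz[OF one] have "cscale c p = 0"
    by simp
  then have "cscale (inverse c * c) p = 0"
    by (intro cop_eqI) (metis ap_linear(6,8) scaleC_scaleC scaleC_zero_right)
  moreover have "c \<noteq> 0"
  proof
    assume "c = 0"
    then have "z = 0"
      unfolding c by (intro cop_eqI) (metis ap_linear(6,8) mult_zero_left scaleC_scaleC scaleC_zero_right scaleR_scaleC of_real_0 scaleR_zero_left)
    with \<open>z \<noteq> 0\<close> show False ..
  qed
  ultimately have "p = 0"
    by (intro cop_eqI) (metis ap_linear(6,8) left_inverse scaleC_one)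
  with p show False
    by simp
qed

text \<open>Take the polar part of a nonzero \<open>q * T * p\<close>.\<close>

lemma partial_isometry_between:
  assumes p: "p \<in> M" "proj p" "p \<noteq> 0" and q: "q \<in> M" "proj q" "q \<noteq> 0"
  obtains u where "u \<in> M" "pisom u" "u \<noteq> 0" "u * p = u" "q * u = u"
proof -
  obtain T where T: "T \<in> M" "q * T * p \<noteq> 0"
    using corner_nonzero[OF q p] by blast
  define A where "A = q * T * p"
  obtain u where u: "u * star u * A = A" "u * star u * u = u" "\<And>z. A * z = 0 \<Longrightarrow> u * z = 0"
    "\<And>z. z * A = 0 \<Longrightarrow> z * u = 0" "\<And>N. vna N \<Longrightarrow> A \<in> N \<Longrightarrow> u \<in> N"
    by (rule polar[of A]) (rule that)
  have "u * (1 - p) = 0" "(1 - q) * u = 0"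
    using p q by (intro u(3,4); simp add: A_def right_diff_distrib left_diff_distrib mult.assoc proj_simps)+
  then have "u * p = u" "q * u = u"
    by (simp_all add: right_diff_distrib left_diff_distrib)
  moreover have "u \<in> M"
    by (rule u(5)) (use vna_axioms p q T in \<open>auto simp: A_def\<close>)
  moreover have "u \<noteq> 0"
    using u(1) T(2) by (auto simp: A_def)
  ultimately show thesis
    using that u(2) by (auto simp: pisom_def)
qed

text \<open>\<open>U\<close> sums a maximal orthogonal family of partial isometries from below
  \<open>p\<close> to below \<open>q\<close>. If both leftovers \<open>x\<close> and
  \<open>y\<close> were nonzero, a partial isometry between them would enlarge the family.\<close>

lemma comparability:
  assumes p: "p \<in> M" "proj p" and q: "q \<in> M" "proj q"
  shows "subeq M p q \<or> subeq M q p"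
proof -
  define A where "A = {u \<in> M. pisom u \<and> u * p = u \<and> q * u = u}"
  define R where "R v w \<longleftrightarrow> star v * w = 0 \<and> v * star w = 0" for v w :: "'h cop"
  obtain V where V: "V \<subseteq> A" "pairwise R V" "\<And>x. x \<in> A \<Longrightarrow> pairwise R (insert x V) \<Longrightarrow> x \<in> V"
    using maximal_pairwise[of "{}" A R] by auto
  obtain U where U: "U \<in> M" "pisom U" "\<And>v. v \<in> V \<Longrightarrow> U * (star v * v) = v" "\<And>v. v \<in> V \<Longrightarrow> v * star v * U = v"
    "\<And>z. (\<And>v. v \<in> V \<Longrightarrow> z * v = 0) \<Longrightarrow> z * U = 0" "\<And>z. (\<And>v. v \<in> V \<Longrightarrow> v * z = 0) \<Longrightarrow> U * z = 0"
    using countable_sum[of V] V(1,2) unfolding A_def R_def by blast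
  have "U * (1 - p) = 0" "(1 - q) * U = 0"
    using V(1) by (intro U(5,6); auto simp: A_def right_diff_distrib left_diff_distrib)+
  then have Up: "U * p = U" "q * U = U"
    by (simp_all add: right_diff_distrib left_diff_distrib)
  have Ups: "p * star U = star U" "star U * q = star U"
    using arg_cong[OF Up(1), of star] arg_cong[OF Up(2), of star] p q by (simp_all add: proj_def)
  define x where "x = p - star U * U"
  define y where "y = q - U * star U"
  have x: "x \<in> M" "proj x" and y: "y \<in> M" "proj y"
    using p q U by (auto simp: x_def y_def Ups Up mult.assoc[symmetric] intro!: proj_diff proj_star_self proj_self_star)
  have vy: "star v * y = 0" "v * x = 0" if "v \<in> V" for v
  proof -
    have v: "v * star v * v = v" "v * p = v" "q * v = v"
      using V(1) that by (auto simp: A_def pisom_def)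
    have "U * star U * v = U * star U * U * (star v * v)"
      using U(3)[OF that] by (simp add: mult.assoc)
    also have "\<dots> = v"
      using U(2) U(3)[OF that] by (simp add: pisom_def)
    finally have "y * v = 0"
      by (simp add: y_def left_diff_distrib v)
    then show "star v * y = 0"
      using y(2) by (metis proj_def star_mult star_zero)
    have "U * star v = U * (star v * v) * star v"
      using arg_cong[OF v(1), of star] by (simp add: mult.assoc)
    then have "U * star v = v * star v"
      using U(3)[OF that] by simp
    then have "v * star U = v * star v"
      by (metis star_mult star_star)
    then have "v * (star U * U) = v"
      using U(4)[OF that] by (simp add: mult.assoc[symmetric])
    then show "v * x = 0"
      by (simp add: x_def right_diff_distrib v)
  qed
  have "x = 0 \<or> y = 0"
  proof (rule ccontr)
    assume "\<not> ?thesis"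
    then obtain w where w: "w \<in> M" "pisom w" "w \<noteq> 0" "w * x = w" "y * w = w"
      using partial_isometry_between[OF x _ y] by metis
    have "x * p = x"
      using p U(1) Up by (simp add: x_def left_diff_distrib proj_simps mult.assoc)
    then have "w * p = w"
      by (metis w(4) mult.assoc)
    have "q * y = y"
      using q Up by (simp add: y_def right_diff_distrib proj_simps mult.assoc[symmetric])
    then have "q * w = w"
      by (metis w(5) mult.assoc)
    with \<open>w * p = w\<close> w have "w \<in> A"
      by (simp add: A_def)
    have vw: "star v * w = 0" "v * star w = 0" if "v \<in> V" for v
    proof -
      have "star v * (y * w) = 0"
        using vy(1)[OF that] by (simp add: mult.assoc[symmetric])
      then show "star v * w = 0"
        by (simp add: w)
      have "star w = x * star w"
        using w(4) x(2) by (metis proj_def star_mult)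
      then show "v * star w = 0"
        using vy(2)[OF that] by (metis mult.assoc mult_zero_left)
    qed
    have wv: "star w * v = 0" "w * star v = 0" if "v \<in> V" for v
      using arg_cong[OF vw(1)[OF that], of star] arg_cong[OF vw(2)[OF that], of star] by simp_all
    have "w \<in> V"
      using \<open>w \<in> A\<close> V(2) vw wv by (intro V(3)) (auto simp: pairwise_insert R_def)
    from vw(1)[OF this] w(3) show False
      by simp
  qed
  then show ?thesis
  proof
    assume "x = 0"
    then have "star U * U = p"
      by (simp add: x_def)
    then show ?thesis
      using U(1) Up(2) by (auto simp: subeq_def)
  next
    assume "y = 0"
    then have "star (star U) * star U = q"
      by (simp add: y_def)
    then show ?thesis
      using U(1) Ups(1) by (auto simp: subeq_def)
  qed
qed

text \<open>A maximal family leaves a rest \<open>x\<close> of \<open>e\<close> that cannot contain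
  a copy of \<open>r\<close>, so by comparability \<open>x\<close> is a copy of a part of
  \<open>r\<close>, and \<open>l\<close> carries that part onto \<open>x\<close>. The last clause
  says that all these ranges exhaust \<open>e\<close>.\<close>

lemma maximal_copies:
  assumes r: "r \<in> M" "proj r" "r \<noteq> 0" and e: "e \<in> M" "proj e"
    and V0: "V0 \<subseteq> copies M r e" "pairwise (\<lambda>v w. star v * w = 0) V0"
  obtains V l where "V0 \<subseteq> V" "V \<subseteq> copies M r e" "pairwise (\<lambda>v w. star v * w = 0) V" "countable V"
    "l \<in> M" "pisom l" "l * r = l" "e * l = l" "\<And>v. v \<in> V \<Longrightarrow> star v * l = 0"
    "\<And>z. (\<And>v. v \<in> V \<Longrightarrow> z * v = 0) \<Longrightarrow> z * l = 0 \<Longrightarrow> z * e = 0"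
proof -
  obtain V where V: "V0 \<subseteq> V" "V \<subseteq> copies M r e" "pairwise (\<lambda>v w. star v * w = 0) V"
    "\<And>x. x \<in> copies M r e \<Longrightarrow> pairwise (\<lambda>v w. star v * w = 0) (insert x V) \<Longrightarrow> x \<in> V"
    using maximal_pairwise[OF V0] by auto
  have v: "v \<in> M" "star v * v = r" "e * v = v" "pisom v" "v \<noteq> 0" "v * star v * v = v" if "v \<in> V" for v
    using V(2) that r pisomI[of v] by (auto simp: copies_def pisom_def)
  have "countable V"
    using V(3) v by (intro countable_orthogonal) auto
  obtain Z where Z: "Z \<in> M" "proj Z" and Zv: "\<And>v. v \<in> V \<Longrightarrow> Z * v = v"
      and Zz: "\<And>z. (\<And>v. v \<in> V \<Longrightarrow> z * v = 0) \<Longrightarrow> z * Z = 0"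
    by (rule final_sum[OF _ v(4) V(3)]) (use v(1) in blast, auto)
  have "(1 - e) * Z = 0"
    by (rule Zz) (simp add: left_diff_distrib v(3))
  then have eZ: "e * Z = Z"
    by (simp add: left_diff_distrib)
  define x where "x = e - Z"
  have x: "x \<in> M" "proj x" "e * x = x"
    using e Z eZ by (auto simp: x_def right_diff_distrib proj_simps intro: proj_diff)
  have vx: "star v * x = 0" if "v \<in> V" for v
  proof -
    have "x * v = 0"
      using Zv[OF that] v(3)[OF that] by (simp add: x_def left_diff_distrib)
    then show ?thesis
      using x(2) by (metis proj_def star_mult star_zero)
  qed
  have "\<not> subeq M r x"
  proof
    assume "subeq M r x"
    then obtain w where w: "w \<in> M" "star w * w = r" "x * w = w"
      by (auto simp: subeq_def)
    have "e * w = w"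
      using w(3) x(3) by (metis mult.assoc)
    have vw: "star v * w = 0" if "v \<in> V" for v
      using vx[OF that] w(3) by (metis mult.assoc mult_zero_left)
    have "star w * v = 0" if "v \<in> V" for v
      using arg_cong[OF vw[OF that], of star] by simp
    with vw have "w \<in> V"
      using V(3) w \<open>e * w = w\<close> by (intro V(4)) (auto simp: copies_def pairwise_insert)
    from vw[OF this] w r show False
      by simp
  qed
  then obtain t where t: "t \<in> M" "star t * t = x" "r * t = t"
    using comparability[OF r(1,2) x(1,2)] by (auto simp: subeq_def)
  have "pisom t"
    using t(2) x(2) pisomI by blast
  have tx: "t * x = t"
    by (rule mult_star_self[OF t(2) x(2)])
  have xt: "x * star t = star t"
    using arg_cong[OF tx, of star] x(2) by (simp add: proj_def)
  show thesis
  proof (rule that[OF V(1,2,3) \<open>countable V\<close>, of "star t"])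
    show "star t \<in> M" "pisom (star t)"
      using t \<open>pisom t\<close> by (auto intro: pisom_star)
    show "star t * r = star t"
      using arg_cong[OF t(3), of star] r(2) by (simp add: proj_def)
    show "e * star t = star t"
      by (metis mult.assoc x(3) xt)
    show "star v * star t = 0" if "v \<in> V" for v
      by (metis mult.assoc mult_zero_left vx[OF that] xt)
    show "z * e = 0" if "\<And>v. v \<in> V \<Longrightarrow> z * v = 0" "z * star t = 0" for z
    proof -
      have "z * Z = 0"
        by (rule Zz) (rule that(1))
      moreover have "z * x = 0"
        using that(2) by (simp add: t(2)[symmetric] mult.assoc[symmetric])
      ultimately show ?thesis
        by (simp add: x_def right_diff_distrib)
    qed
  qed
qed

end

section \<open>Spectral projections\<close>

text \<open>A spectral projection without functional calculus: \<open>e\<close> is the support of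
  \<open>T = R + H\<close> with \<open>R = |H|\<close>, twice the positive part of \<open>H\<close>.
  As \<open>H\<close> takes both signs, both factors in \<open>T * (R - H) = 0\<close> are nonzero,
  so \<open>e\<close> is neither \<open>0\<close> nor \<open>r\<close>.\<close>

lemma corner_projection:
  fixes A r :: "('h::complex_hilbert) cop"
  assumes r: "proj r" and A: "star A = A" "r * A = A" "\<And>c. A \<noteq> c *\<^sub>R r"
  obtains e where "proj e" "r * e = e" "e \<noteq> 0" "e \<noteq> r" "\<And>N. vna N \<Longrightarrow> A \<in> N \<Longrightarrow> r \<in> N \<Longrightarrow> e \<in> N"
proof -
  have Ar: "A * r = A"
    using arg_cong[OF A(2), of star] r A(1) by (simp add: proj_def)
  have "r \<noteq> 0"
    using A(2) A(3)[of 0] by auto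
  then obtain x where "r \<cdot> x \<noteq> 0"
    using cop_eqI[of r 0] by auto
  define y where "y = (1 / norm (r \<cdot> x)) *\<^sub>R (r \<cdot> x)"
  have rr: "r \<cdot> (r \<cdot> z) = r \<cdot> z" for z
    using arg_cong[OF proj_simps(1)[OF r], of "\<lambda>T. T \<cdot> z"] by simp
  have y: "r \<cdot> y = y" "norm y = 1"
    using \<open>r \<cdot> x \<noteq> 0\<close> by (simp_all add: y_def rr)
  define c where "c = inner (A \<cdot> y) y"
  have "\<exists>z. r \<cdot> z = z \<and> norm z = 1 \<and> inner (A \<cdot> z) z \<noteq> c"
  proof (rule ccontr)
    assume "\<not> ?thesis"
    then have c: "inner (A \<cdot> z) z = c" if "r \<cdot> z = z" "norm z = 1" for z
      using that by blast
    have "A - c *\<^sub>R r = 0"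
    proof (rule selfadjoint_eq_0)
      show "star (A - c *\<^sub>R r) = A - c *\<^sub>R r"
        using A r by (simp add: proj_def)
      fix x
      have "inner (A \<cdot> x) x = inner (A \<cdot> (r \<cdot> x)) (r \<cdot> x)"
      proof -
        have "star r * (A * r) = A"
          using Ar A(2) r by (simp add: proj_def)
        from arg_cong[OF this, of "\<lambda>T. T \<cdot> x"] have "A \<cdot> x = star r \<cdot> (A \<cdot> (r \<cdot> x))"
          by simp
        then show ?thesis
          by (metis inner_star star_star)
      qed
      also have "\<dots> = c * (norm (r \<cdot> x))\<^sup>2"
      proof (cases "r \<cdot> x = 0")
        case False
        define n where "n = norm (r \<cdot> x)"
        have "n \<noteq> 0"
          using False by (simp add: n_def)
        have "inner (A \<cdot> ((1 / n) *\<^sub>R (r \<cdot> x))) ((1 / n) *\<^sub>R (r \<cdot> x)) = c"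
          using False by (intro c) (simp_all add: n_def rr)
        then have "inner (A \<cdot> (r \<cdot> x)) (r \<cdot> x) = c * (n * n)"
          using \<open>n \<noteq> 0\<close> by (simp add: field_simps)
        then show ?thesis
          by (simp add: n_def power2_eq_square)
      qed simp
      also have "\<dots> = c * inner (r \<cdot> x) x"
        unfolding norm_ap_eq using r by (simp add: proj_def)
      finally show "inner ((A - c *\<^sub>R r) \<cdot> x) x = 0"
        by (simp add: inner_diff_left)
    qed
    with A(3)[of c] show False
      by simp
  qed
  then obtain z where z: "r \<cdot> z = z" "norm z = 1" "inner (A \<cdot> z) z \<noteq> c"
    by blast
  \<comment> \<open>Halfway between two different values of the quadratic form of \<open>A\<close>
    at unit vectors, so that \<open>K\<close> takes both signs.\<close>
  define l where "l = (c + inner (A \<cdot> z) z) / 2"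
  define K where "K = A - l *\<^sub>R r"
  have K: "star K = K" "r * K = K" "K * r = K"
    using A Ar r by (simp_all add: K_def proj_def right_diff_distrib left_diff_distrib)
  have "inner y y = 1" "inner z z = 1"
    using y z by (simp_all add: power2_norm_eq_inner[symmetric])
  then have Kv: "inner (K \<cdot> y) y = c - l" "inner (K \<cdot> z) z = inner (A \<cdot> z) z - l"
    using y z by (simp_all add: K_def inner_diff_left c_def)
  have signs: "(\<exists>x. inner (K \<cdot> x) x < 0) \<and> (\<exists>x. inner (K \<cdot> x) x > 0)"
  proof (cases "inner (A \<cdot> z) z < c")
    case True
    then have "inner (K \<cdot> z) z < 0" "inner (K \<cdot> y) y > 0"
      unfolding Kv by (simp_all add: l_def)
    then show ?thesis
      by blast
  next
    case False
    then have "inner (K \<cdot> y) y < 0" "inner (K \<cdot> z) z > 0"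
      unfolding Kv using z(3) by (simp_all add: l_def)
    then show ?thesis
      by blast
  qed
  define k where "k = 1 / (1 + norm K)"
  have "1 + norm K > 0"
    by (simp add: add_pos_nonneg)
  then have "k > 0"
    by (simp add: k_def)
  define H where "H = k *\<^sub>R K"
  have H: "star H = H" "r * H = H" "H * r = H"
    using K by (simp_all add: H_def)
  have "norm H \<le> 1"
    using \<open>1 + norm K > 0\<close> by (simp add: H_def k_def)
  have "norm (1 - H * H) \<le> 1"
    using norm_one_minus_star_mult[OF \<open>norm H \<le> 1\<close>] by (simp add: H)
  then obtain R where R: "star R = R" "R * R = H * H" "norm (1 - R) \<le> 1"
      "\<And>N. vna N \<Longrightarrow> H * H \<in> N \<Longrightarrow> R \<in> N"
    using sqrt_exists[of "H * H"] H by auto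
  have R0: "0 \<le> inner (R \<cdot> x) x" for x
  proof -
    have "inner ((1 - R) \<cdot> x) x \<le> norm ((1 - R) \<cdot> x) * norm x"
      by (rule norm_cauchy_schwarz)
    also have "\<dots> \<le> (1 * norm x) * norm x"
      using R(3) by (intro mult_right_mono order.trans[OF norm_ap]) auto
    also have "\<dots> = inner x x"
      by (simp add: power2_norm_eq_inner[symmetric] power2_eq_square)
    finally show ?thesis
      by (simp add: inner_diff_left)
  qed
  \<comment> \<open>\<open>R\<close> lies in every von Neumann algebra that contains
    \<open>H * H\<close>, in particular in the commutant of \<open>H\<close>.\<close>
  have "R \<in> {T. \<forall>S\<in>{H}. T * S = S * T}"
    using H by (intro R(4) vna_commutant) (auto simp: mult.assoc)
  then have RH: "R * H = H * R"
    by simp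
  have "star (R * (1 - r)) * (R * (1 - r)) = (1 - star r) * ((R * R) * (1 - r))"
    using R(1) by (simp add: mult.assoc)
  also have "\<dots> = 0"
    unfolding R(2) by (simp add: right_diff_distrib mult.assoc H)
  finally have "R * (1 - r) = 0"
    by (simp only: star_mult_self_eq_0)
  then have Rr: "R * r = R"
    by (simp add: right_diff_distrib)
  have rR: "r * R = R"
    using arg_cong[OF Rr, of star] R(1) r by (simp add: proj_def)
  define T where "T = R + H"
  have Hx: "inner (H \<cdot> x) x = k * inner (K \<cdot> x) x" for x
    by (simp add: H_def)
  have "T \<noteq> 0"
  proof
    assume "T = 0"
    then have "H = - R"
      by (simp add: T_def add_eq_0_iff)
    then have "k * inner (K \<cdot> x) x \<le> 0" for x
      unfolding Hx[symmetric] using R0[of x] by simp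
    moreover obtain x where "inner (K \<cdot> x) x > 0"
      using signs by blast
    ultimately show False
      using \<open>k > 0\<close> by (metis linorder_not_le mult_pos_pos)
  qed
  have "R - H \<noteq> 0"
  proof
    assume "R - H = 0"
    then have "0 \<le> k * inner (K \<cdot> x) x" for x
      unfolding Hx[symmetric] using R0[of x] by simp
    moreover obtain x where "inner (K \<cdot> x) x < 0"
      using signs by blast
    ultimately show False
      using \<open>k > 0\<close> by (metis linorder_not_le mult_pos_neg)
  qed
  have TRH: "T * (R - H) = 0"
    using RH R(2) by (simp add: T_def right_diff_distrib distrib_right)
  obtain u where u: "T * (star u * u) = T" "u * star u * u = u" "\<And>z. T * z = 0 \<Longrightarrow> u * z = 0"
      "\<And>N. vna N \<Longrightarrow> T \<in> N \<Longrightarrow> u \<in> N"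
    by (rule polar[of T]) (rule that)
  define e where "e = star u * u"
  have e: "proj e"
    using u(2) by (simp add: e_def proj_star_self pisom_def)
  show thesis
  proof (rule that[OF e])
    have "u * (1 - r) = 0"
      by (rule u(3)) (simp add: T_def right_diff_distrib distrib_right Rr H)
    then have "e * r = e"
      by (simp add: e_def right_diff_distrib mult.assoc)
    then show "r * e = e"
      using e r by (metis proj_def star_mult)
    show "e \<noteq> 0"
      using u(1) \<open>T \<noteq> 0\<close> by (auto simp: e_def)
    show "e \<noteq> r"
    proof
      assume "e = r"
      have "u * (R - H) = 0"
        by (rule u(3)[OF TRH])
      then have "e * (R - H) = 0"
        by (simp add: e_def mult.assoc)
      then have "R - H = 0"
        unfolding \<open>e = r\<close> by (simp add: right_diff_distrib rR H)
      with \<open>R - H \<noteq> 0\<close> show False ..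
    qed
    fix N
    assume "vna N" "A \<in> N" "r \<in> N"
    interpret vna N by fact
    have "H \<in> N"
      using \<open>A \<in> N\<close> \<open>r \<in> N\<close> by (simp add: H_def K_def)
    moreover have "R \<in> N"
      using \<open>H \<in> N\<close> by (intro R(4)) (auto intro: \<open>vna N\<close>)
    ultimately have "u \<in> N"
      by (intro u(4)) (auto simp: T_def intro: \<open>vna N\<close>)
    then show "e \<in> N"
      by (simp add: e_def)
  qed
qed

section \<open>A generator built from systems of partial isometries\<close>

text \<open>The geometric weights separate the eigenvalues: in \<open>D k = p k + X\<close> the term
  \<open>X\<close> is orthogonal to \<open>p k\<close> and has norm at most 1/2, so the powers of
  \<open>D k\<close> converge to \<open>p k\<close>, and subtracting \<open>p k\<close> leaves a
  multiple of \<open>D (Suc k)\<close>.\<close>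

lemma (in vna) diagonal_mem:
  assumes p: "\<And>i. proj (p i)" "\<And>i j. i \<noteq> j \<Longrightarrow> p i * p j = 0"
    and D: "(\<Sum>i. (1/4) ^ i *\<^sub>R p i) \<in> N"
  shows "p k \<in> N"
proof -
  define D where "D k = (\<Sum>i. (1/4) ^ i *\<^sub>R p (i + k))" for k
  have bound: "norm ((1/4) ^ i *\<^sub>R p (i + k)) \<le> (1/4) ^ i" for i k
    using norm_proj[OF p(1)] by simp
  have summ_norm: "summable (\<lambda>i. norm ((1/4) ^ i *\<^sub>R p (i + k)))" for k
    by (rule summable_comparison_test'[of "\<lambda>i. (1/4) ^ i :: real"]) (use bound in \<open>auto simp: summable_geometric\<close>)
  then have summ: "summable (\<lambda>i. (1/4) ^ i *\<^sub>R p (i + k))" for k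
    by (rule summable_norm_cancel)
  have norm_D: "norm (D k) \<le> 4/3" for k
  proof -
    have "norm (D k) \<le> (\<Sum>i. norm ((1/4) ^ i *\<^sub>R p (i + k)))"
      unfolding D_def by (rule summable_norm[OF summ_norm])
    also have "\<dots> \<le> (\<Sum>i. (1/4) ^ i)"
      by (rule suminf_le[OF bound summ_norm]) (simp add: summable_geometric)
    also have "\<dots> = 4/3"
      by (subst suminf_geometric) simp_all
    finally show ?thesis .
  qed
  have D_split: "D k = p k + (1/4) *\<^sub>R D (Suc k)" for k
  proof -
    have "(\<Sum>i. (1/4) ^ Suc i *\<^sub>R p (Suc i + k)) = D k - p k"
      using suminf_split_head[OF summ[of k]] by (simp add: D_def)
    moreover have "(\<Sum>i. (1/4) ^ Suc i *\<^sub>R p (Suc i + k)) = (1/4) *\<^sub>R D (Suc k)"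
      unfolding D_def using suminf_scaleR_right[OF summ[of "Suc k"], of "1/4"] by simp
    ultimately have "D k - p k = (1/4) *\<^sub>R D (Suc k)"
      by simp
    then show ?thesis
      by (simp only: diff_eq_eq add.commute)
  qed
  have pD: "p k * D (Suc k) = 0" "D (Suc k) * p k = 0" for k
  proof -
    have "p k * D (Suc k) = (\<Sum>i. p k * ((1/4) ^ i *\<^sub>R p (i + Suc k)))"
      unfolding D_def by (rule suminf_mult[symmetric, OF summ])
    then show "p k * D (Suc k) = 0"
      using p(2) by simp
    have "D (Suc k) * p k = (\<Sum>i. ((1/4) ^ i *\<^sub>R p (i + Suc k)) * p k)"
      unfolding D_def by (rule suminf_mult2[OF summ])
    then show "D (Suc k) * p k = 0"
      using p(2) by simp
  qed
  have step: "p k \<in> N \<and> D (Suc k) \<in> N" if "D k \<in> N" for k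
  proof -
    define X where "X = (1/4) *\<^sub>R D (Suc k)"
    have X: "p k * X = 0" "X * p k = 0" "norm X \<le> 1/2"
      using pD norm_D[of "Suc k"] by (simp_all add: X_def)
    have pow: "D k ^ Suc n = p k + X ^ Suc n \<and> p k * X ^ Suc n = 0" for n
    proof (induction n)
      case 0
      then show ?case
        using X D_split[of k] by (simp add: X_def)
    next
      case (Suc n)
      have "D k ^ Suc (Suc n) = (p k + X) * (p k + X ^ Suc n)"
        using Suc D_split[of k] by (simp add: X_def)
      also have "\<dots> = p k + X ^ Suc (Suc n)"
        using Suc X proj_simps(1)[OF p(1)] by (simp add: distrib_left distrib_right)
      finally show ?case
        using X by (simp add: mult.assoc[symmetric])
    qed
    have norm_X: "norm (X ^ Suc n) \<le> (1/2) ^ Suc n" for n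
    proof (induction n)
      case (Suc n)
      have "norm (X ^ Suc (Suc n)) \<le> norm X * norm (X ^ Suc n)"
        using norm_mult_ineq[of X "X ^ Suc n"] by simp
      also have "\<dots> \<le> 1/2 * (1/2) ^ Suc n"
        using X(3) Suc by (intro mult_mono) auto
      finally show ?case
        by simp
    qed (use X in simp)
    have "(\<lambda>n. X ^ Suc n) \<longlonglongrightarrow> 0"
    proof (rule Lim_null_comparison)
      show "(\<lambda>n. (1/2 :: real) ^ Suc n) \<longlonglongrightarrow> 0"
        by (rule LIMSEQ_Suc, rule LIMSEQ_power_zero) simp
    qed (use norm_X in \<open>auto intro: always_eventually\<close>)
    then have "(\<lambda>n. p k + X ^ Suc n) \<longlonglongrightarrow> p k + 0"
      by (intro tendsto_intros)
    then have "(\<lambda>n. D k ^ Suc n) \<longlonglongrightarrow> p k"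
      using pow by simp
    then have "p k \<in> N"
      by (rule norm_limit[rotated]) (use that in auto)
    moreover have "D (Suc k) = 4 *\<^sub>R (D k - p k)"
      using D_split[of k] by simp
    ultimately show ?thesis
      using that by simp
  qed
  have "D k \<in> N" for k
    by (induction k) (use D step in \<open>auto simp: D_def[of 0]\<close>)
  then show ?thesis
    using step by blast
qed

text \<open>\<open>T\<close> is reassembled from its matrix entries: each block
  \<open>p m * T * p n\<close> is in \<open>N\<close>, and the blocks are summed strongly, over
  \<open>m\<close> and then over \<open>n\<close>. By \<open>complete\<close> the \<open>p n\<close>
  add up to 1.\<close>

lemma (in vna) mem_if_compressions:
  fixes s :: "nat \<Rightarrow> 'h cop"
  assumes s: "\<And>n. pisom (s n)" "\<And>m n. m \<noteq> n \<Longrightarrow> star (s m) * s n = 0" "\<And>n. s n \<in> N"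
    and complete: "\<And>z. (\<And>n. z * s n = 0) \<Longrightarrow> z = 0"
    and T: "\<And>m n. star (s m) * T * s n \<in> N"
  shows "T \<in> N"
proof -
  define p where "p n = s n * star (s n)" for n
  have p: "proj (p n)" for n
    using s by (simp add: p_def proj_self_star)
  have pp: "p m * p n = 0" if "m \<noteq> n" for m n
    using s(2)[OF that] by (metis p_def mult.assoc mult_zero_left mult_zero_right)
  have o: "star (p m) * p n = 0" "p m * star (p n) = 0" if "m \<noteq> n" for m n
    using pp[OF that] proj_simps(3)[OF p] by simp_all
  obtain u where u: "\<And>n. u * (star (p n) * p n) = p n" "\<And>x. (\<lambda>k. (\<Sum>n<k. p n) \<cdot> x) \<longlonglongrightarrow> u \<cdot> x"
    by (rule orthogonal_sum[of p, OF proj_imp_pisom[OF p] o]) (assumption | rule that)+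
  have "(u - 1) * s n = 0" for n
  proof -
    have "u * p n = p n"
      using u(1)[of n] proj_simps(1,3)[OF p[of n]] by simp
    moreover have "p n * s n = s n"
      using s(1)[of n] by (simp add: p_def pisom_def)
    ultimately have "u * s n = s n"
      by (metis mult.assoc)
    then show ?thesis
      by (simp add: left_diff_distrib)
  qed
  then have "u = 1"
    using complete[of "u - 1"] by simp
  with u(2) have lim: "(\<lambda>k. (\<Sum>n<k. p n) \<cdot> x) \<longlonglongrightarrow> x" for x
    by simp
  have "p m * T * p n \<in> N" for m n
  proof -
    have "p m * T * p n = s m * (star (s m) * T * s n) * star (s n)"
      by (simp add: p_def mult.assoc)
    then show ?thesis
      using s(3) T by simp
  qed
  then have "(\<Sum>m<k. p m) * (T * p n) \<in> N" for k n
    unfolding sum_distrib_right by (intro sum) (simp add: mult.assoc)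
  moreover have "(\<lambda>k. ((\<Sum>m<k. p m) * (T * p n)) \<cdot> x) \<longlonglongrightarrow> (T * p n) \<cdot> x" for n x
    using lim[of "(T * p n) \<cdot> x"] by simp
  ultimately have "T * p n \<in> N" for n
    by (rule strong_limit)
  then have "T * (\<Sum>n<k. p n) \<in> N" for k
    unfolding sum_distrib_left by (intro sum)
  moreover have "(\<lambda>k. (T * (\<Sum>n<k. p n)) \<cdot> x) \<longlonglongrightarrow> T \<cdot> x" for x
    using tendsto_ap_right[OF lim, of T] by simp
  ultimately show ?thesis
    by (rule strong_limit)
qed

text \<open>The summand 1 in the denominator keeps every weight defined and nonzero, so that a term
  isolated from the sum can be divided by its weight.\<close>

lemma summable_weighted:
  fixes x :: "nat \<Rightarrow> 'a::banach"
  shows "summable (\<lambda>n. ((1/2) ^ n / (1 + norm (x n))) *\<^sub>R x n)"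
proof (rule summable_norm_cancel, rule summable_comparison_test'[of "\<lambda>n. (1/2) ^ n :: real"])
  fix n
  have "norm (x n) / (1 + norm (x n)) \<le> 1"
    by (simp add: divide_le_eq_1 add_pos_nonneg)
  then have "(1/2) ^ n * (norm (x n) / (1 + norm (x n))) \<le> (1/2) ^ n * 1"
    by (intro mult_left_mono) auto
  moreover have "\<bar>1 + norm (x n)\<bar> = 1 + norm (x n)"
    by (simp add: abs_of_nonneg)
  ultimately show "norm (norm (((1/2) ^ n / (1 + norm (x n))) *\<^sub>R x n)) \<le> (1/2) ^ n"
    by (simp add: abs_mult abs_divide)
qed (auto simp: summable_geometric)

text \<open>The element \<open>B\<close> has the diagonal blocks \<open>\<Sum> 4\<^sup>-\<^sup>i v\<^sub>i v\<^sub>i\<^sup>*\<close> and \<open>\<Sum> 4\<^sup>-\<^sup>j w\<^sub>j w\<^sub>j\<^sup>*\<close>, whose spectral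
  projections are the final projections of the \<open>v\<^sub>i\<close> and \<open>w\<^sub>j\<close>, and the off-diagonal block
  \<open>\<Sum> c\<^sub>i\<^sub>j v\<^sub>i y\<^sub>i\<^sub>j w\<^sub>j\<^sup>*\<close>. The entries with \<open>i = i0\<close> or \<open>j = j0\<close> produce the partial isometries, all
  other entries \<open>y\<^sub>i\<^sub>j\<close> are at our disposal.\<close>

lemma (in vna) block_element:
  fixes v w :: "nat \<Rightarrow> 'h cop" and y :: "nat \<Rightarrow> nat \<Rightarrow> 'h cop"
  assumes e: "e \<in> N" "proj e" and r: "proj r"
    and v: "\<And>i. v i \<in> N" "\<And>i. pisom (v i)" "\<And>i. e * v i = v i" "\<And>i. v i * r = v i"
      "\<And>i j. i \<noteq> j \<Longrightarrow> star (v i) * v j = 0"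
    and w: "\<And>i. w i \<in> N" "\<And>i. pisom (w i)" "\<And>i. (1 - e) * w i = w i" "\<And>i. w i * r = w i"
      "\<And>i j. i \<noteq> j \<Longrightarrow> star (w i) * w j = 0"
    and base: "v i0 = r" "star (w j0) * w j0 = r"
    and y: "\<And>i j. y i j \<in> N" "\<And>j. y i0 j = r" "\<And>i. y i j0 = r"
  obtains B where "B \<in> N" "star B = B"
    "\<And>Q. vna Q \<Longrightarrow> e \<in> Q \<Longrightarrow> B \<in> Q \<Longrightarrow> r \<in> Q \<and> (\<forall>i. v i \<in> Q) \<and> (\<forall>j. w j \<in> Q) \<and>
      (\<forall>i j. star (v i) * v i * y i j * (star (w j) * w j) \<in> Q)"
proof -
  define f where "f = 1 - e"
  have ef: "e * f = 0" "f * e = 0" "star e = e" "star f = f" "e * e = e" "f * f = f"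
    using e(2) by (simp_all add: f_def proj_def right_diff_distrib left_diff_distrib)
  have fw: "f * w j = w j" for j
    using w(3) by (simp add: f_def)
  define p where "p i = v i * star (v i)" for i
  define q where "q j = w j * star (w j)" for j
  have p: "proj (p i)" and q: "proj (q i)" for i
    using v(2) w(2) by (simp_all add: p_def q_def proj_self_star)
  have pp: "p i * p j = 0" and qq: "q i * q j = 0" if "i \<noteq> j" for i j
    using v(5)[OF that] w(5)[OF that]
    by (metis p_def q_def mult.assoc mult_zero_left mult_zero_right)+
  have ep: "e * p i = p i" and fq: "f * q i = q i" for i
    using v(3) fw by (simp_all add: p_def q_def mult.assoc[symmetric])
  have pe: "p i * e = p i" and qf: "q i * f = q i" for i
    using arg_cong[OF ep[of i], of star] arg_cong[OF fq[of i], of star] p[of i] q[of i] ef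
    by (simp_all add: proj_def)
  define x where "x n = (case prod_decode n of (i, j) \<Rightarrow> v i * y i j * star (w j))" for n
  have xN: "x n \<in> N" for n
    using v(1) w(1) y(1) by (auto simp: x_def split: prod.split)
  define c where "c n = (1/2) ^ n / (1 + norm (x n))" for n
  have c: "c n \<noteq> 0" for n
    by (simp add: c_def add_nonneg_eq_0_iff)
  define C where "C = (\<Sum>n. c n *\<^sub>R x n)"
  have summ_C: "summable (\<lambda>n. c n *\<^sub>R x n)"
    unfolding c_def by (rule summable_weighted)
  define Dp where "Dp = (\<Sum>i. (1/4) ^ i *\<^sub>R p i)"
  define Dq where "Dq = (\<Sum>i. (1/4) ^ i *\<^sub>R q i)"
  have summ_D: "summable (\<lambda>i. (1/4) ^ i *\<^sub>R P i)" if "\<And>i. proj (P i)" for P :: "nat \<Rightarrow> 'h cop"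
    by (rule summable_norm_cancel, rule summable_comparison_test'[of "\<lambda>i. (1/4) ^ i :: real"])
      (use norm_proj[OF that] in \<open>auto simp: summable_geometric\<close>)
  have star_suminf: "star (suminf X) = (\<Sum>n. star (X n))" if "summable X" for X :: "nat \<Rightarrow> 'h cop"
    by (rule bounded_linear.suminf[OF bounded_linear_star that])
  define B where "B = Dp + Dq + C + star C"
  have "Dp \<in> N" "Dq \<in> N" "C \<in> N"
    unfolding Dp_def Dq_def C_def
    by (rule suminf_mem[OF _ summ_D[OF p]] suminf_mem[OF _ summ_D[OF q]] suminf_mem[OF _ summ_C];
        use v(1) w(1) xN in \<open>simp add: p_def q_def\<close>)+
  have eDp: "e * Dp = Dp" "Dp * e = Dp"
    unfolding Dp_def suminf_mult[symmetric, OF summ_D[OF p]] suminf_mult2[OF summ_D[OF p]]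
    by (simp_all add: ep pe)
  have fDq: "f * Dq = Dq" "Dq * f = Dq"
    unfolding Dq_def suminf_mult[symmetric, OF summ_D[OF q]] suminf_mult2[OF summ_D[OF q]]
    by (simp_all add: fq qf)
  have ex: "e * x n = x n" and xf: "x n * f = x n" for n
  proof -
    have "star (w j) * f = star (w j)" for j
      using arg_cong[OF fw[of j], of star] ef by simp
    then show "e * x n = x n" "x n * f = x n"
      using v(3) by (simp_all add: x_def mult.assoc[symmetric] split: prod.split)
        (simp add: mult.assoc)
  qed
  have eC: "e * C = C" "C * f = C"
    unfolding C_def suminf_mult[symmetric, OF summ_C] suminf_mult2[OF summ_C]
    by (simp_all add: ex xf)
  have Ce: "C * e = 0" "f * C = 0"
    using eC ef by (metis mult.assoc mult_zero_right, metis mult.assoc mult_zero_left)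
  have sC: "star C * e = star C" "f * star C = star C" "e * star C = 0" "star C * f = 0"
    using arg_cong[OF eC(1), of star] arg_cong[OF eC(2), of star] arg_cong[OF Ce(1), of star]
      arg_cong[OF Ce(2), of star] ef by simp_all
  have De: "e * Dq = 0" "Dq * e = 0" "f * Dp = 0" "Dp * f = 0"
    using eDp fDq ef by (metis mult.assoc mult_zero_left mult_zero_right)+
  have blocks: "e * B * e = Dp" "f * B * f = Dq" "e * B * f = C"
    by (simp_all add: B_def distrib_left distrib_right eDp fDq eC Ce sC De)
  show thesis
  proof (rule that[of B])
    show "B \<in> N"
      using \<open>Dp \<in> N\<close> \<open>Dq \<in> N\<close> \<open>C \<in> N\<close> by (simp add: B_def)
    have "star Dp = Dp" "star Dq = Dq"
      unfolding Dp_def Dq_def star_suminf[OF summ_D[OF p]] star_suminf[OF summ_D[OF q]]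
      using p q by (simp_all add: proj_def)
    then show "star B = B"
      by (simp add: B_def)
    fix Q
    assume "vna Q" "e \<in> Q" "B \<in> Q"
    interpret Q: vna Q by fact
    have "f \<in> Q"
      using \<open>e \<in> Q\<close> by (simp add: f_def)
    have "Dp \<in> Q" "Dq \<in> Q" "C \<in> Q"
      using \<open>e \<in> Q\<close> \<open>f \<in> Q\<close> \<open>B \<in> Q\<close> by (simp_all add: blocks[symmetric])
    have pQ: "p i \<in> Q" for i
      by (rule Q.diagonal_mem[OF p pp]) (use \<open>Dp \<in> Q\<close> in \<open>simp_all add: Dp_def\<close>)
    have qQ: "q i \<in> Q" for i
      by (rule Q.diagonal_mem[OF q qq]) (use \<open>Dq \<in> Q\<close> in \<open>simp_all add: Dq_def\<close>)
    have vv: "p i * v i' = (if i = i' then v i else 0)" for i i'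
      using v(2)[of i] v(5)[of i i'] by (auto simp: p_def pisom_def mult.assoc)
    have ww: "star (w j') * q j = (if j = j' then star (w j) else 0)" for j j'
      using pisom_star[OF w(2)[of j]] w(5)[of j' j] by (auto simp: q_def pisom_def mult.assoc[symmetric])
    have xQ: "v i * y i j * star (w j) \<in> Q" for i j
    proof -
      define n where "n = prod_encode (i, j)"
      \<comment> \<open>\<open>p i\<close> and \<open>q j\<close> single out the position
        \<open>(i, j)\<close> of the off-diagonal block.\<close>
      have *: "p i * x m * q j = (if m = n then x n else 0)" for m
      proof -
        obtain i' j' where m: "prod_decode m = (i', j')"
          by fastforce
        then have "m = n \<longleftrightarrow> i' = i \<and> j' = j"
          unfolding n_def by (metis Pair_inject prod_decode_inverse prod_encode_inverse)
        moreover have "p i * x m * q j = (p i * v i') * y i' j' * (star (w j') * q j)"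
          by (simp add: x_def m mult.assoc)
        moreover have "x n = v i * y i j * star (w j)"
          by (simp add: x_def n_def)
        ultimately show ?thesis
          by (auto simp: vv ww)
      qed
      have "p i * C = (\<Sum>m. p i * (c m *\<^sub>R x m))"
        unfolding C_def by (rule suminf_mult[symmetric, OF summ_C])
      moreover have "summable (\<lambda>m. p i * (c m *\<^sub>R x m))"
        by (rule summable_mult[OF summ_C])
      ultimately have "p i * C * q j = (\<Sum>m. p i * (c m *\<^sub>R x m) * q j)"
        by (simp add: suminf_mult2)
      also have "\<dots> = (\<Sum>m. if m = n then c n *\<^sub>R x n else 0)"
      proof (rule suminf_cong)
        fix m
        show "p i * (c m *\<^sub>R x m) * q j = (if m = n then c n *\<^sub>R x n else 0)"
          using *[of m] by simp
      qed
      also have "\<dots> = c n *\<^sub>R x n"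
        by (rule sums_unique[symmetric]) (rule sums_If_finite_set[of "{n}" "\<lambda>m. c n *\<^sub>R x n", simplified])
      finally have "p i * C * q j = c n *\<^sub>R x n" .
      then have "x n = (1 / c n) *\<^sub>R (p i * C * q j)"
        using c[of n] by simp
      then have "x n \<in> Q"
        using pQ qQ \<open>C \<in> Q\<close> by simp
      then show ?thesis
        by (simp add: x_def n_def)
    qed
    have rw: "r * star (w j) = star (w j)" for j
      using arg_cong[OF w(4)[of j], of star] r by (simp add: proj_def)
    \<comment> \<open>Row \<open>i0\<close>: its entries \<open>r * r * star (w j)\<close> are the
      \<open>star (w j)\<close> themselves.\<close>
    have "star (w j) \<in> Q" for j
    proof -
      have "v i0 * y i0 j * star (w j) = star (w j)"
        using r by (simp add: base y(2) proj_def rw)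
      with xQ[of i0 j] show ?thesis
        by simp
    qed
    then have wQ: "w j \<in> Q" for j
      using Q.star[of "star (w j)"] by simp
    \<comment> \<open>Column \<open>j0\<close>: its entries \<open>v i * r * star (w j0)\<close>,
      multiplied by \<open>w j0\<close>, give \<open>v i\<close>.\<close>
    have vQ: "v i \<in> Q" for i
    proof -
      have "v i * y i j0 * star (w j0) * w j0 = v i"
        by (simp add: y(3) v(4) mult.assoc base(2))
      then show ?thesis
        using Q.mult[OF xQ[of i j0] wQ[of j0]] by simp
    qed
    have "star (v i) * v i * y i j * (star (w j) * w j) \<in> Q" for i j
    proof -
      have "star (v i) * v i * y i j * (star (w j) * w j) = star (v i) * (v i * y i j * star (w j)) * w j"
        by (simp add: mult.assoc)
      then show ?thesis
        using xQ vQ wQ by simp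
    qed
    with vQ wQ show "r \<in> Q \<and> (\<forall>i. v i \<in> Q) \<and> (\<forall>j. w j \<in> Q) \<and>
      (\<forall>i j. star (v i) * v i * y i j * (star (w j) * w j) \<in> Q)"
      using base(1) by metis
  qed
qed

text \<open>Assigns elements of \<open>Y\<close> to positions in \<open>X\<close>; the alternatives
  serve the infinite case and the cases settled by counting.\<close>

lemma countable_surjection:
  assumes "countable Y" "infinite X \<or> finite Y \<and> card Y \<le> card X"
  shows "\<exists>h :: 'a \<Rightarrow> 'b. Y \<subseteq> h ` X"
proof -
  have "\<exists>g. inj_on g Y \<and> g ` Y \<subseteq> X"
  proof (cases "infinite X")
    case True
    then obtain a :: "nat \<Rightarrow> 'a" where "inj a" "range a \<subseteq> X"
      using infinite_countable_subset by blast
    moreover obtain b :: "'b \<Rightarrow> nat" where "inj_on b Y"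
      using \<open>countable Y\<close> by (rule countableE)
    ultimately have "inj_on (a \<circ> b) Y \<and> (a \<circ> b) ` Y \<subseteq> X"
      by (auto intro: comp_inj_on inj_on_subset)
    then show ?thesis
      by blast
  next
    case False
    then show ?thesis
      using assms(2) card_le_inj[of Y X] by auto
  qed
  then obtain g where g: "inj_on g Y" "g ` Y \<subseteq> X"
    by blast
  have "y \<in> inv_into Y g ` X" if "y \<in> Y" for y
    using g that by (intro image_eqI[of _ _ "g y"]) auto
  then show ?thesis
    by blast
qed

text \<open>Here \<open>V\<close> and \<open>W\<close> are maximal families of copies of \<open>r\<close> in \<open>e\<close> and \<open>1 - e\<close>, and \<open>l\<close>, \<open>k\<close> take care
  of what remains. The elements of \<open>Y\<close> are placed at the pairs in \<open>(V - {r}) \<times> (W - {w0})\<close>.\<close>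

lemma (in vna) generating_element:
  assumes e: "e \<in> N" "proj e" and r: "r \<in> N" "proj r" "r \<noteq> 0"
    and V: "V \<subseteq> copies N r e" "pairwise (\<lambda>v w. star v * w = 0) V" "countable V" "r \<in> V"
    and l: "l \<in> N" "pisom l" "l * r = l" "e * l = l" "\<And>v. v \<in> V \<Longrightarrow> star v * l = 0"
      "\<And>z. (\<And>v. v \<in> V \<Longrightarrow> z * v = 0) \<Longrightarrow> z * l = 0 \<Longrightarrow> z * e = 0"
    and W: "W \<subseteq> copies N r (1 - e)" "pairwise (\<lambda>v w. star v * w = 0) W" "countable W" "w0 \<in> W"
    and k: "k \<in> N" "pisom k" "k * r = k" "(1 - e) * k = k" "\<And>w. w \<in> W \<Longrightarrow> star w * k = 0"
      "\<And>z. (\<And>w. w \<in> W \<Longrightarrow> z * w = 0) \<Longrightarrow> z * k = 0 \<Longrightarrow> z * (1 - e) = 0"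
    and Y: "Y \<subseteq> N" "countable Y"
      "infinite ((V - {r}) \<times> (W - {w0})) \<or> finite Y \<and> card Y \<le> card ((V - {r}) \<times> (W - {w0}))"
    and gen: "\<And>Q T. vna Q \<Longrightarrow> Q \<subseteq> N \<Longrightarrow> r \<in> Q \<Longrightarrow> (\<And>y. y \<in> Y \<Longrightarrow> r * y * r \<in> Q) \<Longrightarrow> T \<in> N \<Longrightarrow>
      r * T * r \<in> Q"
  obtains B where "B \<in> N" "star B = B" "\<And>Q. vna Q \<Longrightarrow> Q \<subseteq> N \<Longrightarrow> e \<in> Q \<Longrightarrow> B \<in> Q \<Longrightarrow> Q = N"
proof -
  have copy: "a \<in> N" "star a * a = r" "g * a = a" "pisom a" "a * r = a" "a \<noteq> 0" if "a \<in> copies N r g" for a g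
    using that r pisomI[of a] mult_star_self[of a r] by (auto simp: copies_def)
  have enum: "\<exists>s :: nat \<Rightarrow> 'h cop. (\<forall>n. s n \<in> insert 0 (insert m U)) \<and> insert m U \<subseteq> range s \<and>
      (\<forall>i j. i \<noteq> j \<longrightarrow> star (s i) * s j = 0)"
    if U: "countable U" "pairwise (\<lambda>v w. star v * w = 0) U" "\<And>v. v \<in> U \<Longrightarrow> star v * m = 0"
    for U and m :: "'h cop"
  proof -
    obtain s :: "nat \<Rightarrow> 'h cop" where s: "\<And>n. s n \<in> insert 0 (insert m U)" "insert m U \<subseteq> range s"
        "\<And>i j. i \<noteq> j \<Longrightarrow> s i = s j \<Longrightarrow> s i = 0"
      by (rule enumerate_countable[of "insert m U"]) (use U(1) in auto)
    have U': "star m * v = 0" if "v \<in> U" for v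
      using arg_cong[OF U(3)[OF that], of star] by simp
    have "star (s i) * s j = 0" if "i \<noteq> j" for i j
    proof (cases "s i = 0 \<or> s j = 0")
      case False
      then have "s i \<noteq> s j"
        using s(3) that by metis
      then show ?thesis
        using False s(1)[of i] s(1)[of j] U(2,3) U' unfolding pairwise_def by auto
    qed auto
    with s show ?thesis
      by blast
  qed
  obtain v :: "nat \<Rightarrow> 'h cop" where v: "\<And>n. v n \<in> insert 0 (insert l V)" "insert l V \<subseteq> range v"
      "\<And>i j. i \<noteq> j \<Longrightarrow> star (v i) * v j = 0"
    using enum[OF V(3,2) l(5)] by metis
  obtain w :: "nat \<Rightarrow> 'h cop" where w: "\<And>n. w n \<in> insert 0 (insert k W)" "insert k W \<subseteq> range w"
      "\<And>i j. i \<noteq> j \<Longrightarrow> star (w i) * w j = 0"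
    using enum[OF W(3,2) k(5)] by metis
  have v': "v i \<in> N" "pisom (v i)" "e * v i = v i" "v i * r = v i" for i
    using v(1)[of i] V(1) l copy[of "v i" e] by (auto simp: pisom_def)
  have w': "w i \<in> N" "pisom (w i)" "(1 - e) * w i = w i" "w i * r = w i" for i
    using w(1)[of i] W(1) k copy[of "w i" "1 - e"] by (auto simp: pisom_def)
  obtain i0 where i0: "v i0 = r"
    using v(2) V(4) by (metis imageE insertI2 subsetD)
  obtain j0 where j0: "w j0 = w0"
    using w(2) W(4) by (metis imageE insertI2 subsetD)
  have w0: "star w0 * w0 = r"
    using copy[of w0] W by blast
  obtain h where h: "Y \<subseteq> h ` ((V - {r}) \<times> (W - {w0}))"
    using countable_surjection[OF Y(2,3)] by blast
  \<comment> \<open>\<open>h\<close> is arbitrary outside the free positions, for instance at the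
    leftovers \<open>l\<close> and \<open>k\<close>; testing for membership in \<open>Y\<close>
    keeps all entries in \<open>N\<close>.\<close>
  define y where "y i j = (if v i = r \<or> w j = w0 then r else if h (v i, w j) \<in> Y then h (v i, w j) else 0)"
    for i j
  have yN: "y i j \<in> N" for i j
    using r(1) Y(1) by (auto simp: y_def)
  have base: "v i0 = r" "star (w j0) * w j0 = r"
    using i0 j0 w0 by simp_all
  have y0: "y i0 j = r" "y i j0 = r" for i j
    by (simp_all add: y_def i0 j0)
  obtain B where B: "B \<in> N" "star B = B"
      "\<And>Q. vna Q \<Longrightarrow> e \<in> Q \<Longrightarrow> B \<in> Q \<Longrightarrow> r \<in> Q \<and> (\<forall>i. v i \<in> Q) \<and> (\<forall>j. w j \<in> Q) \<and>
        (\<forall>i j. star (v i) * v i * y i j * (star (w j) * w j) \<in> Q)"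
    by (rule block_element[where v = v and w = w and y = y and ?i0.0 = i0 and ?j0.0 = j0, OF e r(2) v' v(3) w' w(3) base yN y0])
      (assumption | rule that)+
  show thesis
  proof (rule that[OF B(1,2)])
    fix Q
    assume Q: "vna Q" "Q \<subseteq> N" "e \<in> Q" "B \<in> Q"
    interpret Q: vna Q by fact
    have BQ: "r \<in> Q" "v i \<in> Q" "w j \<in> Q" "star (v i) * v i * y i j * (star (w j) * w j) \<in> Q" for i j
      using B(3)[OF Q(1,3,4)] by auto
    \<comment> \<open>At a free position both partners are full copies of \<open>r\<close>, so the
      entry arrives as \<open>r * a * r\<close>.\<close>
    have "r * a * r \<in> Q" if aY: "a \<in> Y" for a
    proof -
      obtain b c where bc: "b \<in> V - {r}" "c \<in> W - {w0}" "a = h (b, c)"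
        using h aY by blast
      obtain i j where ij: "b = v i" "c = w j"
        using bc v(2) w(2) by (metis DiffD1 imageE insertI2 subsetD)
      have "star b * b = r" "star c * c = r"
        using copy[of b e] copy[of c "1 - e"] bc V(1) W(1) by auto
      moreover have "y i j = a"
        using bc ij aY by (auto simp: y_def)
      ultimately show ?thesis
        using BQ(4)[of i j] ij by simp
    qed
    then have gen': "r * T * r \<in> Q" if "T \<in> N" for T
      using gen[OF Q(1,2) BQ(1) _ that] by blast
    \<comment> \<open>Interleaves both families into one sequence whose ranges fill \<open>e\<close>
      and \<open>1 - e\<close>, as \<open>mem_if_compressions\<close> requires.\<close>
    define s where "s n = (if even n then v (n div 2) else w (n div 2))" for n
    have s: "s n \<in> N" "s n \<in> Q" "pisom (s n)" "s n * r = s n" for n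
      using v' w' BQ by (simp_all add: s_def)
    have vw: "star (v i) * w j = 0" "star (w j) * v i = 0" for i j
    proof -
      have "star (v i) * e = star (v i)"
        using arg_cong[OF v'(3)[of i], of star] e(2) by (simp add: proj_def)
      then have "star (v i) * w j = star (v i) * (e * ((1 - e) * w j))"
        using w'(3)[of j] by (simp add: mult.assoc[symmetric])
      also have "e * ((1 - e) * w j) = 0"
        using e(2) by (simp add: proj_def mult.assoc[symmetric] right_diff_distrib)
      finally show "star (v i) * w j = 0"
        by simp
      from arg_cong[OF this, of star] show "star (w j) * v i = 0"
        by simp
    qed
    have so: "star (s m) * s n = 0" if "m \<noteq> n" for m n
    proof -
      have "m div 2 \<noteq> n div 2" if "even m = even n"
        using that \<open>m \<noteq> n\<close> by (metis dvd_mult_div_cancel odd_two_times_div_two_succ)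
      then show ?thesis
        using v(3) w(3) vw by (simp add: s_def)
    qed
    have complete: "z = 0" if z: "\<And>n. z * s n = 0" for z
    proof -
      have "z * v i = 0" for i
        using z[of "2 * i"] by (simp add: s_def)
      then have "z * e = 0"
        using v(2) by (intro l(6)) (metis imageE insertCI subsetD)+
      have "z * w i = 0" for i
        using z[of "2 * i + 1"] by (simp add: s_def)
      then have "z * (1 - e) = 0"
        using w(2) by (intro k(6)) (metis imageE insertCI subsetD)+
      with \<open>z * e = 0\<close> show ?thesis
        by (simp add: right_diff_distrib)
    qed
    have "T \<in> Q" if "T \<in> N" for T
    proof (rule Q.mem_if_compressions[OF s(3) so s(2) complete])
      fix m n
      have "r * star (s m) = star (s m)"
        using arg_cong[OF s(4)[of m], of star] r by (simp add: proj_def)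
      then have "star (s m) * T * s n = r * (star (s m) * T * s n) * r"
        using s(4)[of n] by (metis mult.assoc)
      also have "\<dots> \<in> Q"
        by (rule gen') (use s(1) that in simp)
      finally show "star (s m) * T * s n \<in> Q" .
    qed
    then show "Q = N"
      using Q(2) by blast
  qed
qed

section \<open>Factors with a minimal projection\<close>

lemma cscale_mult [simp]: "cscale c S * T = cscale c (S * T)" "S * cscale c T = cscale c (S * T)"
  by (rule cop_eqI; simp)+

lemma cscale_of_real: "cscale (complex_of_real c) T = c *\<^sub>R T"
  by (rule cop_eqI) (simp add: scaleR_scaleC)

lemma cscale_cscale: "cscale a (cscale b T) = cscale (a * b) T"
  by (rule cop_eqI) (simp add: scaleC_scaleC)

lemma cscale_add_left: "cscale a T + cscale b T = cscale (a + b) T"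
  by (rule cop_eqI) (simp add: scaleC_add_left)

lemma cscale_one [simp]: "cscale 1 T = T"
  by (rule cop_eqI) simp

lemma cscale_eq_0D: "cscale c T = 0 \<Longrightarrow> T \<noteq> 0 \<Longrightarrow> c = 0"
proof (rule ccontr)
  assume "cscale c T = 0" "T \<noteq> 0" "c \<noteq> 0"
  have "T = cscale (inverse c) (cscale c T)"
    using \<open>c \<noteq> 0\<close> by (simp add: cscale_cscale)
  also have "\<dots> = 0"
    unfolding \<open>cscale c T = 0\<close> by (rule cop_eqI) simp
  finally show False
    using \<open>T \<noteq> 0\<close> by contradiction
qed

text \<open>By \<open>corner_projection\<close>, a self-adjoint element of the corner that is not a
  real multiple of \<open>a\<close> yields such a \<open>t\<close>; other elements split into real
  and imaginary part.\<close>

lemma (in vna) scalar_corner_or_subprojection: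
  assumes a: "a \<in> N" "proj a"
  shows "(\<forall>T\<in>N. \<exists>c. a * T * a = cscale c a) \<or> (\<exists>t\<in>N. proj t \<and> a * t = t \<and> t \<noteq> 0 \<and> t \<noteq> a)"
proof (rule disjCI)
  assume no: "\<not> (\<exists>t\<in>N. proj t \<and> a * t = t \<and> t \<noteq> 0 \<and> t \<noteq> a)"
  have sa: "\<exists>c. H = c *\<^sub>R a" if H: "H \<in> N" "star H = H" "a * H = H" for H
  proof (rule ccontr)
    assume "\<nexists>c. H = c *\<^sub>R a"
    then obtain e where "proj e" "a * e = e" "e \<noteq> 0" "e \<noteq> a"
      and "\<And>N. vna N \<Longrightarrow> H \<in> N \<Longrightarrow> a \<in> N \<Longrightarrow> e \<in> N"
      using corner_projection[OF a(2) H(2,3)] by metis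
    with no show False
      using H(1) a(1) vna_axioms by blast
  qed
  show "\<forall>T\<in>N. \<exists>c. a * T * a = cscale c a"
  proof
    fix T
    assume "T \<in> N"
    define S where "S = a * T * a"
    have S: "S \<in> N" "a * S = S" "a * star S = star S"
      using \<open>T \<in> N\<close> a by (simp_all add: S_def proj_simps mult.assoc)
    obtain c where c: "S + star S = c *\<^sub>R a"
      using sa[of "S + star S"] S by (auto simp: distrib_left add.commute)
    have "star (cscale (- \<i>) (S - star S)) = cscale (- \<i>) (S - star S)"
    proof -
      have neg: "star S - S = cscale (- 1) (S - star S)"
        by (rule cop_eqI) (simp add: scaleC_minus_one)
      have "star (cscale (- \<i>) (S - star S)) = cscale \<i> (star S - S)"
        by simp
      also have "\<dots> = cscale (\<i> * - 1) (S - star S)"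
        unfolding neg cscale_cscale ..
      finally show ?thesis
        by simp
    qed
    then obtain d where d: "cscale (- \<i>) (S - star S) = d *\<^sub>R a"
      using sa[of "cscale (- \<i>) (S - star S)"] S by (auto simp: right_diff_distrib)
    have "cscale \<i> (cscale (- \<i>) (S - star S)) = S - star S"
      by (simp add: cscale_cscale)
    then have diff: "S - star S = cscale (\<i> * complex_of_real d) a"
      unfolding d cscale_of_real[symmetric] by (simp add: cscale_cscale)
    have "2 *\<^sub>R S = (S + star S) + (S - star S)"
      by (simp add: scaleR_2)
    also have "\<dots> = cscale (complex_of_real c + \<i> * complex_of_real d) a"
      unfolding c diff cscale_of_real[symmetric] by (simp add: cscale_add_left)
    finally have "(1/2) *\<^sub>R (2 *\<^sub>R S) = cscale ((complex_of_real c + \<i> * complex_of_real d) / 2) a"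
      by (simp only: cscale_of_real[symmetric] cscale_cscale) simp
    then show "\<exists>c. a * T * a = cscale c a"
      by (auto simp: S_def)
  qed
qed

context separable_factor
begin

text \<open>Between a proper nonzero subprojection \<open>t\<close> and its complement
  \<open>x\<close> there is some \<open>t * R * x \<noteq> 0\<close>, whereas commutativity of the
  corner moves \<open>x\<close> next to \<open>t\<close>.\<close>

lemma abelian_imp_scalar_corner:
  assumes a: "a \<in> M" "proj a" "\<And>S T. S \<in> M \<Longrightarrow> T \<in> M \<Longrightarrow> (a * S * a) * (a * T * a) = (a * T * a) * (a * S * a)"
    and T: "T \<in> M"
  shows "\<exists>c. a * T * a = cscale c a"
proof -
  have False if t: "t \<in> M" "proj t" "a * t = t" "t \<noteq> 0" "t \<noteq> a" for t
  proof -
    define x where "x = a - t"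
    have ta: "t * a = t"
      by (rule proj_le_sym[OF a(2) t(2,3)])
    have x: "x \<in> M" "proj x" "x \<noteq> 0" "a * x = x" "x * a = x" "t * x = 0"
      using a t ta by (simp_all add: x_def proj_diff right_diff_distrib left_diff_distrib proj_simps)
    obtain R where R: "R \<in> M" "t * R * x \<noteq> 0"
      using corner_nonzero[OF t(1,2,4) x(1-3)] by blast
    have "t * R * x = t * ((a * R * a) * (a * x * a))"
      using x ta by (simp add: mult.assoc) (metis mult.assoc)
    also have "\<dots> = t * ((a * x * a) * (a * R * a))"
      using a(3)[OF R(1) x(1)] by simp
    also have "\<dots> = 0"
      using x(4,5,6) by (metis mult.assoc mult_zero_left)
    finally show False
      using R(2) by simp
  qed
  then show ?thesis
    using scalar_corner_or_subprojection[OF a(1,2)] T by blast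
qed

text \<open>The projection \<open>a\<close> fits under every nonzero projection \<open>g\<close>: a
  nonzero partial isometry from below \<open>a\<close> to below \<open>g\<close> has an initial
  projection that is a scalar multiple of \<open>a\<close>, hence all of \<open>a\<close>. This
  provides \<open>r\<close> below \<open>e\<close> and \<open>w0\<close> for \<open>1 - e\<close>;
  the corner of \<open>r\<close> is again scalar, so \<open>Y\<close> is empty.\<close>

lemma generator_minimal:
  assumes a: "a \<in> M" "proj a" "a \<noteq> 0" "\<And>T. T \<in> M \<Longrightarrow> \<exists>c. a * T * a = cscale c a"
    and e: "e \<in> M" "proj e" "e \<noteq> 0" "e \<noteq> 1"
  shows "\<exists>B\<in>M. star B = B \<and> (\<forall>Q. vna Q \<and> Q \<subseteq> M \<and> e \<in> Q \<and> B \<in> Q \<longrightarrow> Q = M)"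
proof -
  have copy: "\<exists>u\<in>M. star u * u = a \<and> g * u = u" if g: "g \<in> M" "proj g" "g \<noteq> 0" for g
  proof -
    obtain u where u: "u \<in> M" "pisom u" "u \<noteq> 0" "u * a = u" "g * u = u"
      by (rule partial_isometry_between[OF a(1-3) g]) (rule that)
    have au: "a * star u = star u"
      using arg_cong[OF u(4), of star] a(2) by (simp add: proj_def)
    define q where "q = star u * u"
    have q: "proj q" "q \<noteq> 0" "q = a * q * a"
      using u au by (simp_all add: q_def proj_star_self mult.assoc[symmetric]) (simp add: mult.assoc)
    obtain c where "a * q * a = cscale c a"
      using a(4)[of q] u(1) by (auto simp: q_def)
    with q have c: "q = cscale c a"
      by simp
    have "q = a"
    proof -
      have "cscale c q = q * q"
        using q(3) a(2) by (simp add: c proj_simps)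
      also have "\<dots> = q"
        using q(1) by (simp add: proj_simps)
      finally have "cscale (c - 1) q = 0"
        using cscale_add_left[of c q "- 1"] cscale_of_real[of "- 1" q] by simp
      then have "c = 1"
        using cscale_eq_0D[of "c - 1" q] q(2) by simp
      then show ?thesis
        by (simp add: c)
    qed
    with u show ?thesis
      by (auto simp: q_def)
  qed
  obtain u where u: "u \<in> M" "star u * u = a" "e * u = u"
    using copy[OF e(1-3)] by blast
  have f: "1 - e \<in> M" "proj (1 - e)" "1 - e \<noteq> 0"
    using e by (simp_all add: proj_diff)
  obtain u2 where u2: "u2 \<in> M" "star u2 * u2 = a" "(1 - e) * u2 = u2"
    using copy[OF f] by blast
  have "pisom u"
    using u(2) a(2) by (auto intro: pisomI)
  define r where "r = u * star u"
  have r: "r \<in> M" "proj r" "e * r = r"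
    using u \<open>pisom u\<close> by (simp_all add: r_def proj_self_star mult.assoc[symmetric])
  have ua: "u * a = u"
    by (rule mult_star_self[OF u(2) a(2)])
  have au: "a * star u = star u"
    using arg_cong[OF ua, of star] a(2) by (simp add: proj_def)
  have "r \<noteq> 0"
  proof
    assume "r = 0"
    then have "r * u = 0"
      by simp
    then have "u = 0"
      using \<open>pisom u\<close> by (simp add: r_def pisom_def)
    with u(2) a(3) show False
      by simp
  qed
  have rTr: "\<exists>c. r * T * r = cscale c r" if T: "T \<in> M" for T
  proof -
    obtain c where c: "a * (star u * T * u) * a = cscale c a"
      using a(4)[of "star u * T * u"] u T by auto
    have "r * T * r = u * (a * (star u * T * u) * a) * star u"
      using ua au by (simp add: r_def mult.assoc) (simp add: mult.assoc[symmetric])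
    also have "\<dots> = cscale c r"
      unfolding c using ua by (simp add: r_def)
    finally show ?thesis ..
  qed
  have "{r} \<subseteq> copies M r e"
    using r by (simp add: copies_def proj_simps)
  then obtain V l where V: "{r} \<subseteq> V" "V \<subseteq> copies M r e" "pairwise (\<lambda>v w. star v * w = 0) V" "countable V"
    and l: "l \<in> M" "pisom l" "l * r = l" "e * l = l" "\<And>v. v \<in> V \<Longrightarrow> star v * l = 0"
      "\<And>z. (\<And>v. v \<in> V \<Longrightarrow> z * v = 0) \<Longrightarrow> z * l = 0 \<Longrightarrow> z * e = 0"
    by (rule maximal_copies[OF r(1,2) \<open>r \<noteq> 0\<close> e(1,2), where ?V0.0 = "{r}"]) auto
  define w0 where "w0 = u2 * star u"
  have "star w0 * w0 = u * (star u2 * u2) * star u"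
    by (simp add: w0_def mult.assoc)
  then have w0: "w0 \<in> copies M r (1 - e)"
    using u u2 ua by (simp add: copies_def w0_def r_def mult.assoc[symmetric])
  then have "{w0} \<subseteq> copies M r (1 - e)"
    by simp
  then obtain W k where W: "{w0} \<subseteq> W" "W \<subseteq> copies M r (1 - e)" "pairwise (\<lambda>v w. star v * w = 0) W" "countable W"
    and k: "k \<in> M" "pisom k" "k * r = k" "(1 - e) * k = k" "\<And>v. v \<in> W \<Longrightarrow> star v * k = 0"
      "\<And>z. (\<And>v. v \<in> W \<Longrightarrow> z * v = 0) \<Longrightarrow> z * k = 0 \<Longrightarrow> z * (1 - e) = 0"
    by (rule maximal_copies[OF r(1,2) \<open>r \<noteq> 0\<close> f(1,2), where ?V0.0 = "{w0}"]) auto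
  have "r \<in> V" "w0 \<in> W"
    using V(1) W(1) by auto
  obtain B where "B \<in> M" "star B = B" "\<And>Q. vna Q \<Longrightarrow> Q \<subseteq> M \<Longrightarrow> e \<in> Q \<Longrightarrow> B \<in> Q \<Longrightarrow> Q = M"
  proof (rule generating_element[OF e(1,2) r(1,2) \<open>r \<noteq> 0\<close> V(2-4) \<open>r \<in> V\<close> l W(2-4) \<open>w0 \<in> W\<close> k, where Y = "{}"])
    fix Q T
    assume "vna Q" "r \<in> Q" "T \<in> M"
    then show "r * T * r \<in> Q"
      using rTr[of T] vna.cscale[of Q r] by auto
  qed auto
  then show ?thesis
    by blast
qed

section \<open>Infinite factors\<close>

lemma subeqI: "u \<in> M \<Longrightarrow> star u * u = p \<Longrightarrow> q * u = u \<Longrightarrow> subeq M p q"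
  by (auto simp: subeq_def)

text \<open>\<open>star u * u\<close> and \<open>u * star u\<close> are the supports of
  \<open>p * q\<close>; for projections they are \<open>q - q \<and> (1 - p)\<close> and
  \<open>p - p \<and> (1 - q)\<close>.\<close>

lemma left_right_supports:
  assumes p: "p \<in> M" "proj p" and q: "q \<in> M" "proj q"
  obtains u where "u \<in> M" "pisom u" "u * q = u" "p * u = u" "p * q * (star u * u) = p * q" "u * star u * (p * q) = p * q"
    "\<And>z. z * (p * q) = 0 \<Longrightarrow> z * u = 0"
proof -
  obtain u where u: "p * q * (star u * u) = p * q" "u * star u * (p * q) = p * q" "u * star u * u = u"
    "\<And>z. p * q * z = 0 \<Longrightarrow> u * z = 0" "\<And>z. z * (p * q) = 0 \<Longrightarrow> z * u = 0"
    "\<And>N. vna N \<Longrightarrow> p * q \<in> N \<Longrightarrow> u \<in> N"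
    by (rule polar[of "p * q"]) (rule that)
  have "u * (1 - q) = 0" "(1 - p) * u = 0"
    using p q by (intro u(4,5); simp add: right_diff_distrib left_diff_distrib mult.assoc proj_simps)+
  then have "u * q = u" "p * u = u"
    by (simp_all add: right_diff_distrib left_diff_distrib)
  moreover have "u \<in> M"
    by (rule u(6)) (use vna_axioms p q in auto)
  ultimately show thesis
    using that u by (simp add: pisom_def)
qed

text \<open>Kaplansky's formula \<open>g - g \<and> e \<sim> (1 - e) - (1 - e) \<and> (1 - g)\<close> and its mirror image reduce the
  claim to a comparison of \<open>x = g \<and> e\<close> with \<open>y = (1 - e) \<and> (1 - g)\<close>.\<close>

lemma subeq_complement:
  assumes g: "g \<in> M" "proj g" and e: "e \<in> M" "proj e"
  shows "subeq M g (1 - e) \<or> subeq M (1 - g) e"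
proof -
  define f where "f = 1 - e"
  define h where "h = 1 - g"
  have f: "f \<in> M" "proj f" and h: "h \<in> M" "proj h"
    using g e by (simp_all add: f_def h_def proj_diff)
  have ef: "e * f = 0" "f * e = 0" "g * h = 0" "h * g = 0"
    using e g by (simp_all add: f_def h_def right_diff_distrib left_diff_distrib proj_simps)
  \<comment> \<open>In terms of the local \<open>f\<close> and \<open>g\<close>, \<open>x\<close> is
    \<open>g \<and> (1 - f)\<close> and \<open>y\<close> is \<open>f \<and> (1 - g)\<close>.\<close>
  have meet: "\<exists>u x y. u \<in> M \<and> x \<in> M \<and> y \<in> M \<and> pisom u \<and> x = g - star u * u \<and> y = f - u * star u \<and>
      proj x \<and> proj y \<and> f * x = 0 \<and> y * g = 0 \<and> f * u = u \<and> u * g = u \<and> (\<forall>z. z * (f * g) = 0 \<longrightarrow> z * u = 0)"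
    if f: "f \<in> M" "proj f" and g: "g \<in> M" "proj g" for f g
  proof -
    obtain u where u: "u \<in> M" "pisom u" "u * g = u" "f * u = u" "f * g * (star u * u) = f * g"
        "u * star u * (f * g) = f * g" "\<And>z. z * (f * g) = 0 \<Longrightarrow> z * u = 0"
      by (rule left_right_supports[OF f g]) (rule that)
    have us: "g * star u = star u" "star u * f = star u"
      using arg_cong[OF u(3), of star] arg_cong[OF u(4), of star] f g by (simp_all add: proj_def)
    have "proj (g - star u * u)" "proj (f - u * star u)"
      using f g u us by (auto intro!: proj_diff proj_star_self proj_self_star simp: mult.assoc[symmetric])
    moreover have "f * (g - star u * u) = 0"
    proof -
      have "f * (star u * u) = f * g * (star u * u)"
        using us by (simp add: mult.assoc[symmetric]) (simp add: mult.assoc)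
      then show ?thesis
        using u(5) by (simp add: right_diff_distrib)
    qed
    moreover have "(f - u * star u) * g = 0"
    proof -
      have "u * star u * g = u * star u * (f * g)"
        using us by (simp add: mult.assoc) (simp add: mult.assoc[symmetric])
      then show ?thesis
        using u(6) by (simp add: left_diff_distrib)
    qed
    ultimately show ?thesis
      using f g u(1-4,7)
      by (intro exI[of _ u] exI[of _ "g - star u * u"] exI[of _ "f - u * star u"] conjI) simp_all
  qed
  obtain u x y where u: "u \<in> M" "x \<in> M" "y \<in> M" "pisom u" "x = g - star u * u" "y = f - u * star u"
      "proj x" "proj y" "f * x = 0" "y * g = 0" "f * u = u" "u * g = u" "\<And>z. z * (f * g) = 0 \<Longrightarrow> z * u = 0"
    using meet[OF f g] by metis
  \<comment> \<open>The same two meets, obtained from \<open>e * h\<close>. The relations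
    \<open>x \<le> x2\<close> and \<open>y2 \<le> y\<close> derived below link both
    decompositions.\<close>
  obtain u2 y2 x2 where u2: "u2 \<in> M" "y2 \<in> M" "x2 \<in> M" "pisom u2" "y2 = h - star u2 * u2" "x2 = e - u2 * star u2"
      "proj y2" "proj x2" "e * y2 = 0" "x2 * h = 0" "e * u2 = u2" "u2 * h = u2" "\<And>z. z * (e * h) = 0 \<Longrightarrow> z * u2 = 0"
    using meet[OF e h] by metis
  have xf: "x * f = 0"
    using arg_cong[OF u(9), of star] u(7) f(2) by (simp add: proj_def)
  then have xe: "x * e = x"
    by (simp add: f_def right_diff_distrib)
  have "x * h = 0"
    using u(12) by (simp add: u(5) h_def left_diff_distrib right_diff_distrib mult.assoc g(2)[unfolded proj_def])
  then have "x * u2 = 0"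
    using xe by (intro u2(13)) (simp add: mult.assoc[symmetric])
  then have xx2: "x * x2 = x"
    by (simp add: u2(6) right_diff_distrib xe mult.assoc[symmetric])
  have x2x: "x2 * x = x"
    using arg_cong[OF xx2, of star] u(7) u2(8) by (simp add: proj_def)
  have y2e: "y2 * e = 0"
    using arg_cong[OF u2(9), of star] u2(7) e(2) by (simp add: proj_def)
  then have y2f: "y2 * f = y2"
    by (simp add: f_def right_diff_distrib)
  have "y2 * g = 0"
    using u2(12) h(2) by (simp add: u2(5) left_diff_distrib mult.assoc ef) (metis ef(4) mult.assoc mult_zero_right)
  then have "y2 * u = 0"
    using y2f by (intro u(13)) (simp add: mult.assoc[symmetric])
  then have y2y: "y2 * y = y2"
    by (simp add: u(6) right_diff_distrib y2f mult.assoc[symmetric])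
  from comparability[OF u(2,7) u(3,8)] show ?thesis
  proof
    assume "subeq M x y"
    then obtain s where s: "s \<in> M" "star s * s = x" "y * s = s"
      by (auto simp: subeq_def)
    have sy: "star s * y = star s"
      using arg_cong[OF s(3), of star] u(8) by (simp add: proj_def)
    have "y * u = 0"
      using u(4,11) by (simp add: u(6) left_diff_distrib pisom_def)
    then have su: "star s * u = 0"
      by (metis sy mult.assoc mult_zero_right)
    then have us: "star u * s = 0"
      by (rule star_mult_eq_0)
    have "f * y = y"
      using u(11) f(2) by (simp add: u(6) right_diff_distrib proj_simps mult.assoc[symmetric])
    then have fs: "f * s = s"
      by (metis s(3) mult.assoc)
    \<comment> \<open>\<open>g = x + star u * u\<close> and \<open>f = y + u * star u\<close>, so
      \<open>s\<close> on \<open>x\<close> and \<open>u\<close> on the rest add up to a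
      witness.\<close>
    have "subeq M g f"
      by (rule subeqI[of "s + u"])
        (use s u(1,11) su us fs in \<open>simp_all add: distrib_left distrib_right u(5)\<close>)
    then show ?thesis
      by (simp add: f_def)
  next
    assume "subeq M y x"
    then obtain s where s: "s \<in> M" "star s * s = y" "x * s = s"
      by (auto simp: subeq_def)
    define t where "t = s * y2"
    have tt: "star t * t = y2"
    proof -
      have "star t * t = y2 * (star s * s) * y2"
        using u2(7) by (simp add: t_def proj_def mult.assoc)
      then show ?thesis
        using s(2) y2y u2(7) by (simp add: proj_def)
    qed
    have x2t: "x2 * t = t"
      by (metis t_def s(3) x2x mult.assoc)
    have tx2: "star t * x2 = star t"
      using arg_cong[OF x2t, of star] u2(8) by (simp add: proj_def)
    have "x2 * u2 = 0"
      using u2(4,11) by (simp add: u2(6) left_diff_distrib pisom_def)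
    then have tu: "star t * u2 = 0"
      by (metis tx2 mult.assoc mult_zero_right)
    then have ut: "star u2 * t = 0"
      by (rule star_mult_eq_0)
    have "e * x2 = x2"
      using u2(11) e(2) by (simp add: u2(6) right_diff_distrib proj_simps mult.assoc[symmetric])
    then have et: "e * t = t"
      by (metis x2t mult.assoc)
    have "t \<in> M"
      using s u2 by (simp add: t_def)
    have "subeq M h e"
      by (rule subeqI[of "t + u2"])
        (use \<open>t \<in> M\<close> u2(1,11) tu ut et tt in \<open>simp_all add: distrib_left distrib_right u2(5)\<close>)
    then show ?thesis
      by (simp add: h_def)
  qed
qed

lemma transport_copies:
  assumes "subeq M g g'" and C: "C \<subseteq> copies M r g" "pairwise (\<lambda>v w. star v * w = 0) C" "infinite C"
  shows "\<exists>C'. C' \<subseteq> copies M r g' \<and> pairwise (\<lambda>v w. star v * w = 0) C' \<and> infinite C'"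
proof -
  obtain s where s: "s \<in> M" "star s * s = g" "g' * s = s"
    using assms(1) by (auto simp: subeq_def)
  have gc: "g * c = c" "star c * c = r" "c \<in> M" if "c \<in> C" for c
    using C(1) that by (auto simp: copies_def)
  have prod: "star (s * c) * (s * d) = star c * d" if "d \<in> C" for c d
  proof -
    have "star (s * c) * (s * d) = star c * ((star s * s) * d)"
      by (simp add: mult.assoc)
    then show ?thesis
      by (simp add: s(2) gc[OF that])
  qed
  have "inj_on ((*) s) C"
  proof (rule inj_onI)
    fix c d
    assume "c \<in> C" "d \<in> C" "s * c = s * d"
    then have "star s * s * c = star s * s * d"
      by (simp add: mult.assoc)
    then show "c = d"
      by (simp add: s(2) gc \<open>c \<in> C\<close> \<open>d \<in> C\<close>)
  qed
  then have "infinite ((*) s ` C)"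
    using C(3) finite_imageD by blast
  moreover have "(*) s ` C \<subseteq> copies M r g'"
  proof
    fix a
    assume "a \<in> (*) s ` C"
    then obtain c where c: "c \<in> C" "a = s * c"
      by blast
    with prod[OF c(1), of c] gc[OF c(1)] s show "a \<in> copies M r g'"
      by (simp add: copies_def mult.assoc[symmetric])
  qed
  moreover have "pairwise (\<lambda>v w. star v * w = 0) ((*) s ` C)"
    by (rule pairwise_imageI) (use C(2) prod in \<open>auto simp: pairwise_def simp del: star_mult\<close>)
  ultimately show ?thesis
    by blast
qed

text \<open>The isometry \<open>v\<close> shifts its defect \<open>r\<close>, so the
  \<open>v ^ n * r\<close> are infinitely many orthogonal copies. The even ones fill
  \<open>g\<close>, the odd ones lie below \<open>1 - g\<close>, and \<open>subeq_complement\<close>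
  moves one of the halves into \<open>1 - e\<close> or \<open>e\<close>.\<close>

lemma infinitely_many_copies:
  assumes v: "v \<in> M" "star v * v = 1" "v * star v \<noteq> 1" and e: "e \<in> M" "proj e"
  obtains r C where "r \<in> M" "proj r" "r \<noteq> 0" "pairwise (\<lambda>v w. star v * w = 0) C" "infinite C"
    "C \<subseteq> copies M r (1 - e) \<or> C \<subseteq> copies M r e"
proof -
  define r where "r = 1 - v * star v"
  have "pisom v"
    using v(2) by (auto intro: pisomI)
  then have r: "r \<in> M" "proj r" "r \<noteq> 0"
    using v by (simp_all add: r_def proj_diff proj_self_star)
  have rv: "r * v = 0"
    using \<open>pisom v\<close> by (simp add: r_def left_diff_distrib pisom_def)
  have vr: "star v * r = 0"
    using arg_cong[OF rv, of star] r(2) by (simp add: proj_def)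
  define a where "a n = v ^ n * r" for n
  have vn: "star (v ^ n) * v ^ n = 1" for n
  proof (induction n)
    case (Suc n)
    have "star (v ^ Suc n) * v ^ Suc n = star (v ^ n) * (star v * v) * v ^ n"
      by (simp add: mult.assoc)
    then show ?case
      using Suc v(2) by simp
  qed simp
  have aM: "a n \<in> M" for n
    using v r by (simp add: a_def)
  have aa: "star (a n) * a n = r" for n
  proof -
    have "star (a n) * a n = r * (star (v ^ n) * v ^ n) * r"
      using r(2) by (simp add: a_def proj_def mult.assoc)
    then show ?thesis
      using vn r(2) by (simp add: proj_def)
  qed
  have less: "star (a m) * a n = 0" if "m < n" for m n
  proof -
    obtain k where n: "n = m + Suc k"
      using \<open>m < n\<close> less_imp_Suc_add by auto
    have "v ^ n = v ^ m * (v * v ^ k)"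
      unfolding n power_add power_Suc ..
    then have "star (a m) * a n = r * (star (v ^ m) * v ^ m) * (v * v ^ k) * r"
      using r(2) by (simp add: a_def proj_def mult.assoc)
    also have "\<dots> = (r * v) * v ^ k * r"
      using vn by (simp add: mult.assoc)
    finally show ?thesis
      using rv by simp
  qed
  have orth: "star (a m) * a n = 0" if "m \<noteq> n" for m n
  proof (cases "m < n")
    case False
    then show ?thesis
      using arg_cong[OF less[of n m], of star] that by simp
  qed (rule less)
  have inj: "inj a"
  proof (rule injI, rule ccontr)
    fix m n
    assume "a m = a n" "m \<noteq> n"
    then show False
      using orth[of m n] aa[of n] r(3) by simp
  qed
  define E where "E = a ` {n. even n}"
  define O' where "O' = a ` {n. odd n}"
  have pw: "pairwise (\<lambda>v w. star v * w = 0) (a ` X)" for X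
    by (rule pairwise_imageI) (rule orth)
  have inf: "infinite E" "infinite O'"
  proof -
    have "infinite {n :: nat. even n}" "infinite {n :: nat. odd n}"
      unfolding infinite_nat_iff_unbounded by (metis even_Suc lessI less_SucI mem_Collect_eq)+
    then show "infinite E" "infinite O'"
      using inj unfolding E_def O'_def by (meson finite_imageD inj_on_subset subset_UNIV)+
  qed
  have pis: "pisom (a n)" for n
    using aa[of n] r(2) by (auto intro: pisomI)
  obtain g where g: "g \<in> M" "proj g" "\<And>x. x \<in> E \<Longrightarrow> g * x = x"
      "\<And>z. (\<And>x. x \<in> E \<Longrightarrow> z * x = 0) \<Longrightarrow> z * g = 0"
    by (rule final_sum[of E]) (use aM pis pw in \<open>auto simp: E_def\<close>)
  have gO: "(1 - g) * x = x" if x: "x \<in> O'" for x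
  proof -
    have "star x * g = 0"
    proof (rule g(4))
      fix y
      assume "y \<in> E"
      then obtain m n where "y = a m" "even m" "x = a n" "odd n"
        using x by (auto simp: E_def O'_def)
      then show "star x * y = 0"
        using orth[of n m] by auto
    qed
    from arg_cong[OF this, of star] have "g * x = 0"
      using g(2) by (simp add: proj_def)
    then show ?thesis
      by (simp add: left_diff_distrib)
  qed
  have E: "E \<subseteq> copies M r g" "pairwise (\<lambda>v w. star v * w = 0) E"
    using g(3) aM aa pw by (auto simp: E_def copies_def)
  have O': "O' \<subseteq> copies M r (1 - g)" "pairwise (\<lambda>v w. star v * w = 0) O'"
    using gO aM aa pw by (auto simp: O'_def copies_def)
  from subeq_complement[OF g(1,2) e] show thesis
  proof
    assume "subeq M g (1 - e)"
    from transport_copies[OF this E inf(1)] show thesis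
      using that r by metis
  next
    assume "subeq M (1 - g) e"
    from transport_copies[OF this O' inf(2)] show thesis
      using that r by metis
  qed
qed

end

text \<open>Compression by \<open>r\<close> preserves weak approximation, so
  \<open>weakly_closed\<close> settles the unit ball, and scaling does the rest.\<close>

lemma (in separable_vna) countably_generated_corners:
  obtains S :: "nat \<Rightarrow> 'h cop" where "range S \<subseteq> M"
    "\<And>Q r T. vna Q \<Longrightarrow> proj r \<Longrightarrow> (\<And>k. r * S k * r \<in> Q) \<Longrightarrow> T \<in> M \<Longrightarrow> r * T * r \<in> Q"
proof -
  obtain S :: "nat \<Rightarrow> 'h cop" where S: "range S \<subseteq> M"
    "\<And>T F \<eta> e. T \<in> M \<Longrightarrow> norm T \<le> 1 \<Longrightarrow> finite F \<Longrightarrow> e > 0 \<Longrightarrow>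
      \<exists>k. \<bar>\<Sum>x\<in>F. inner (T \<cdot> x - S k \<cdot> x) (\<eta> x)\<bar> < e"
    using weakly_dense_sequence by blast
  show thesis
  proof (rule that[OF S(1)])
    fix Q and r T :: "'h cop"
    assume "vna Q" and r: "proj r" and SQ: "\<And>k. r * S k * r \<in> Q" and T: "T \<in> M"
    interpret Q: vna Q by fact
    have unit_ball: "r * T * r \<in> Q" if T: "T \<in> M" "norm T \<le> 1" for T
    proof (rule Q.weakly_closed)
      fix F :: "'h set" and \<eta> :: "'h \<Rightarrow> 'h" and e :: real
      assume F: "finite F" "e > 0"
      \<comment> \<open>Several vectors of \<open>F\<close> may have the same image under
        \<open>r\<close>, so their test vectors are added up.\<close>
      define \<eta>' where "\<eta>' y = (\<Sum>x\<in>{x \<in> F. r \<cdot> x = y}. r \<cdot> \<eta> x)" for y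
      obtain k where k: "\<bar>\<Sum>y\<in>ap r ` F. inner (T \<cdot> y - S k \<cdot> y) (\<eta>' y)\<bar> < e"
        using S(2)[OF T, of "ap r ` F" e \<eta>'] F by blast
      have "(\<Sum>y\<in>ap r ` F. inner (T \<cdot> y - S k \<cdot> y) (\<eta>' y))
          = (\<Sum>y\<in>ap r ` F. \<Sum>x\<in>{x \<in> F. r \<cdot> x = y}. inner (T \<cdot> (r \<cdot> x) - S k \<cdot> (r \<cdot> x)) (r \<cdot> \<eta> x))"
        unfolding \<eta>'_def inner_sum_right by (intro sum.cong refl) auto
      also have "\<dots> = (\<Sum>x\<in>F. inner (T \<cdot> (r \<cdot> x) - S k \<cdot> (r \<cdot> x)) (r \<cdot> \<eta> x))"
        by (rule sum.image_gen[OF F(1), symmetric])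
      also have "\<dots> = (\<Sum>x\<in>F. inner ((r * T * r) \<cdot> x - (r * S k * r) \<cdot> x) (\<eta> x))"
      proof (intro sum.cong refl)
        fix x
        have "inner (r \<cdot> y) z = inner y (r \<cdot> z)" for y z
          using r by (simp add: inner_star proj_def)
        then show "inner (T \<cdot> (r \<cdot> x) - S k \<cdot> (r \<cdot> x)) (r \<cdot> \<eta> x) = inner ((r * T * r) \<cdot> x - (r * S k * r) \<cdot> x) (\<eta> x)"
          by (metis ap_linear(4) ap_linear_right(2))
      qed
      finally show "\<exists>S\<in>Q. \<bar>\<Sum>x\<in>F. inner ((r * T * r) \<cdot> x - S \<cdot> x) (\<eta> x)\<bar> < e"
        using k SQ by (intro bexI[of _ "r * S k * r"]) simp_all
    qed
    show "r * T * r \<in> Q"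
    proof (cases "T = 0")
      case False
      have "r * ((1 / norm T) *\<^sub>R T) * r \<in> Q"
        by (rule unit_ball) (use False T in simp_all)
      then have "norm T *\<^sub>R (r * ((1 / norm T) *\<^sub>R T) * r) \<in> Q"
        by (rule Q.scaleR)
      then show ?thesis
        using False by simp
    qed simp
  qed
qed

context separable_factor
begin

text \<open>Infinitely many free positions require a second copy in \<open>e\<close> besides the
  distinguished one, so \<open>r0\<close> is cut down: a copy \<open>s0\<close> of a part of it lies
  below \<open>e\<close> and splits as \<open>t + x\<close>, and a part \<open>s\<close> of
  \<open>t\<close> is carried by \<open>c\<close> into \<open>x\<close>. Then \<open>s\<close> and
  \<open>c\<close> are two orthogonal copies of \<open>s\<close> in \<open>e\<close>.\<close>

lemma generator_infinite:
  assumes nonabelian: "\<And>a. a \<in> M \<Longrightarrow> proj a \<Longrightarrow> a \<noteq> 0 \<Longrightarrow> \<exists>T\<in>M. \<forall>c. a * T * a \<noteq> cscale c a"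
    and e: "e \<in> M" "proj e" "e \<noteq> 0" and r0: "r0 \<in> M" "proj r0" "r0 \<noteq> 0"
    and C: "C \<subseteq> copies M r0 (1 - e)" "pairwise (\<lambda>v w. star v * w = 0) C" "infinite C"
  shows "\<exists>B\<in>M. star B = B \<and> (\<forall>Q. vna Q \<and> Q \<subseteq> M \<and> e \<in> Q \<and> B \<in> Q \<longrightarrow> Q = M)"
proof -
  have f: "1 - e \<in> M" "proj (1 - e)"
    using e by (simp_all add: proj_diff)
  obtain b where b: "b \<in> M" "pisom b" "b \<noteq> 0" "b * r0 = b" "e * b = b"
    by (rule partial_isometry_between[OF r0 e]) (rule that)
  define s0 where "s0 = b * star b"
  have s0: "s0 \<in> M" "proj s0" "e * s0 = s0"
    using b by (simp_all add: s0_def proj_self_star mult.assoc[symmetric])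
  have "s0 * b = b"
    using b(2) by (simp add: s0_def pisom_def)
  then have "s0 \<noteq> 0"
    using b(3) by auto
  obtain t where t: "t \<in> M" "proj t" "s0 * t = t" "t \<noteq> 0" "t \<noteq> s0"
    using scalar_corner_or_subprojection[OF s0(1,2)] nonabelian[OF s0(1,2) \<open>s0 \<noteq> 0\<close>] by metis
  define x where "x = s0 - t"
  have x: "x \<in> M" "proj x" "x \<noteq> 0" "t * x = 0" "s0 * x = x"
    using s0 t proj_le_sym[OF s0(2) t(2,3)]
    by (simp_all add: x_def proj_diff right_diff_distrib proj_simps)
  obtain c where c: "c \<in> M" "pisom c" "c \<noteq> 0" "c * t = c" "x * c = c"
    by (rule partial_isometry_between[OF t(1,2,4) x(1-3)]) (rule that)
  define s where "s = star c * c"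
  have s: "s \<in> M" "proj s"
    using c by (simp_all add: s_def proj_star_self)
  have "c * s = c"
    using c(2) by (simp add: s_def pisom_def mult.assoc)
  then have "s \<noteq> 0"
    using c(3) by auto
  have "t * star c = star c"
    using arg_cong[OF c(4), of star] t(2) by (simp add: proj_def)
  then have ts: "t * s = s"
    by (simp add: s_def mult.assoc[symmetric])
  have s0s: "s0 * s = s" "s * s0 = s"
  proof -
    show "s0 * s = s"
      by (metis t(3) ts mult.assoc)
    then show "s * s0 = s"
      by (rule proj_le_sym[OF s0(2) s(2)])
  qed
  have es: "e * s = s"
    by (metis s0(3) s0s(1) mult.assoc)
  have ec: "e * c = c"
    by (metis s0(3) x(5) c(5) mult.assoc)
  have "t * c = 0"
    by (metis x(4) c(5) mult.assoc mult_zero_left)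
  then have sc: "s * c = 0"
    by (metis proj_le_sym[OF t(2) s(2) ts] mult.assoc mult_zero_right)
  then have cs: "star c * s = 0"
    using star_mult_eq_0[of s c] s(2) by (simp add: proj_def)
  have "c \<noteq> s"
    using sc s(2) \<open>s \<noteq> 0\<close> by (auto simp: proj_def)
  have V0: "{s, c} \<subseteq> copies M s e" "pairwise (\<lambda>v w. star v * w = 0) {s, c}"
    using s c(1) es ec sc cs s_def by (auto simp: copies_def pairwise_insert proj_def)
  have C': "star a * a = r0" "(1 - e) * a = a" "a \<in> M" if "a \<in> C" for a
    using C(1) that by (auto simp: copies_def)
  \<comment> \<open>\<open>star b\<close> maps \<open>s \<le> s0\<close> back below
    \<open>r0\<close>, and each \<open>a\<close> in \<open>C\<close> carries it on into
    \<open>1 - e\<close>.\<close>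
  define W0 where "W0 = (\<lambda>a. a * star b * s) ` C"
  have prod: "star (a * star b * s) * (a' * star b * s) = s * b * (star a * a') * star b * s" for a a'
    using s(2) by (simp add: proj_def mult.assoc)
  have self: "star (a * star b * s) * (a * star b * s) = s" if "a \<in> C" for a
  proof -
    have "star (a * star b * s) * (a * star b * s) = s * (b * r0) * star b * s"
      unfolding prod C'(1)[OF that] by (simp add: mult.assoc)
    also have "\<dots> = s * s0 * s"
      by (simp add: b(4) s0_def mult.assoc)
    finally show ?thesis
      using s(2) by (simp add: s0s proj_def)
  qed
  have orth: "star (a * star b * s) * (a' * star b * s) = 0" if "a \<in> C" "a' \<in> C" "a \<noteq> a'" for a a'
    unfolding prod using C(2) that by (simp add: pairwise_def)
  have W0: "W0 \<subseteq> copies M s (1 - e)" "pairwise (\<lambda>v w. star v * w = 0) W0"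
  proof -
    show "W0 \<subseteq> copies M s (1 - e)"
    proof
      fix w
      assume "w \<in> W0"
      then obtain a where a: "a \<in> C" "w = a * star b * s"
        by (auto simp: W0_def)
      show "w \<in> copies M s (1 - e)"
        using C'(2,3)[OF a(1)] self[OF a(1)] b s unfolding a(2) copies_def
        by (simp add: mult.assoc[symmetric])
    qed
    show "pairwise (\<lambda>v w. star v * w = 0) W0"
      unfolding W0_def by (rule pairwise_imageI) (rule orth)
  qed
  have "inj_on (\<lambda>a. a * star b * s) C"
  proof (rule inj_onI, rule ccontr)
    fix a a'
    assume "a \<in> C" "a' \<in> C" "a * star b * s = a' * star b * s" "a \<noteq> a'"
    then show False
      using orth[of a a'] self[of a'] \<open>s \<noteq> 0\<close> by simp
  qed
  then have "infinite W0"
    using C(3) unfolding W0_def by (metis finite_imageD)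
  obtain V l where V: "{s, c} \<subseteq> V" "V \<subseteq> copies M s e" "pairwise (\<lambda>v w. star v * w = 0) V" "countable V"
    and l: "l \<in> M" "pisom l" "l * s = l" "e * l = l" "\<And>v. v \<in> V \<Longrightarrow> star v * l = 0"
      "\<And>z. (\<And>v. v \<in> V \<Longrightarrow> z * v = 0) \<Longrightarrow> z * l = 0 \<Longrightarrow> z * e = 0"
    by (rule maximal_copies[OF s \<open>s \<noteq> 0\<close> e(1,2) V0]) auto
  obtain W k where W: "W0 \<subseteq> W" "W \<subseteq> copies M s (1 - e)" "pairwise (\<lambda>v w. star v * w = 0) W" "countable W"
    and k: "k \<in> M" "pisom k" "k * s = k" "(1 - e) * k = k" "\<And>v. v \<in> W \<Longrightarrow> star v * k = 0"
      "\<And>z. (\<And>v. v \<in> W \<Longrightarrow> z * v = 0) \<Longrightarrow> z * k = 0 \<Longrightarrow> z * (1 - e) = 0"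
    by (rule maximal_copies[OF s \<open>s \<noteq> 0\<close> f W0]) auto
  have "infinite W"
    using \<open>infinite W0\<close> W(1) finite_subset by blast
  then obtain w0 where "w0 \<in> W"
    by fastforce
  have "infinite ((V - {s}) \<times> (W - {w0}))"
  proof -
    have "infinite (W - {w0})"
      using \<open>infinite W\<close> by simp
    moreover have "c \<in> V - {s}"
      using V(1) \<open>c \<noteq> s\<close> by simp
    ultimately show ?thesis
      by (metis empty_iff finite.emptyI finite_cartesian_product_iff)
  qed
  have "s \<in> V"
    using V(1) by simp
  obtain S :: "nat \<Rightarrow> 'h cop" where S: "range S \<subseteq> M"
    "\<And>Q r T. vna Q \<Longrightarrow> proj r \<Longrightarrow> (\<And>k. r * S k * r \<in> Q) \<Longrightarrow> T \<in> M \<Longrightarrow> r * T * r \<in> Q"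
    by (rule countably_generated_corners) auto
  obtain B where "B \<in> M" "star B = B" "\<And>Q. vna Q \<Longrightarrow> Q \<subseteq> M \<Longrightarrow> e \<in> Q \<Longrightarrow> B \<in> Q \<Longrightarrow> Q = M"
  proof (rule generating_element[OF e(1,2) s \<open>s \<noteq> 0\<close> V(2-4) \<open>s \<in> V\<close> l W(2-4) \<open>w0 \<in> W\<close> k S(1)])
    fix Q T
    assume "vna Q" "T \<in> M" "\<And>y. y \<in> range S \<Longrightarrow> s * y * s \<in> Q"
    then show "s * T * s \<in> Q"
      using S(2)[OF _ s(2)] by blast
  qed (use \<open>infinite ((V - {s}) \<times> (W - {w0}))\<close> in auto)
  then show ?thesis
    by blast
qed

section \<open>Finite factors\<close>

text \<open>Hilbert's hotel: the \<open>b n\<close> shift each copy to the next, and together with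
  \<open>1 - Z\<close> they add up to an isometry \<open>U\<close> whose range misses the copy
  \<open>a 0\<close>.\<close>

lemma finite_copies:
  assumes fin: "\<And>v. v \<in> M \<Longrightarrow> star v * v = 1 \<Longrightarrow> v * star v = 1"
    and r: "proj r" "r \<noteq> 0" and C: "C \<subseteq> copies M r g" "pairwise (\<lambda>v w. star v * w = 0) C"
  shows "finite C"
proof (rule ccontr)
  assume "infinite C"
  then obtain a :: "nat \<Rightarrow> 'h cop" where a: "inj a" "range a \<subseteq> C"
    using infinite_countable_subset by blast
  have an: "a n \<in> M" "star (a n) * a n = r" "pisom (a n)" "a n * r = a n" for n
  proof -
    have "a n \<in> copies M r g"
      using a(2) C(1) by blast
    then show 1: "a n \<in> M" "star (a n) * a n = r"
      by (simp_all add: copies_def)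
    show "pisom (a n)" "a n * r = a n"
      using r(1) by (simp_all add: pisomI mult_star_self 1)
  qed
  have orth: "star (a m) * a n = 0" if "m \<noteq> n" for m n
  proof -
    have "a m \<in> C" "a n \<in> C" "a m \<noteq> a n"
      using a that by (auto dest: injD)
    then show ?thesis
      using C(2) by (simp add: pairwise_def)
  qed
  obtain Z where Z: "Z \<in> M" "proj Z" "\<And>x. x \<in> range a \<Longrightarrow> Z * x = x"
      "\<And>z. (\<And>x. x \<in> range a \<Longrightarrow> z * x = 0) \<Longrightarrow> z * Z = 0"
    by (rule final_sum[of "range a"]) (use an in auto, auto intro: pairwise_imageI orth)
  have Za: "Z * a n = a n" "star (a n) * Z = star (a n)" for n
  proof -
    show "Z * a n = a n"
      by (rule Z(3)) simp
    then show "star (a n) * Z = star (a n)"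
      using Z(2) by (metis proj_def star_mult)
  qed
  define b where "b n = a (Suc n) * star (a n)" for n
  define V where "V = insert (1 - Z) (range b)"
  have zz: "proj (1 - Z)"
    using Z(2) by (simp add: proj_diff)
  have bb: "star (b n) * b n = a n * star (a n)" "b n * star (b n) = a (Suc n) * star (a (Suc n))" for n
  proof -
    have "star (b n) * b n = a n * (star (a (Suc n)) * a (Suc n)) * star (a n)"
      by (simp add: b_def mult.assoc)
    then show "star (b n) * b n = a n * star (a n)"
      by (simp add: an)
    have "b n * star (b n) = a (Suc n) * (star (a n) * a n) * star (a (Suc n))"
      by (simp add: b_def mult.assoc)
    then show "b n * star (b n) = a (Suc n) * star (a (Suc n))"
      by (simp add: an)
  qed
  have VM: "V \<subseteq> M"
    using an Z by (auto simp: V_def b_def)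
  have "pisom (b n)" for n
    by (rule pisomI) (simp only: bb proj_self_star[OF an(3)])
  then have Vp: "pisom v" if "v \<in> V" for v
    using that proj_imp_pisom[OF zz] by (auto simp: V_def)
  have bo: "star (b m) * b n = 0" "b m * star (b n) = 0" if "m \<noteq> n" for m n
  proof -
    have "star (b m) * b n = a m * (star (a (Suc m)) * a (Suc n)) * star (a n)"
      by (simp add: b_def mult.assoc)
    then show "star (b m) * b n = 0"
      using orth[of "Suc m" "Suc n"] that by simp
    have "b m * star (b n) = a (Suc m) * (star (a m) * a n) * star (a (Suc n))"
      by (simp add: b_def mult.assoc)
    then show "b m * star (b n) = 0"
      using orth[OF that] by simp
  qed
  have bZ: "Z * b n = b n" "b n * Z = b n" for n
    by (simp add: b_def mult.assoc[symmetric] Za, simp add: b_def mult.assoc Za)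
  have bZ': "star (b n) * Z = star (b n)" "Z * star (b n) = star (b n)" for n
    using bZ[of n] Z(2) by (metis proj_def star_mult)+
  have "pairwise (\<lambda>v w. star v * w = 0 \<and> v * star w = 0) (range b)"
    by (rule pairwise_imageI) (use bo in auto)
  then have V_orth: "pairwise (\<lambda>v w. star v * w = 0 \<and> v * star w = 0) V"
    using zz bZ bZ' Z(2)
    by (auto simp: V_def pairwise_insert proj_def left_diff_distrib right_diff_distrib)
  obtain U where U: "U \<in> M" "pisom U" "\<And>v. v \<in> V \<Longrightarrow> U * (star v * v) = v" "\<And>v. v \<in> V \<Longrightarrow> v * star v * U = v"
    "\<And>z. (\<And>v. v \<in> V \<Longrightarrow> z * v = 0) \<Longrightarrow> z * U = 0" "\<And>z. (\<And>v. v \<in> V \<Longrightarrow> v * z = 0) \<Longrightarrow> U * z = 0"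
    by (rule countable_sum[OF VM Vp V_orth]) auto
  \<comment> \<open>The defect of \<open>U\<close> as an isometry; it annihilates every copy and
    \<open>1 - Z\<close>, hence vanishes.\<close>
  define E where "E = 1 - star U * U"
  have vE: "v * E = 0" if "v \<in> V" for v
  proof -
    have "v * (star U * U) = v * star v * (U * star U * U)"
      by (subst U(4)[OF that, symmetric]) (simp add: mult.assoc)
    also have "\<dots> = v"
      using U(2) U(4)[OF that] by (simp add: pisom_def)
    finally show ?thesis
      by (simp add: E_def right_diff_distrib)
  qed
  have starE: "star E = E"
    by (simp add: E_def)
  have Ev: "E * star v = 0" if "v \<in> V" for v
    using star_mult_eq_0[of E "star v"] star_mult_eq_0[of "star v" E] vE[OF that] starE
    by (metis star_mult star_star star_zero)
  have "E * a n = 0" for n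
  proof -
    have "E * (star (b n) * b n) = 0"
      using Ev[of "b n"] by (simp add: V_def mult.assoc[symmetric])
    then have "E * (a n * star (a n)) * a n = 0"
      by (simp add: bb)
    then show ?thesis
      by (simp add: mult.assoc an)
  qed
  then have "E * Z = 0"
    by (intro Z(4)) auto
  moreover have "E * (1 - Z) = 0"
    using Ev[of "1 - Z"] zz by (simp add: V_def proj_def)
  ultimately have "E = 0"
    by (simp add: right_diff_distrib)
  then have "U * star U = 1"
    by (intro fin U(1)) (simp add: E_def)
  have "star (a 0) * U = 0"
  proof (rule U(5))
    fix v
    assume "v \<in> V"
    then show "star (a 0) * v = 0"
      using orth[of 0] by (auto simp: V_def b_def right_diff_distrib Za mult.assoc[symmetric])
  qed
  then have "star (a 0) * (U * star U) = 0"
    by (simp add: mult.assoc[symmetric])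
  with \<open>U * star U = 1\<close> have "a 0 = 0"
    by simp
  with an(2)[of 0] r(2) show False
    by simp
qed

end

section \<open>Traces and the size of projections\<close>

definition trace_on :: "('h::complex_hilbert) cop set \<Rightarrow> ('h cop \<Rightarrow> real) \<Rightarrow> bool"
  where "trace_on M tr \<longleftrightarrow> (\<forall>S\<in>M. \<forall>T\<in>M. tr (S + T) = tr S + tr T) \<and> (\<forall>T\<in>M. 0 \<le> tr (star T * T)) \<and>
    tr 1 = 1 \<and> (\<forall>S\<in>M. \<forall>T\<in>M. tr (S * T) = tr (T * S))"

context vna
begin

lemma trace_proj_ge_0: "trace_on N tr \<Longrightarrow> p \<in> N \<Longrightarrow> proj p \<Longrightarrow> 0 \<le> tr p"
  unfolding trace_on_def proj_def by metis

lemma trace_proj_diff: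
  assumes "trace_on N tr" "p \<in> N" "q \<in> N"
  shows "tr (p - q) = tr p - tr q"
proof -
  have "tr ((p - q) + q) = tr (p - q) + tr q"
    using assms unfolding trace_on_def by (metis diff)
  then show ?thesis
    by simp
qed

lemma trace_proj_mono:
  assumes "trace_on N tr" "p \<in> N" "proj p" "q \<in> N" "proj q" "p * q = q"
  shows "tr q \<le> tr p"
  using trace_proj_ge_0[of tr "p - q"] trace_proj_diff[of tr p q] proj_diff[of p q] assms by simp

lemma trace_sum:
  assumes "trace_on N tr" "\<And>i. i \<in> I \<Longrightarrow> X i \<in> N"
  shows "tr (\<Sum>i\<in>I. X i) = (\<Sum>i\<in>I. tr (X i))"
proof -
  have "tr 0 = 0"
    using trace_proj_diff[OF assms(1) one one] by simp
  then show ?thesis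
    using assms(2)
  proof (induction I rule: infinite_finite_induct)
    case (insert i I)
    have "(\<Sum>i\<in>I. X i) \<in> N"
      using insert by (intro sum) auto
    then have "tr (X i + (\<Sum>i\<in>I. X i)) = tr (X i) + tr (\<Sum>i\<in>I. X i)"
      using assms(1) insert unfolding trace_on_def by auto
    then show ?case
      using insert by simp
  qed auto
qed

text \<open>\<open>e\<close> is the orthogonal sum of the ranges of \<open>V\<close>, each of trace
  \<open>tr r\<close>, and of the range of \<open>l\<close>, which is equivalent to a part of
  \<open>r\<close>.\<close>

lemma trace_le_copies:
  assumes tr: "trace_on N tr" and r: "r \<in> N" "proj r" and e: "e \<in> N" "proj e"
    and V: "V \<subseteq> copies N r e" "pairwise (\<lambda>v w. star v * w = 0) V" "finite V"
    and l: "l \<in> N" "pisom l" "l * r = l" "e * l = l" "\<And>v. v \<in> V \<Longrightarrow> star v * l = 0"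
      "\<And>z. (\<And>v. v \<in> V \<Longrightarrow> z * v = 0) \<Longrightarrow> z * l = 0 \<Longrightarrow> z * e = 0"
  shows "tr e \<le> (real (card V) + 1) * tr r"
proof -
  have v: "v \<in> N" "star v * v = r" "e * v = v" "pisom v" "v * star v * v = v" if "v \<in> V" for v
    using V(1) that r pisomI[of v] by (auto simp: copies_def pisom_def)
  have lv: "star l * v = 0" if "v \<in> V" for v
    using l(5)[OF that] by (rule star_mult_eq_0)
  define S where "S = (\<Sum>v\<in>V. v * star v)"
  define z where "z = e - S - l * star l"
  have "z * v = 0" if "v \<in> V" for v
  proof -
    have "S * v = (\<Sum>w\<in>V. if w = v then v else 0)"
      unfolding S_def sum_distrib_right
    proof (intro sum.cong refl)
      fix w
      assume "w \<in> V"
      then show "w * star w * v = (if w = v then v else 0)"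
        using V(2) v(5) that by (auto simp: pairwise_def mult.assoc)
    qed
    then have "S * v = v"
      using V(3) that by simp
    then show ?thesis
      using lv[OF that] v(3)[OF that] by (simp add: z_def left_diff_distrib mult.assoc)
  qed
  moreover have "z * l = 0"
  proof -
    have "S * l = 0"
      unfolding S_def sum_distrib_right by (rule sum.neutral) (simp add: mult.assoc l(5))
    then show ?thesis
      using l(2,4) by (simp add: z_def left_diff_distrib pisom_def)
  qed
  ultimately have "z * e = 0"
    by (rule l(6))
  moreover have "z * e = z"
  proof -
    have "star v * e = star v" if "v \<in> V" for v
      using arg_cong[OF v(3)[OF that], of star] e(2) by (simp add: proj_def)
    then have "S * e = S"
      unfolding S_def sum_distrib_right by (intro sum.cong refl) (simp add: mult.assoc)
    moreover have "star l * e = star l"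
      using arg_cong[OF l(4), of star] e(2) by (simp add: proj_def)
    ultimately show ?thesis
      using e(2) by (simp add: z_def left_diff_distrib proj_def mult.assoc)
  qed
  ultimately have "e = S + l * star l"
    by (simp add: z_def diff_diff_eq)
  moreover have "S \<in> N"
    unfolding S_def using v by (intro sum) auto
  ultimately have "tr e = tr S + tr (l * star l)"
    using tr l(1) unfolding trace_on_def by auto
  also have "tr S = (\<Sum>v\<in>V. tr r)"
  proof -
    have "tr S = (\<Sum>v\<in>V. tr (v * star v))"
      unfolding S_def using v by (intro trace_sum[OF tr]) auto
    also have "\<dots> = (\<Sum>v\<in>V. tr r)"
    proof (intro sum.cong refl)
      fix v'
      assume "v' \<in> V"
      then show "tr (v' * star v') = tr r"
        using v[of v'] tr unfolding trace_on_def by (metis star)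
    qed
    finally show ?thesis .
  qed
  also have "tr (l * star l) = tr (star l * l)"
    using tr l(1) unfolding trace_on_def by auto
  also have "tr (star l * l) \<le> tr r"
  proof (rule trace_proj_mono[OF tr r])
    have "r * star l = star l"
      using arg_cong[OF l(3), of star] r(2) by (simp add: proj_def)
    then show "r * (star l * l) = star l * l"
      by (simp add: mult.assoc[symmetric])
  qed (use l in \<open>auto intro: proj_star_self\<close>)
  finally show ?thesis
    by (simp add: algebra_simps)
qed

end

text \<open>Covering \<open>1\<close> by finitely many copies of \<open>s\<close> and a smaller rest
  bounds \<open>tr s\<close>. The bound is common to all traces, so it can be fixed before a trace
  and a partition are chosen.\<close>

lemma (in separable_factor) trace_lower_bound:
  assumes fin: "\<And>v. v \<in> M \<Longrightarrow> star v * v = 1 \<Longrightarrow> v * star v = 1"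
    and s: "s \<in> M" "proj s" "s \<noteq> 0"
  shows "\<exists>c>0. \<forall>tr. trace_on M tr \<longrightarrow> c \<le> tr s"
proof -
  obtain V l where V: "{} \<subseteq> V" "V \<subseteq> copies M s 1" "pairwise (\<lambda>v w. star v * w = 0) V" "countable V"
    and l: "l \<in> M" "pisom l" "l * s = l" "1 * l = l" "\<And>v. v \<in> V \<Longrightarrow> star v * l = 0"
      "\<And>z. (\<And>v. v \<in> V \<Longrightarrow> z * v = 0) \<Longrightarrow> z * l = 0 \<Longrightarrow> z * 1 = 0"
    by (rule maximal_copies[OF s one proj_one, where ?V0.0 = "{}"]) (simp, simp, blast)
  have "finite V"
    by (rule finite_copies[OF fin s(2,3) V(2,3)])
  show ?thesis
  proof (intro exI[of _ "1 / (real (card V) + 1)"] conjI allI impI)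
    fix tr
    assume tr: "trace_on M tr"
    have "tr 1 \<le> (real (card V) + 1) * tr s"
      by (rule trace_le_copies[OF tr s(1,2) one proj_one V(2,3) \<open>finite V\<close> l])
    moreover have "tr 1 = 1"
      using tr by (simp add: trace_on_def)
    ultimately show "1 / (real (card V) + 1) \<le> tr s"
      by (simp add: divide_le_eq mult.commute add_pos_nonneg)
  qed (simp add: add_pos_nonneg)
qed

lemma norm_pisom: "pisom u \<Longrightarrow> norm (u \<cdot> x) \<le> norm x"
proof (rule power2_le_imp_le)
  assume u: "pisom u"
  have "(norm (u \<cdot> x))\<^sup>2 \<le> norm ((star u * u) \<cdot> x) * norm x"
    unfolding norm_ap_eq by (rule norm_cauchy_schwarz)
  also have "\<dots> \<le> norm x * norm x"
    by (intro mult_right_mono norm_proj_ap proj_star_self u) auto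
  finally show "(norm (u \<cdot> x))\<^sup>2 \<le> (norm x)\<^sup>2"
    by (simp add: power2_eq_square)
qed simp

text \<open>The \<open>T\<close> whose matrix entries \<open>u\<^sub>i\<^sup>* T u\<^sub>j\<close> all lie in \<open>Q\<close> form a von Neumann algebra.\<close>

lemma (in vna) corner_generated_by_entries:
  fixes u :: "nat \<Rightarrow> 'h cop"
  assumes k: "k > 0" and u: "\<And>i. i < k \<Longrightarrow> u i \<in> N" "\<And>i. i < k \<Longrightarrow> star (u i) * u i = r"
    and r: "proj r"
    and orth: "\<And>i j. i < k \<Longrightarrow> j < k \<Longrightarrow> i \<noteq> j \<Longrightarrow> star (u i) * u j = 0"
    and sum1: "(\<Sum>i<k. u i * star (u i)) = 1"
    and gen: "\<And>Q. vna Q \<Longrightarrow> Q \<subseteq> N \<Longrightarrow> X \<subseteq> Q \<Longrightarrow> Q = N"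
    and Q: "vna Q" "r \<in> Q" and X: "X \<subseteq> N" "\<And>x i j. x \<in> X \<Longrightarrow> i < k \<Longrightarrow> j < k \<Longrightarrow> star (u i) * x * u j \<in> Q"
    and T: "T \<in> N"
  shows "r * T * r \<in> Q"
proof -
  interpret Q: vna Q by fact
  define N' where "N' = {T \<in> N. \<forall>i<k. \<forall>j<k. star (u i) * T * u j \<in> Q}"
  have pis: "pisom (u i)" if "i < k" for i
    using u(2)[OF that] r by (auto intro: pisomI)
  have "vna N'"
  proof
    show "1 \<in> N'"
      unfolding N'_def
    proof (intro CollectI conjI allI impI)
      fix i j
      assume "i < k" "j < k"
      then show "star (u i) * 1 * u j \<in> Q"
        using u(2) orth Q(2) by (cases "i = j") auto
    qed simp
    show "S + T \<in> N'" if "S \<in> N'" "T \<in> N'" for S T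
      using that by (auto simp: N'_def distrib_left distrib_right)
    show "cscale c T \<in> N'" if "T \<in> N'" for c T
      using that by (auto simp: N'_def)
    show "star T \<in> N'" if T: "T \<in> N'" for T
    proof -
      have "star (u i) * star T * u j \<in> Q" if "i < k" "j < k" for i j
      proof -
        have "star (star (u j) * T * u i) \<in> Q"
          using T that by (intro Q.star) (auto simp: N'_def)
        then show ?thesis
          by (simp add: mult.assoc)
      qed
      with T show ?thesis
        by (auto simp: N'_def)
    qed
    show "S * T \<in> N'" if S: "S \<in> N'" and T: "T \<in> N'" for S T
    proof -
      have "star (u i) * (S * T) * u j \<in> Q" if "i < k" "j < k" for i j
      proof -
        have "star (u i) * (S * T) * u j = star (u i) * S * (\<Sum>m<k. u m * star (u m)) * (T * u j)"
          by (simp add: sum1 mult.assoc)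
        also have "\<dots> = (\<Sum>m<k. (star (u i) * S * u m) * (star (u m) * T * u j))"
          unfolding sum_distrib_left sum_distrib_right by (intro sum.cong refl) (simp add: mult.assoc)
        also have "\<dots> \<in> Q"
          by (rule Q.sum, rule Q.mult) (use S T that in \<open>auto simp: N'_def\<close>)
        finally show ?thesis .
      qed
      with S T show ?thesis
        by (auto simp: N'_def)
    qed
    show "T \<in> N'"
      if approx: "\<And>F e. finite F \<Longrightarrow> e > 0 \<Longrightarrow> \<exists>S\<in>N'. \<forall>x\<in>F. norm (T \<cdot> x - S \<cdot> x) < e" for T
    proof -
      have "T \<in> N"
      proof (rule strongly_closed)
        show "\<exists>S\<in>N. \<forall>x\<in>F. norm (T \<cdot> x - S \<cdot> x) < e" if "finite F" "e > 0" for F e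
          using approx[OF that] unfolding N'_def by fast
      qed
      moreover have "star (u i) * T * u j \<in> Q" if ij: "i < k" "j < k" for i j
      proof (rule Q.strongly_closed)
        fix F :: "'h set" and e :: real
        assume "finite F" "e > 0"
        then obtain S where S: "S \<in> N'" "\<forall>x\<in>ap (u j) ` F. norm (T \<cdot> x - S \<cdot> x) < e"
          using approx[of "ap (u j) ` F" e] by auto
        have "norm ((star (u i) * T * u j) \<cdot> x - (star (u i) * S * u j) \<cdot> x) < e" if "x \<in> F" for x
        proof -
          have "norm ((star (u i) * T * u j) \<cdot> x - (star (u i) * S * u j) \<cdot> x)
              = norm (star (u i) \<cdot> (T \<cdot> (u j \<cdot> x) - S \<cdot> (u j \<cdot> x)))"
            by simp
          also have "\<dots> \<le> norm (T \<cdot> (u j \<cdot> x) - S \<cdot> (u j \<cdot> x))"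
            by (rule norm_pisom[OF pisom_star[OF pis[OF ij(1)]]])
          finally show ?thesis
            using S(2) that by fastforce
        qed
        moreover have "star (u i) * S * u j \<in> Q"
          using S(1) ij by (auto simp: N'_def)
        ultimately show "\<exists>S\<in>Q. \<forall>x\<in>F. norm ((star (u i) * T * u j) \<cdot> x - S \<cdot> x) < e"
          by blast
      qed
      ultimately show ?thesis
        by (auto simp: N'_def)
    qed
  qed
  moreover have "N' \<subseteq> N" "X \<subseteq> N'"
    using X by (auto simp: N'_def)
  ultimately have "N' = N"
    by (rule gen)
  have "r \<in> N"
    using u[OF k] by (metis mult star)
  then have "u 0 * (r * T * r) * star (u 0) \<in> N'"
    using T u[OF k] \<open>N' = N\<close> by simp
  then have "star (u 0) * (u 0 * (r * T * r) * star (u 0)) * u 0 \<in> Q"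
    using k by (auto simp: N'_def)
  moreover have "star (u 0) * (u 0 * (r * T * r) * star (u 0)) * u 0
      = (star (u 0) * u 0) * (r * T * r) * (star (u 0) * u 0)"
    by (simp add: mult.assoc)
  ultimately show ?thesis
    using r by (simp add: u(2)[OF k] proj_simps mult.assoc)
qed

section \<open>Counting the nonzero entries of generators\<close>

lemma card_entries:
  fixes g :: "'a \<Rightarrow> nat \<Rightarrow> nat \<Rightarrow> 'b" and R :: "'a \<Rightarrow> nat \<Rightarrow> nat \<Rightarrow> bool" and k :: nat
  assumes "finite X"
  defines "Y \<equiv> {g x i j | x i j. x \<in> X \<and> i < k \<and> j < k \<and> R x i j}"
  shows "finite Y" "card Y \<le> (\<Sum>x\<in>X. card {(i, j). i < k \<and> j < k \<and> R x i j})"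
proof -
  define Z where "Z = Sigma X (\<lambda>x. {(i, j). i < k \<and> j < k \<and> R x i j})"
  have fin: "finite {(i, j). i < k \<and> j < k \<and> R x i j}" for x
    by (rule finite_subset[of _ "{..<k} \<times> {..<k}"]) auto
  have Y: "Y = (\<lambda>(x, i, j). g x i j) ` Z"
    unfolding Y_def Z_def by (auto simp: image_iff) blast+
  have "finite Z"
    unfolding Z_def using assms(1) fin by (intro finite_SigmaI)
  then show "finite Y"
    by (simp add: Y)
  have "card Y \<le> card Z"
    unfolding Y by (rule card_image_le) fact
  also have "\<dots> = (\<Sum>x\<in>X. card {(i, j). i < k \<and> j < k \<and> R x i j})"
    unfolding Z_def by (rule card_SigmaI) (use assms(1) fin in auto)
  finally show "card Y \<le> (\<Sum>x\<in>X. card {(i, j). i < k \<and> j < k \<and> R x i j})" .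
qed

text \<open>Witnesses for \<open>shen_G M < \<epsilon>\<close>: here \<open>tr\<close> is the real part of the trace, and the inequality between the
  number of nonzero entries and \<open>\<epsilon>\<close> is multiplied by \<open>k\<^sup>2\<close>.\<close>

definition sparse_generators :: "('h::complex_hilbert) cop set \<Rightarrow> real \<Rightarrow> ('h cop \<Rightarrow> real) \<Rightarrow> nat \<Rightarrow>
    (nat \<Rightarrow> 'h cop) \<Rightarrow> 'h cop set \<Rightarrow> bool"
  where "sparse_generators M \<epsilon> tr k P X \<longleftrightarrow> trace_on M tr \<and> k > 0 \<and> (\<forall>i<k. P i \<in> M \<and> proj (P i)) \<and>
    (\<forall>i<k. \<forall>j<k. i \<noteq> j \<longrightarrow> P i * P j = 0) \<and> (\<Sum>i<k. P i) = 1 \<and> (\<forall>i<k. tr (P i) = 1 / real k) \<and>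
    finite X \<and> X \<subseteq> M \<and> (\<forall>Q. vna Q \<and> Q \<subseteq> M \<and> X \<subseteq> Q \<longrightarrow> Q = M) \<and>
    real (\<Sum>x\<in>X. card {(i, j). i < k \<and> j < k \<and> P i * x * P j \<noteq> 0}) < \<epsilon> * (real k)\<^sup>2"

text \<open>Generators of a noncommutative algebra cannot all be \<open>0\<close>, since
  \<open>0\<close> lies in the center; so some entry is nonzero. For small \<open>\<epsilon>\<close>
  this makes \<open>k\<close> large.\<close>

lemma (in vna) sparse_generators_large:
  assumes sg: "sparse_generators N \<epsilon> tr k P X" and noncomm: "S \<in> N" "T \<in> N" "S * T \<noteq> T * S"
  shows "1 < \<epsilon> * (real k)\<^sup>2"
proof -
  have P: "(\<Sum>i<k. P i) = 1" and X: "finite X" "X \<subseteq> N" "\<And>Q. vna Q \<Longrightarrow> Q \<subseteq> N \<Longrightarrow> X \<subseteq> Q \<Longrightarrow> Q = N"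
    and count: "real (\<Sum>x\<in>X. card {(i, j). i < k \<and> j < k \<and> P i * x * P j \<noteq> 0}) < \<epsilon> * (real k)\<^sup>2"
    using sg by (simp_all add: sparse_generators_def)
  have "\<exists>x\<in>X. x \<noteq> 0"
  proof (rule ccontr)
    assume "\<not> ?thesis"
    then have X0: "X \<subseteq> {0}"
      by blast
    define Q where "Q = N \<inter> {T. \<forall>S\<in>N. T * S = S * T}"
    have "vna Q"
      unfolding Q_def by (intro vna_inter vna_axioms vna_commutant) auto
    moreover have "Q \<subseteq> N" "X \<subseteq> Q"
      using X0 by (auto simp: Q_def)
    ultimately have "Q = N"
      by (rule X(3))
    then have "S \<in> Q"
      using noncomm(1) by simp
    then show False
      using noncomm(2,3) by (auto simp: Q_def)
  qed
  then obtain x where x: "x \<in> X" "x \<noteq> 0"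
    by blast
  have "\<exists>i<k. \<exists>j<k. P i * x * P j \<noteq> 0"
  proof (rule ccontr)
    assume "\<not> ?thesis"
    then have "(\<Sum>i<k. P i * x * (\<Sum>j<k. P j)) = 0"
      by (simp add: sum_distrib_left)
    moreover have "(\<Sum>i<k. P i * x * (\<Sum>j<k. P j)) = (\<Sum>i<k. P i) * x * (\<Sum>j<k. P j)"
      by (simp only: sum_distrib_right)
    ultimately show False
      using x(2) P by simp
  qed
  then have "{(i, j). i < k \<and> j < k \<and> P i * x * P j \<noteq> 0} \<noteq> {}"
    by auto
  moreover have "finite {(i, j). i < k \<and> j < k \<and> P i * x * P j \<noteq> 0}"
    by (rule finite_subset[of _ "{..<k} \<times> {..<k}"]) auto
  ultimately have "1 \<le> card {(i, j). i < k \<and> j < k \<and> P i * x * P j \<noteq> 0}"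
    by (simp add: Suc_le_eq card_gt_0_iff)
  also have "\<dots> \<le> (\<Sum>x\<in>X. card {(i, j). i < k \<and> j < k \<and> P i * x * P j \<noteq> 0})"
    by (rule member_le_sum[OF x(1), of "\<lambda>x. card {(i, j). i < k \<and> j < k \<and> P i * x * P j \<noteq> 0}"])
      (use X(1) in auto)
  finally have "1 \<le> real (\<Sum>x\<in>X. card {(i, j). i < k \<and> j < k \<and> P i * x * P j \<noteq> 0})"
    by (simp only: real_of_nat_ge_one_iff)
  with count show ?thesis
    by linarith
qed

context separable_factor
begin

text \<open>Comparability makes one projection equivalent to a part of the other; what is left over
  has trace 0 and vanishes by \<open>trace_lower_bound\<close>.\<close>

lemma equivalent_if_trace_eq:
  assumes fin: "\<And>v. v \<in> M \<Longrightarrow> star v * v = 1 \<Longrightarrow> v * star v = 1"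
    and tr: "trace_on M tr" and p: "p \<in> M" "proj p" and q: "q \<in> M" "proj q" and eq: "tr p = tr q"
  shows "\<exists>u\<in>M. star u * u = p \<and> u * star u = q"
proof -
  have zero: "a = 0" if "a \<in> M" "proj a" "tr a = 0" for a
    using trace_lower_bound[OF fin, of a] that tr by force
  have full: "t * star t = b" if t: "t \<in> M" "star t * t = a" "b * t = t" and a: "proj a" "tr a = tr b"
    and b: "b \<in> M" "proj b" for a b t
  proof -
    have "pisom t"
      using t(2) a(1) by (auto intro: pisomI)
    have "proj (b - t * star t)"
      using t(3) b \<open>pisom t\<close> by (intro proj_diff proj_self_star) (simp_all add: mult.assoc[symmetric])
    moreover have "tr (t * star t) = tr a"
      using tr t(1,2) unfolding trace_on_def by (metis star)
    then have "tr (b - t * star t) = 0"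
      using trace_proj_diff[OF tr b(1), of "t * star t"] t(1) a(2) by simp
    ultimately have "b - t * star t = 0"
      using b(1) t(1) by (intro zero) auto
    then show ?thesis
      by simp
  qed
  from comparability[OF p q] show ?thesis
  proof
    assume "subeq M p q"
    then obtain t where t: "t \<in> M" "star t * t = p" "q * t = t"
      by (auto simp: subeq_def)
    with full[OF t p(2) eq q] show ?thesis
      by blast
  next
    assume "subeq M q p"
    then obtain t where t: "t \<in> M" "star t * t = q" "p * t = t"
      by (auto simp: subeq_def)
    from full[OF t q(2) eq[symmetric] p] t show ?thesis
      by (intro bexI[of _ "star t"]) auto
  qed
qed

text \<open>The number of copies of \<open>r\<close>, a projection of trace \<open>1/k\<close>, in \<open>e\<close> and in \<open>1 - e\<close> grows linearly with
  \<open>k\<close>, so the number of free positions grows quadratically and exceeds the number of nonzero entries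
  of the generators if these are sparse enough.\<close>

lemma generator_II1:
  assumes fin: "\<And>v. v \<in> M \<Longrightarrow> star v * v = 1 \<Longrightarrow> v * star v = 1"
    and noncomm: "S \<in> M" "T \<in> M" "S * T \<noteq> T * S"
    and sparse: "\<And>\<epsilon>. \<epsilon> > 0 \<Longrightarrow> \<exists>tr k P X. sparse_generators M \<epsilon> tr k P X"
    and e: "e \<in> M" "proj e" "e \<noteq> 0" "e \<noteq> 1"
  shows "\<exists>B\<in>M. star B = B \<and> (\<forall>Q. vna Q \<and> Q \<subseteq> M \<and> e \<in> Q \<and> B \<in> Q \<longrightarrow> Q = M)"
proof -
  have f: "1 - e \<in> M" "proj (1 - e)" "1 - e \<noteq> 0"
    using e by (simp_all add: proj_diff)
  obtain c1 c2 where c12: "c1 > 0" "c2 > 0" "\<And>tr. trace_on M tr \<Longrightarrow> c1 \<le> tr e" "\<And>tr. trace_on M tr \<Longrightarrow> c2 \<le> tr (1 - e)"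
    using trace_lower_bound[OF fin e(1-3)] trace_lower_bound[OF fin f] by metis
  define c where "c = min c1 c2"
  have c: "c > 0" "\<And>tr. trace_on M tr \<Longrightarrow> c \<le> tr e" "\<And>tr. trace_on M tr \<Longrightarrow> c \<le> tr (1 - e)"
    using c12 by (force simp: c_def)+
  \<comment> \<open>Then \<open>\<epsilon> * (real k)\<^sup>2\<close> is the square of
    \<open>c * k / 4\<close>, while each side offers at least \<open>c * k - 2\<close> copies
    besides the distinguished one, which exceeds \<open>c * k / 4\<close> because
    \<open>c * k > 4\<close>.\<close>
  define \<epsilon> where "\<epsilon> = c\<^sup>2 / 16"
  have "\<epsilon> > 0"
    using c(1) by (simp add: \<epsilon>_def)
  then obtain tr k P X where sg: "sparse_generators M \<epsilon> tr k P X"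
    using sparse by blast
  then have tr: "trace_on M tr" and "k > 0" and P: "\<And>i. i < k \<Longrightarrow> P i \<in> M" "\<And>i. i < k \<Longrightarrow> proj (P i)"
      "\<And>i j. i < k \<Longrightarrow> j < k \<Longrightarrow> i \<noteq> j \<Longrightarrow> P i * P j = 0" "(\<Sum>i<k. P i) = 1" "\<And>i. i < k \<Longrightarrow> tr (P i) = 1 / real k"
    and X: "finite X" "X \<subseteq> M" "\<And>Q. vna Q \<Longrightarrow> Q \<subseteq> M \<Longrightarrow> X \<subseteq> Q \<Longrightarrow> Q = M"
    and count: "real (\<Sum>x\<in>X. card {(i, j). i < k \<and> j < k \<and> P i * x * P j \<noteq> 0}) < \<epsilon> * (real k)\<^sup>2"
    by (simp_all add: sparse_generators_def)
  have ck: "c * real k > 4"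
  proof -
    have "1 < \<epsilon> * (real k)\<^sup>2"
      by (rule sparse_generators_large[OF sg noncomm])
    then have "4\<^sup>2 < (c * real k)\<^sup>2"
      by (simp add: \<epsilon>_def power_mult_distrib)
    then show ?thesis
      using c(1) by (intro power_less_imp_less_base[of 4 2]) auto
  qed
  \<comment> \<open>\<open>P 0\<close> has trace \<open>1 / k\<close>, less than that of
    \<open>e\<close>, so comparability places a copy \<open>r\<close> of it below
    \<open>e\<close>.\<close>
  have "\<not> subeq M e (P 0)"
  proof
    assume "subeq M e (P 0)"
    then obtain t where t: "t \<in> M" "star t * t = e" "P 0 * t = t"
      by (auto simp: subeq_def)
    have "tr (t * star t) \<le> tr (P 0)"
      using t P(1,2)[OF \<open>k > 0\<close>] e(2)
      by (intro trace_proj_mono[OF tr]) (auto simp: mult.assoc[symmetric] intro!: proj_self_star pisomI)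
    moreover have "tr (t * star t) = tr e"
      using tr t(1,2) unfolding trace_on_def by (metis star)
    ultimately have "c \<le> 1 / real k"
      using c(2)[OF tr] P(5)[OF \<open>k > 0\<close>] by simp
    then have "c * real k \<le> 1"
      using \<open>k > 0\<close> by (simp add: field_simps)
    with ck show False
      by simp
  qed
  then obtain w where w: "w \<in> M" "star w * w = P 0" "e * w = w"
    using comparability[OF P(1,2)[OF \<open>k > 0\<close>] e(1,2)] \<open>k > 0\<close> by (auto simp: subeq_def)
  define r where "r = w * star w"
  have "pisom w"
    using w(2) P(2)[OF \<open>k > 0\<close>] by (auto intro: pisomI)
  then have r: "r \<in> M" "proj r" and er: "e * r = r"
    using w by (simp_all add: r_def proj_self_star mult.assoc[symmetric])
  have tr_r: "tr r = 1 / real k"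
    using tr w(1,2) P(5)[OF \<open>k > 0\<close>] unfolding r_def trace_on_def by (metis star)
  have "r \<noteq> 0"
  proof
    assume "r = 0"
    have "tr 0 = 0"
      using trace_proj_diff[OF tr one one] by simp
    with tr_r \<open>r = 0\<close> \<open>k > 0\<close> show False
      by simp
  qed
  have "\<exists>u\<in>M. star u * u = r \<and> u * star u = P i" if "i < k" for i
    by (rule equivalent_if_trace_eq[OF fin tr r P(1,2)[OF that]]) (simp_all add: tr_r P(5)[OF that])
  then obtain u where u: "\<And>i. i < k \<Longrightarrow> u i \<in> M" "\<And>i. i < k \<Longrightarrow> star (u i) * u i = r"
      "\<And>i. i < k \<Longrightarrow> u i * star (u i) = P i"
    by metis
  have "{r} \<subseteq> copies M r e"
    using r er by (simp add: copies_def proj_simps)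
  then obtain V l where V: "{r} \<subseteq> V" "V \<subseteq> copies M r e" "pairwise (\<lambda>v w. star v * w = 0) V" "countable V"
    and l: "l \<in> M" "pisom l" "l * r = l" "e * l = l" "\<And>v. v \<in> V \<Longrightarrow> star v * l = 0"
      "\<And>z. (\<And>v. v \<in> V \<Longrightarrow> z * v = 0) \<Longrightarrow> z * l = 0 \<Longrightarrow> z * e = 0"
    by (rule maximal_copies[OF r \<open>r \<noteq> 0\<close> e(1,2), where ?V0.0 = "{r}"]) auto
  obtain W m where W: "{} \<subseteq> W" "W \<subseteq> copies M r (1 - e)" "pairwise (\<lambda>v w. star v * w = 0) W" "countable W"
    and m: "m \<in> M" "pisom m" "m * r = m" "(1 - e) * m = m" "\<And>v. v \<in> W \<Longrightarrow> star v * m = 0"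
      "\<And>z. (\<And>v. v \<in> W \<Longrightarrow> z * v = 0) \<Longrightarrow> z * m = 0 \<Longrightarrow> z * (1 - e) = 0"
    by (rule maximal_copies[OF r \<open>r \<noteq> 0\<close> f(1,2), where ?V0.0 = "{}"]) (simp, simp, blast)
  have "finite V" "finite W"
    using finite_copies[OF fin r(2) \<open>r \<noteq> 0\<close>] V(2,3) W(2,3) by blast+
  have large: "c * real k \<le> real n + 1" if "c \<le> (real n + 1) * tr r" for n
    using that \<open>k > 0\<close> by (simp add: tr_r field_simps)
  have cardV: "c * real k \<le> real (card V) + 1"
  proof (rule large)
    have "tr e \<le> (real (card V) + 1) * tr r"
      by (rule trace_le_copies[OF tr r e(1,2) V(2,3) \<open>finite V\<close> l])
    with c(2)[OF tr] show "c \<le> (real (card V) + 1) * tr r"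
      by linarith
  qed
  have cardW: "c * real k \<le> real (card W) + 1"
  proof (rule large)
    have "tr (1 - e) \<le> (real (card W) + 1) * tr r"
      by (rule trace_le_copies[OF tr r f(1,2) W(2,3) \<open>finite W\<close> m])
    with c(3)[OF tr] show "c \<le> (real (card W) + 1) * tr r"
      by linarith
  qed
  then have "W \<noteq> {}"
    using ck by auto
  then obtain w0 where "w0 \<in> W"
    by blast
  have "r \<in> V"
    using V(1) by simp
  \<comment> \<open>Only the nonzero entries take a position; the zero entries lie in every
    \<open>Q\<close>.\<close>
  define Y where "Y = {star (u i) * x * u j | x i j. x \<in> X \<and> i < k \<and> j < k \<and> P i * x * P j \<noteq> 0}"
  have Y: "finite Y" "card Y \<le> (\<Sum>x\<in>X. card {(i, j). i < k \<and> j < k \<and> P i * x * P j \<noteq> 0})"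
    unfolding Y_def by (rule card_entries[OF X(1)])+
  have "Y \<subseteq> M"
    using u(1) X(2) by (auto simp: Y_def)
  have "real (card Y) \<le> real (card ((V - {r}) \<times> (W - {w0})))"
  proof -
    have "real (card Y) \<le> \<epsilon> * (real k)\<^sup>2"
      using Y(2) count by linarith
    also have "\<dots> = (c * real k / 4) * (c * real k / 4)"
      by (simp add: \<epsilon>_def power2_eq_square)
    also have "\<dots> \<le> (real (card V) - 1) * (real (card W) - 1)"
      using ck cardV cardW by (intro mult_mono) auto
    also have "\<dots> = real (card (V - {r})) * real (card (W - {w0}))"
    proof -
      have "card V > 0" "card W > 0"
        using \<open>r \<in> V\<close> \<open>w0 \<in> W\<close> \<open>finite V\<close> \<open>finite W\<close> by (auto simp: card_gt_0_iff)
      then show ?thesis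
        using \<open>r \<in> V\<close> \<open>w0 \<in> W\<close> by (simp add: card_Diff_singleton of_nat_diff)
    qed
    finally show ?thesis
      by (simp add: card_cartesian_product)
  qed
  then have card: "infinite ((V - {r}) \<times> (W - {w0})) \<or> finite Y \<and> card Y \<le> card ((V - {r}) \<times> (W - {w0}))"
    using Y(1) by simp
  have pu: "P i * u i = u i" "u i * r = u i" if "i < k" for i
  proof -
    show "u i * r = u i"
      by (rule mult_star_self[OF u(2)[OF that] r(2)])
    then show "P i * u i = u i"
      by (metis u(2,3)[OF that] mult.assoc)
  qed
  have up: "star (u i) * P i = star (u i)" "r * star (u i) = star (u i)" if "i < k" for i
    using pu[OF that] P(2)[OF that] r(2) by (metis proj_def star_mult)+
  have uu: "star (u i) * u j = 0" if "i < k" "j < k" "i \<noteq> j" for i j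
  proof -
    have "star (u i) * u j = star (u i) * (P i * P j) * u j"
      by (metis mult.assoc pu(1)[OF that(2)] up(1)[OF that(1)])
    then show ?thesis
      using P(3)[OF that] by simp
  qed
  have sum1: "(\<Sum>i<k. u i * star (u i)) = 1"
    using u(3) P(4) by simp
  obtain B where "B \<in> M" "star B = B" "\<And>Q. vna Q \<Longrightarrow> Q \<subseteq> M \<Longrightarrow> e \<in> Q \<Longrightarrow> B \<in> Q \<Longrightarrow> Q = M"
  proof (rule generating_element[OF e(1,2) r \<open>r \<noteq> 0\<close> V(2-4) \<open>r \<in> V\<close> l W(2-4) \<open>w0 \<in> W\<close> m \<open>Y \<subseteq> M\<close> _ card])
    fix Q T
    assume Q: "vna Q" "r \<in> Q" "\<And>y. y \<in> Y \<Longrightarrow> r * y * r \<in> Q" and "T \<in> M"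
    show "r * T * r \<in> Q"
    proof (rule corner_generated_by_entries[OF \<open>k > 0\<close> u(1,2) r(2) uu sum1 X(3) Q(1,2) X(2) _ \<open>T \<in> M\<close>])
      fix x i j
      assume x: "x \<in> X" "i < k" "j < k"
      have rr: "r * (star (u i) * x * u j) * r = star (u i) * x * u j"
        by (metis mult.assoc pu(2)[OF x(3)] up(2)[OF x(2)])
      show "star (u i) * x * u j \<in> Q"
      proof (cases "P i * x * P j = 0")
        case True
        have "star (u i) * x * u j = star (u i) * (P i * x * P j) * u j"
          by (metis mult.assoc pu(1)[OF x(3)] up(1)[OF x(2)])
        then show ?thesis
          using True vna.zero[OF Q(1)] by simp
      next
        case False
        then have "star (u i) * x * u j \<in> Y"
          using x by (auto simp: Y_def)
        from Q(3)[OF this] show ?thesis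
          by (simp only: rr)
      qed
    qed
  qed (use Y(1) in \<open>auto intro: countable_finite\<close>)
  then show ?thesis
    by blast
qed

text \<open>The trichotomy: there is a minimal projection, or \<open>1\<close> is infinite, or \<open>M\<close> is of type II\<open>\<^sub>1\<close>.\<close>

lemma generator_exists:
  assumes II1: "\<And>\<epsilon>. (\<And>v. v \<in> M \<Longrightarrow> star v * v = 1 \<Longrightarrow> v * star v = 1) \<Longrightarrow>
      (\<And>a. a \<in> M \<Longrightarrow> proj a \<Longrightarrow> \<forall>S\<in>M. \<forall>T\<in>M. (a * S * a) * (a * T * a) = (a * T * a) * (a * S * a) \<Longrightarrow> a = 0) \<Longrightarrow>
      \<epsilon> > 0 \<Longrightarrow> \<exists>tr k P X. sparse_generators M \<epsilon> tr k P X"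
    and e: "e \<in> M" "proj e" "e \<noteq> 0" "e \<noteq> 1"
  shows "\<exists>B\<in>M. star B = B \<and> (\<forall>Q. vna Q \<and> Q \<subseteq> M \<and> e \<in> Q \<and> B \<in> Q \<longrightarrow> Q = M)"
proof (cases "\<exists>a\<in>M. proj a \<and> a \<noteq> 0 \<and> (\<forall>S\<in>M. \<forall>T\<in>M. (a * S * a) * (a * T * a) = (a * T * a) * (a * S * a))")
  case True
  then obtain a where a: "a \<in> M" "proj a" "a \<noteq> 0"
      "\<And>S T. S \<in> M \<Longrightarrow> T \<in> M \<Longrightarrow> (a * S * a) * (a * T * a) = (a * T * a) * (a * S * a)"
    by blast
  show ?thesis
    by (rule generator_minimal[OF a(1-3) abelian_imp_scalar_corner[OF a(1,2,4)] e])
next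
  case False
  then have nonabelian: "\<exists>S\<in>M. \<exists>T\<in>M. (a * S * a) * (a * T * a) \<noteq> (a * T * a) * (a * S * a)"
    if "a \<in> M" "proj a" "a \<noteq> 0" for a
    using that by blast
  have nonscalar: "\<exists>T\<in>M. \<forall>c. a * T * a \<noteq> cscale c a" if "a \<in> M" "proj a" "a \<noteq> 0" for a
  proof (rule ccontr)
    assume "\<not> ?thesis"
    then have scalar: "\<exists>c. a * T * a = cscale c a" if "T \<in> M" for T
      using that by blast
    have "(a * S * a) * (a * T * a) = (a * T * a) * (a * S * a)" if ST: "S \<in> M" "T \<in> M" for S T
    proof -
      obtain c d where "a * S * a = cscale c a" "a * T * a = cscale d a"
        using scalar[OF ST(1)] scalar[OF ST(2)] by blast
      then show ?thesis
        by (simp add: cscale_cscale mult.commute)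
    qed
    with nonabelian[OF that] show False
      by blast
  qed
  have f: "1 - e \<in> M" "proj (1 - e)" "1 - e \<noteq> 0"
    using e by (simp_all add: proj_diff)
  show ?thesis
  proof (cases "\<exists>v\<in>M. star v * v = 1 \<and> v * star v \<noteq> 1")
    case True
    then obtain v where v: "v \<in> M" "star v * v = 1" "v * star v \<noteq> 1"
      by blast
    obtain r C where r: "r \<in> M" "proj r" "r \<noteq> 0" and C: "pairwise (\<lambda>v w. star v * w = 0) C" "infinite C"
        "C \<subseteq> copies M r (1 - e) \<or> C \<subseteq> copies M r e"
      by (rule infinitely_many_copies[OF v e(1,2)]) (rule that)
    from C(3) show ?thesis
    proof
      assume "C \<subseteq> copies M r (1 - e)"
      from generator_infinite[OF nonscalar e(1-3) r this C(1,2)] show ?thesis .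
    next
      \<comment> \<open>The roles of \<open>e\<close> and \<open>1 - e\<close> are exchanged; a von
        Neumann algebra contains both or neither.\<close>
      assume "C \<subseteq> copies M r e"
      then have "C \<subseteq> copies M r (1 - (1 - e))"
        by simp
      from generator_infinite[OF nonscalar f r this C(1,2)]
      obtain B where B: "B \<in> M" "star B = B" "\<And>Q. vna Q \<Longrightarrow> Q \<subseteq> M \<Longrightarrow> 1 - e \<in> Q \<Longrightarrow> B \<in> Q \<Longrightarrow> Q = M"
        by blast
      have "1 - e \<in> Q" if "vna Q" "e \<in> Q" for Q
        using vna.diff[OF that(1) vna.one[OF that(1)] that(2)] .
      with B show ?thesis
        by blast
    qed
  next
    case finite: False
    have one_nonzero: "(1 :: 'h cop) \<noteq> 0"
    proof
      assume "(1 :: 'h cop) = 0"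
      then have "e * 1 = e * 0"
        by simp
      with e(3) show False
        by simp
    qed
    obtain S T where ST: "S \<in> M" "T \<in> M" "S * T \<noteq> T * S"
      using nonabelian[OF one proj_one one_nonzero] by auto
    show ?thesis
    proof (rule generator_II1[OF _ ST _ e])
      show fin: "v * star v = 1" if "v \<in> M" "star v * v = 1" for v
        using finite that by blast
      have ab: "a = 0" if "a \<in> M" "proj a" "\<forall>S\<in>M. \<forall>T\<in>M. (a * S * a) * (a * T * a) = (a * T * a) * (a * S * a)" for a
        using False that by blast
      show "\<exists>tr k P X. sparse_generators M \<epsilon> tr k P X" if "\<epsilon> > 0" for \<epsilon>
        by (rule II1[OF fin ab that])
    qed
  qed
qed

end

section \<open>Von Neumann algebras and the theorem\<close>

definition cops :: "('h::complex_hilbert) operator set \<Rightarrow> 'h cop set"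
  where "cops M = {T. Rep_cop T \<in> M}"

lemma cops_image: "(\<And>T. T \<in> M \<Longrightarrow> clinear_op T) \<Longrightarrow> Rep_cop ` cops M = M"
proof (intro equalityI subsetI)
  fix T
  assume "\<And>T. T \<in> M \<Longrightarrow> clinear_op T" "T \<in> M"
  then have "T = Rep_cop (Abs_cop T)"
    by (simp add: Abs_cop_inverse)
  with \<open>T \<in> M\<close> show "T \<in> Rep_cop ` cops M"
    unfolding cops_def by (metis image_eqI mem_Collect_eq)
qed (auto simp: cops_def)

lemma cops_eqD: "cops M = cops N \<Longrightarrow> (\<And>T. T \<in> M \<Longrightarrow> clinear_op T) \<Longrightarrow> M \<subseteq> N"
  using cops_image[of M] by (auto simp: cops_def)

text \<open>The topology is pulled back from a product, where a basic neighbourhood restricts only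
  finitely many coordinates; these form \<open>F\<close>.\<close>

lemma strongly_closed_approx:
  fixes M :: "('a::real_normed_vector \<Rightarrow>\<^sub>L 'b::real_normed_vector) set" and T :: "'a \<Rightarrow>\<^sub>L 'b"
  assumes "closedin strong_operator_topology M"
    and approx: "\<And>F e. finite F \<Longrightarrow> e > 0 \<Longrightarrow> \<exists>S\<in>M. \<forall>x\<in>F. norm (T x - S x) < e"
  shows "T \<in> M"
proof (rule ccontr)
  assume "T \<notin> M"
  have "openin strong_operator_topology (UNIV - M)"
    using assms(1) by (simp add: closedin_def strong_operator_topology_topspace)
  then obtain U where U: "open U" "UNIV - M = blinfun_apply -` U"
    unfolding strong_operator_topology_def openin_pullback_topology by auto
  have "blinfun_apply T \<in> U"
    using U(2) \<open>T \<notin> M\<close> by auto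
  obtain X where X: "blinfun_apply T \<in> (\<Pi>\<^sub>E i\<in>UNIV. X i)" "\<And>i. open (X i)"
      "finite {i. X i \<noteq> UNIV}" "(\<Pi>\<^sub>E i\<in>UNIV. X i) \<subseteq> U"
    using product_topology_open_contains_basis[of "\<lambda>_. euclidean" UNIV U "blinfun_apply T"]
      U(1) \<open>blinfun_apply T \<in> U\<close>
    by (auto simp: open_fun_def)
  define F where "F = {i. X i \<noteq> UNIV}"
  have "\<exists>e>0. ball (T i) e \<subseteq> X i" for i
    using X(1) X(2)[of i] open_contains_ball[of "X i"] by (auto simp: PiE_iff)
  then obtain r where r: "\<And>i. r i > 0" "\<And>i. ball (T i) (r i) \<subseteq> X i"
    by metis
  \<comment> \<open>The inserted \<open>1\<close> covers the case of empty \<open>F\<close>.\<close>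
  define e where "e = Min (insert 1 (r ` F))"
  have "finite F"
    using X(3) by (simp add: F_def)
  then have e: "e > 0" "\<And>i. i \<in> F \<Longrightarrow> e \<le> r i"
    using r(1) by (auto simp: e_def)
  obtain S where S: "S \<in> M" "\<forall>x\<in>F. norm (T x - S x) < e"
    using approx[OF \<open>finite F\<close> e(1)] by blast
  have "S i \<in> X i" for i
  proof (cases "i \<in> F")
    case True
    then have "S i \<in> ball (T i) (r i)"
      using S(2) e(2)[OF True] by (auto simp: dist_norm)
    then show ?thesis
      using r(2) by blast
  qed (simp add: F_def)
  then have "blinfun_apply S \<in> U"
    using X(4) by (auto simp: PiE_iff)
  then show False
    using S(1) U(2) by blast
qed

lemma in_strong_closure_approx:
  fixes R :: "'a::real_normed_vector \<Rightarrow>\<^sub>L 'b::real_normed_vector" and N :: "('a \<Rightarrow>\<^sub>L 'b) set"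
    and F :: "'a set"
  assumes "R \<in> strong_operator_topology closure_of N" "finite F" "e > 0"
  shows "\<exists>S\<in>N. \<forall>x\<in>F. norm (R x - blinfun_apply S x) < e"
proof -
  define U where "U = {f. \<forall>i\<in>F. blinfun_apply f (id i) \<in> ball (R i) e}"
  have U: "openin strong_operator_topology U"
    unfolding U_def by (rule strong_operator_topology_basis) (use assms(2) in auto)
  have RU: "R \<in> U"
    using assms(3) by (simp add: U_def)
  have "\<forall>T. R \<in> T \<and> openin strong_operator_topology T \<longrightarrow> (\<exists>y. y \<in> N \<and> y \<in> T)"
    using assms(1) unfolding in_closure_of by (rule conjunct2)
  from mp[OF spec[OF this, of U] conjI[OF RU U]] obtain S where "S \<in> N" "S \<in> U"
    by (elim exE conjE)
  then show ?thesis
    by (intro bexI[of _ S]) (simp_all add: dist_norm U_def)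
qed

lemma vna_cops: "von_neumann_algebra M \<Longrightarrow> vna (cops M)"
proof
  assume M: "von_neumann_algebra M"
  show "T \<in> cops M"
    if "\<And>F e. finite F \<Longrightarrow> e > 0 \<Longrightarrow> \<exists>S\<in>cops M. \<forall>x\<in>F. norm (T \<cdot> x - S \<cdot> x) < e" for T
  proof -
    have "Rep_cop T \<in> M"
    proof (rule strongly_closed_approx)
      show "closedin strong_operator_topology M"
        using M by (simp add: von_neumann_algebra_def)
      show "\<exists>S\<in>M. \<forall>x\<in>F. norm (Rep_cop T x - S x) < e" if "finite F" "e > 0" for F e
        using \<open>\<And>F e. finite F \<Longrightarrow> e > 0 \<Longrightarrow> \<exists>S\<in>cops M. \<forall>x\<in>F. norm (T \<cdot> x - S \<cdot> x) < e\<close>[OF that]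
        by (auto simp: cops_def ap.rep_eq)
    qed
    then show ?thesis
      by (simp add: cops_def)
  qed
qed (simp_all add: cops_def von_neumann_algebra_def one_cop.rep_eq plus_cop.rep_eq times_cop.rep_eq
    cscale.rep_eq star.rep_eq)

text \<open>The ambient topology lives on real-linear operators, so a strong limit must be shown to
  be complex-linear before it can be moved to \<open>cop\<close>.\<close>

lemma von_neumann_algebra_Rep: "vna N \<Longrightarrow> von_neumann_algebra (Rep_cop ` N)"
proof -
  assume "vna N"
  interpret vna N by fact
  have "strong_operator_topology closure_of (Rep_cop ` N) \<subseteq> Rep_cop ` N"
  proof
    fix R :: "'a operator"
    assume R: "R \<in> strong_operator_topology closure_of (Rep_cop ` N)"
    have approx: "\<exists>S\<in>N. \<forall>x\<in>F. norm (R x - S \<cdot> x) < e" if "finite F" "e > 0" for F e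
      using in_strong_closure_approx[OF R that] by (auto simp: ap.rep_eq)
    have "clinear_op R"
      unfolding clinear_op_def
    proof (intro allI)
      fix c x
      have "norm (R (c *\<^sub>C x) - c *\<^sub>C R x) \<le> 0 + e" if "e > 0" for e
      proof -
        define d where "d = e / (1 + cmod c)"
        have "1 + cmod c > 0"
          by (simp add: add_pos_nonneg)
        then have "d > 0"
          using \<open>e > 0\<close> by (simp add: d_def)
        then obtain S where S: "\<forall>y\<in>{x, c *\<^sub>C x}. norm (R y - S \<cdot> y) < d"
          using approx[of "{x, c *\<^sub>C x}" d] by auto
        have "R (c *\<^sub>C x) - c *\<^sub>C R x = (R (c *\<^sub>C x) - S \<cdot> (c *\<^sub>C x)) - c *\<^sub>C (R x - S \<cdot> x)"
          by (simp add: scaleC_diff_right)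
        also have "norm \<dots> \<le> norm (R (c *\<^sub>C x) - S \<cdot> (c *\<^sub>C x)) + norm (c *\<^sub>C (R x - S \<cdot> x))"
          by (rule norm_triangle_ineq4)
        also have "\<dots> \<le> d + cmod c * d"
          using S by (auto simp: norm_scaleC intro!: add_mono mult_left_mono)
        also have "\<dots> = (1 + cmod c) * d"
          by (simp add: algebra_simps)
        also have "\<dots> = e"
          using \<open>1 + cmod c > 0\<close> by (simp add: d_def)
        finally show ?thesis
          by simp
      qed
      then have "norm (R (c *\<^sub>C x) - c *\<^sub>C R x) \<le> 0"
        by (rule field_le_epsilon)
      then show "R (c *\<^sub>C x) = c *\<^sub>C R x"
        by simp
    qed
    then have Rep: "Rep_cop (Abs_cop R) = R"
      by (simp add: Abs_cop_inverse)
    have "Abs_cop R \<in> N"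
      by (rule strongly_closed) (use approx in \<open>simp add: ap.rep_eq Rep\<close>)
    then show "R \<in> Rep_cop ` N"
      using Rep by (metis imageI)
  qed
  then have closed: "closedin strong_operator_topology (Rep_cop ` N)"
    by (simp add: closure_of_subset_eq[symmetric] strong_operator_topology_topspace)
  have img: "Rep_cop T \<in> Rep_cop ` N" if "T \<in> N" for T
    using that by simp
  have "id_blinfun \<in> Rep_cop ` N"
    using img[OF one] by (simp add: one_cop.rep_eq)
  moreover have "Rep_cop S + Rep_cop T \<in> Rep_cop ` N" "Rep_cop S o\<^sub>L Rep_cop T \<in> Rep_cop ` N"
    if "S \<in> N" "T \<in> N" for S T
    using img[OF add[OF that]] img[OF mult[OF that]] by (simp_all add: plus_cop.rep_eq times_cop.rep_eq)
  moreover have "scale_op c (Rep_cop T) \<in> Rep_cop ` N" "adj (Rep_cop T) \<in> Rep_cop ` N" if "T \<in> N" for c T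
    using img[OF cscale[OF that, of c]] img[OF star[OF that]] by (simp_all add: cscale.rep_eq star.rep_eq)
  moreover have "clinear_op (Rep_cop T)" for T :: "'a cop"
    using Rep_cop[of T] by simp
  ultimately show ?thesis
    using closed unfolding von_neumann_algebra_def by (intro conjI ballI allI) auto
qed

lemma W_star_generates:
  assumes M: "von_neumann_algebra M" and "W_star M (Rep_cop ` X) = M"
    and Q: "vna Q" "Q \<subseteq> cops M" "X \<subseteq> Q"
  shows "Q = cops M"
proof -
  have "W_star M (Rep_cop ` X) \<subseteq> Rep_cop ` Q"
    unfolding W_star_def using Q by (intro hull_minimal) (auto simp: von_neumann_algebra_Rep cops_def)
  then have "M \<subseteq> Rep_cop ` Q"
    using assms(2) by simp
  then show ?thesis
    using Q(2) by (force simp: cops_def Rep_cop_inject)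
qed

lemma W_star_eqI:
  assumes M: "von_neumann_algebra M" and X: "X \<subseteq> M"
    and gen: "\<And>Q. vna Q \<Longrightarrow> Q \<subseteq> cops M \<Longrightarrow> (\<And>T. Rep_cop T \<in> X \<Longrightarrow> T \<in> Q) \<Longrightarrow> Q = cops M"
  shows "W_star M X = M"
proof
  show "W_star M X \<subseteq> M"
    unfolding W_star_def using M X by (intro hull_minimal) auto
  show "M \<subseteq> W_star M X"
    unfolding W_star_def hull_def
  proof (rule Inter_greatest)
    fix N
    assume N: "N \<in> {N. (von_neumann_algebra N \<and> N \<subseteq> M) \<and> X \<subseteq> N}"
    then have "cops N = cops M"
      by (intro gen vna_cops) (auto simp: cops_def)
    then show "M \<subseteq> N"
      using M by (intro cops_eqD) (auto simp: von_neumann_algebra_def)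
  qed
qed

text \<open>An enumeration of \<open>F\<close>, continued by zero vectors, gives square-summable
  sequences; so the functional is a coordinate of the map that defines the ultraweak
  topology.\<close>

lemma vector_functional_in_predual:
  fixes M :: "('h::complex_hilbert) operator set"
  assumes F: "finite F"
  shows "(\<lambda>T. \<Sum>x\<in>F. cinner (blinfun_apply T x) (\<eta> x)) \<in> predual M"
proof -
  define f where "f = (\<lambda>(T :: 'h operator) (\<xi> :: nat \<Rightarrow> 'h, \<eta> :: nat \<Rightarrow> 'h).
      if summable (\<lambda>n. (norm (\<xi> n))\<^sup>2) \<and> summable (\<lambda>n. (norm (\<eta> n))\<^sup>2)
      then \<Sum>n. cinner (T (\<xi> n)) (\<eta> n) else 0)"
  obtain h where h: "bij_betw h {..<card F} F"
    using ex_bij_betw_nat_finite[OF F] by (auto simp: atLeast0LessThan)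
  define \<xi>1 where "\<xi>1 n = (if n < card F then h n else 0)" for n
  define \<eta>1 where "\<eta>1 n = (if n < card F then \<eta> (h n) else 0)" for n
  have "summable (\<lambda>n. (norm (\<xi>1 n))\<^sup>2)" "summable (\<lambda>n. (norm (\<eta>1 n))\<^sup>2)"
    by (rule summable_finite[of "{..<card F}"]; simp add: \<xi>1_def \<eta>1_def)+
  moreover have "(\<Sum>n. cinner (T (\<xi>1 n)) (\<eta>1 n)) = (\<Sum>x\<in>F. cinner (T x) (\<eta> x))" for T :: "'h operator"
  proof -
    have c0: "cinner x (0 :: 'h) = 0" for x
      by (simp add: cinner_conv_inner zero_complex.code)
    have "(\<Sum>n. cinner (T (\<xi>1 n)) (\<eta>1 n)) = (\<Sum>n<card F. cinner (T (\<xi>1 n)) (\<eta>1 n))"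
      by (rule suminf_finite) (simp_all add: \<eta>1_def c0)
    also have "\<dots> = (\<Sum>n<card F. cinner (T (h n)) (\<eta> (h n)))"
      by (rule sum.cong) (simp_all add: \<eta>1_def \<xi>1_def)
    also have "\<dots> = (\<Sum>x\<in>F. cinner (T x) (\<eta> x))"
      by (rule sum.reindex_bij_betw[OF h])
    finally show ?thesis .
  qed
  ultimately have eq: "(\<lambda>T. \<Sum>x\<in>F. cinner (blinfun_apply T x) (\<eta> x)) = (\<lambda>g. g (\<xi>1, \<eta>1)) \<circ> f"
    by (simp add: f_def fun_eq_iff)
  have "continuous_map ultraweak_topology euclidean ((\<lambda>g. g (\<xi>1, \<eta>1)) \<circ> f)"
    unfolding ultraweak_topology_def f_def[symmetric]
    by (rule continuous_map_pullback) (simp add: continuous_map_iff_continuous2 continuous_on_product_coordinates)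
  then have "continuous_map (subtopology ultraweak_topology M) euclidean (\<lambda>T. \<Sum>x\<in>F. cinner (blinfun_apply T x) (\<eta> x))"
    unfolding eq by (rule continuous_map_from_subtopology)
  moreover have "linear_functional_on M (\<lambda>T. \<Sum>x\<in>F. cinner (blinfun_apply T x) (\<eta> x))"
    by (simp add: linear_functional_on_def blinfun.add_left cinner_add_left sum.distrib scale_op.rep_eq
        cinner_scaleC_left sum_distrib_left)
  ultimately show ?thesis
    by (simp add: predual_def)
qed

lemma separable_factor_cops:
  fixes M :: "('h::complex_hilbert) operator set"
  assumes "factor M" "separable_predual M"
  obtains D where "separable_factor (cops M) D"
proof -
  have M: "von_neumann_algebra M"
    using assms(1) by (simp add: factor_def)
  interpret vna "cops M"
    by (rule vna_cops[OF M])
  obtain C where C: "countable C" "C \<subseteq> predual M"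
      "\<And>\<phi> e. \<phi> \<in> predual M \<Longrightarrow> e > 0 \<Longrightarrow> \<exists>\<psi>\<in>C. \<forall>T\<in>M. cmod (\<phi> T - \<psi> T) \<le> e * norm T"
    using assms(2) unfolding separable_predual_def by metis
  have "C \<noteq> {}"
    using C(3)[OF vector_functional_in_predual[of "{}"], of 1] by auto
  define D where "D n T = Re (from_nat_into C n (Rep_cop T))" for n and T :: "'h cop"
  have "separable_factor (cops M) D"
  proof
    fix F :: "'h set" and e :: real and \<eta>
    assume "finite F" "e > 0"
    from C(3)[OF vector_functional_in_predual[OF \<open>finite F\<close>, of \<eta>] \<open>e > 0\<close>]
    obtain \<psi> where \<psi>: "\<psi> \<in> C" "\<forall>T\<in>M.
        cmod ((\<Sum>x\<in>F. cinner (blinfun_apply T x) (\<eta> x)) - \<psi> T) \<le> e * norm T"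
      by (rule bexE)
    obtain n where n: "from_nat_into C n = \<psi>"
      using from_nat_into_surj[OF C(1) \<psi>(1)] by blast
    have "\<bar>(\<Sum>x\<in>F. inner (T \<cdot> x) (\<eta> x)) - D n T\<bar> \<le> e * norm T" if "T \<in> cops M" for T
    proof -
      have "(\<Sum>x\<in>F. inner (T \<cdot> x) (\<eta> x)) - D n T
          = Re ((\<Sum>x\<in>F. cinner (blinfun_apply (Rep_cop T) x) (\<eta> x)) - \<psi> (Rep_cop T))"
        by (simp add: D_def n ap.rep_eq inner_cinner)
      then show ?thesis
        using order_trans[OF abs_Re_le_cmod bspec[OF \<psi>(2), of "Rep_cop T"]] that
        by (simp add: cops_def norm_cop.rep_eq)
    qed
    then show "\<exists>n. \<forall>T\<in>cops M. \<bar>(\<Sum>x\<in>F. inner (T \<cdot> x) (\<eta> x)) - D n T\<bar> \<le> e * norm T"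
      by blast
  next
    fix Z
    assume Z: "Z \<in> cops M" "\<And>T. T \<in> cops M \<Longrightarrow> Z * T = T * Z"
    have "Rep_cop Z \<in> center M"
      unfolding center_def
    proof (intro CollectI conjI ballI)
      show "Rep_cop Z \<in> M"
        using Z(1) by (simp add: cops_def)
      fix R
      assume "R \<in> M"
      then obtain T where T: "R = Rep_cop T" "T \<in> cops M"
        using cops_image[of M] M unfolding von_neumann_algebra_def by blast
      show "Rep_cop Z o\<^sub>L R = R o\<^sub>L Rep_cop Z"
        using Z(2)[OF T(2)] by (metis T(1) times_cop.rep_eq)
    qed
    then obtain c where "Rep_cop Z = scale_op c id_blinfun"
      using assms(1) by (auto simp: factor_def)
    then have "Rep_cop Z = Rep_cop (cscale c 1)"
      by (simp add: cscale.rep_eq one_cop.rep_eq)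
    then show "\<exists>c. Z = cscale c 1"
      by (auto simp: Rep_cop_inject)
  qed
  then show thesis
    by (rule that)
qed

section \<open>Traces, Shen's invariant and type II1 in terms of \<open>cop\<close>\<close>

lemma Rep_cop_sum: "Rep_cop (\<Sum>i\<in>I. X i) = (\<Sum>i\<in>I. Rep_cop (X i))"
  by (induction I rule: infinite_finite_induct) (simp_all add: zero_cop.rep_eq plus_cop.rep_eq)

lemma Rep_cop_eq_0_iff [simp]: "Rep_cop T = 0 \<longleftrightarrow> T = 0"
  by (metis Rep_cop_inject zero_cop.rep_eq)

lemma projection_in_Rep_iff: "projection_in M (Rep_cop p) \<longleftrightarrow> p \<in> cops M \<and> proj p"
  by (simp add: projection_in_def proj_def cops_def times_cop.rep_eq[symmetric] star.rep_eq[symmetric] Rep_cop_inject)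

lemma trace_on_cops:
  assumes M: "von_neumann_algebra M" and \<tau>: "tracial_state M \<tau>"
  shows "trace_on (cops M) (\<lambda>T. Re (\<tau> (Rep_cop T)))"
proof -
  have \<tau>: "\<And>S T. S \<in> M \<Longrightarrow> T \<in> M \<Longrightarrow> \<tau> (S + T) = \<tau> S + \<tau> T" "\<And>T. T \<in> M \<Longrightarrow> \<tau> (adj T o\<^sub>L T) \<in> \<real>\<^sub>\<ge>\<^sub>0"
    "\<tau> id_blinfun = 1" "\<And>S T. S \<in> M \<Longrightarrow> T \<in> M \<Longrightarrow> \<tau> (S o\<^sub>L T) = \<tau> (T o\<^sub>L S)"
    using \<tau> by (auto simp: tracial_state_def linear_functional_on_def)
  show ?thesis
    unfolding trace_on_def
  proof (intro conjI ballI)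
    fix S T
    assume "S \<in> cops M" "T \<in> cops M"
    then have ST: "Rep_cop S \<in> M" "Rep_cop T \<in> M"
      by (simp_all add: cops_def)
    show "Re (\<tau> (Rep_cop (S + T))) = Re (\<tau> (Rep_cop S)) + Re (\<tau> (Rep_cop T))"
      using \<tau>(1)[OF ST] by (simp add: plus_cop.rep_eq)
    show "Re (\<tau> (Rep_cop (S * T))) = Re (\<tau> (Rep_cop (T * S)))"
      using \<tau>(4)[OF ST] by (simp add: times_cop.rep_eq)
  next
    fix T
    assume "T \<in> cops M"
    then show "0 \<le> Re (\<tau> (Rep_cop (star T * T)))"
      using \<tau>(2)[of "Rep_cop T"] by (auto simp: cops_def times_cop.rep_eq star.rep_eq complex_nonneg_Reals_iff)
  next
    show "Re (\<tau> (Rep_cop 1)) = 1"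
      by (simp add: one_cop.rep_eq \<tau>(3))
  qed
qed

lemma sparse_generators_exist:
  fixes M :: "('h::complex_hilbert) operator set"
  assumes M: "von_neumann_algebra M" and "shen_G M = 0" "\<epsilon> > 0"
  shows "\<exists>tr k P X. sparse_generators (cops M) \<epsilon> tr k P X"
proof -
  have "shen_G M < ereal \<epsilon>"
    using assms(2,3) by simp
  then obtain X k p \<tau> where I: "shen_I X k p < \<epsilon>" and \<tau>: "tracial_state M \<tau>"
    and p: "equal_partition M \<tau> k p" and X: "finite X" "X \<subseteq> M" "W_star M X = M"
    unfolding shen_G_def Inf_less_iff by auto
  have clinear: "clinear_op T" if "T \<in> M" for T
    using M that by (simp add: von_neumann_algebra_def)
  have "k > 0"
    using p by (simp add: equal_partition_def)
  define P where "P i = Abs_cop (p i)" for i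
  have P: "Rep_cop (P i) = p i" if "i < k" for i
  proof -
    have "p i \<in> M"
      using p that by (simp add: equal_partition_def projection_in_def)
    then show ?thesis
      by (simp add: P_def Abs_cop_inverse clinear)
  qed
  have RepX: "Rep_cop ` cops X = X"
    by (rule cops_image) (use X(2) clinear in blast)
  have "inj_on Rep_cop (cops X)"
    by (rule inj_onI) (simp add: Rep_cop_inject)
  have "finite (cops X)"
    using \<open>inj_on Rep_cop (cops X)\<close> RepX X(1) by (metis finite_imageD)
  have card: "{(i, j). i < k \<and> j < k \<and> p i o\<^sub>L Rep_cop x o\<^sub>L p j \<noteq> 0}
      = {(i, j). i < k \<and> j < k \<and> P i * x * P j \<noteq> 0}" for x
  proof -
    have "p i o\<^sub>L Rep_cop x o\<^sub>L p j = Rep_cop (P i * x * P j)" if "i < k" "j < k" for i j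
      using that by (simp add: times_cop.rep_eq P)
    then show ?thesis
      by auto
  qed
  have "(\<Sum>x\<in>cops X. 1 / (real k)\<^sup>2 * real (card {(i, j). i < k \<and> j < k \<and> P i * x * P j \<noteq> 0})) < \<epsilon>"
    using I unfolding shen_I_def
    by (subst (asm) RepX[symmetric], subst (asm) sum.reindex[OF \<open>inj_on Rep_cop (cops X)\<close>]) (simp add: card)
  then have "real (\<Sum>x\<in>cops X. card {(i, j). i < k \<and> j < k \<and> P i * x * P j \<noteq> 0}) / (real k)\<^sup>2 < \<epsilon>"
    by (simp add: sum_divide_distrib)
  then have count: "real (\<Sum>x\<in>cops X. card {(i, j). i < k \<and> j < k \<and> P i * x * P j \<noteq> 0}) < \<epsilon> * (real k)\<^sup>2"
    using \<open>k > 0\<close> by (subst (asm) pos_divide_less_eq) auto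
  have projP: "P i \<in> cops M \<and> proj (P i)" if "i < k" for i
    using p that unfolding projection_in_Rep_iff[symmetric] P[OF that] by (simp add: equal_partition_def)
  have orthP: "P i * P j = 0" if "i < k" "j < k" "i \<noteq> j" for i j
  proof -
    have "Rep_cop (P i * P j) = 0"
      using p that by (simp add: times_cop.rep_eq P equal_partition_def)
    then show ?thesis
      by simp
  qed
  have "Rep_cop (\<Sum>i<k. P i) = Rep_cop 1"
    using p by (simp add: Rep_cop_sum P one_cop.rep_eq equal_partition_def)
  then have sumP: "(\<Sum>i<k. P i) = 1"
    by (simp add: Rep_cop_inject)
  have trP: "Re (\<tau> (Rep_cop (P i))) = 1 / real k" if "i < k" for i
    using p that by (simp add: P equal_partition_def)
  have gen: "Q = cops M" if "vna Q" "Q \<subseteq> cops M" "cops X \<subseteq> Q" for Q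
    by (rule W_star_generates[OF M _ that]) (simp add: RepX X(3))
  have "cops X \<subseteq> cops M"
    using X(2) by (auto simp: cops_def)
  with trace_on_cops[OF M \<tau>] \<open>k > 0\<close> projP orthP sumP trP gen count \<open>finite (cops X)\<close>
  have "sparse_generators (cops M) \<epsilon> (\<lambda>T. Re (\<tau> (Rep_cop T))) k P (cops X)"
    unfolding sparse_generators_def by auto
  then show ?thesis
    by blast
qed

lemma type_II1_factorI:
  fixes M :: "('h::complex_hilbert) operator set"
  assumes M: "factor M" and nonzero: "(1 :: 'h cop) \<noteq> 0"
    and fin: "\<And>v. v \<in> cops M \<Longrightarrow> star v * v = 1 \<Longrightarrow> v * star v = 1"
    and abelian: "\<And>a. a \<in> cops M \<Longrightarrow> proj a \<Longrightarrow>
      \<forall>S\<in>cops M. \<forall>T\<in>cops M. (a * S * a) * (a * T * a) = (a * T * a) * (a * S * a) \<Longrightarrow> a = 0"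
  shows "type_II1_factor M"
proof -
  have vN: "von_neumann_algebra M"
    using M by (simp add: factor_def)
  interpret vna "cops M"
    by (rule vna_cops[OF vN])
  have Rep: "\<exists>T'. T = Rep_cop T' \<and> T' \<in> cops M" if "T \<in> M" for T
    using cops_image[of M] that vN unfolding von_neumann_algebra_def by blast
  have "id_blinfun \<noteq> (0 :: 'h operator)"
    using nonzero by (metis Rep_cop_eq_0_iff one_cop.rep_eq)
  moreover have "finite_projection M id_blinfun"
    unfolding finite_projection_def
  proof (intro conjI allI impI)
    show "projection_in M id_blinfun"
      using projection_in_Rep_iff[of M 1] by (simp add: one_cop.rep_eq)
    fix q
    assume q: "projection_in M q \<and> id_blinfun o\<^sub>L q = q \<and> mvn_equivalent M q id_blinfun"
    then obtain v where v: "v \<in> M" "adj v o\<^sub>L v = q" "v o\<^sub>L adj v = id_blinfun"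
      by (auto simp: mvn_equivalent_def)
    obtain u where u: "v = Rep_cop u" "u \<in> cops M"
      using Rep[OF v(1)] by blast
    have "Rep_cop (u * star u) = Rep_cop 1"
      using v(3) by (simp add: u times_cop.rep_eq star.rep_eq one_cop.rep_eq)
    \<comment> \<open>Finiteness is applied to the isometry \<open>star u\<close>.\<close>
    then have "star u * u = 1"
      using fin[of "star u"] u(2) by (simp add: Rep_cop_inject)
    then show "q = id_blinfun"
      using v(2) by (metis u(1) times_cop.rep_eq star.rep_eq one_cop.rep_eq)
  qed
  moreover have "p = 0" if p: "abelian_projection M p" for p
  proof -
    obtain a where a: "p = Rep_cop a" "a \<in> cops M" "proj a"
      using Rep[of p] p projection_in_Rep_iff by (auto simp: abelian_projection_def projection_in_def)
    have "a = 0"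
    proof (rule abelian[OF a(2,3)], intro ballI)
      fix S T
      assume "S \<in> cops M" "T \<in> cops M"
      then have "Rep_cop ((a * S * a) * (a * T * a)) = Rep_cop ((a * T * a) * (a * S * a))"
        using p by (simp add: abelian_projection_def a(1) cops_def times_cop.rep_eq)
      then show "(a * S * a) * (a * T * a) = (a * T * a) * (a * S * a)"
        by (simp add: Rep_cop_inject)
    qed
    then show ?thesis
      by (simp add: a(1))
  qed
  ultimately show ?thesis
    using M by (simp add: type_II1_factor_def)
qed

text \<open>A scalar real part makes \<open>T\<close> commute with \<open>star T\<close>. Then
  everything generated by \<open>T\<close> commutes with \<open>T\<close>, hence with everything,
  and a commutative factor consists of scalars.\<close>

lemma not_scalar_real_part:
  fixes M :: "('h::complex_hilbert) operator set"
  assumes factor: "factor M" and dim: "B \<subseteq> M" "op.independent B" "finite B" "card B > 1"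
    and T: "T \<in> cops M" "W_star M {Rep_cop T} = M"
  shows "(1/2) *\<^sub>R (T + star T) \<noteq> cscale c 1"
proof
  assume "(1/2) *\<^sub>R (T + star T) = cscale c 1"
  then have "2 *\<^sub>R ((1/2) *\<^sub>R (T + star T)) = 2 *\<^sub>R cscale c 1"
    by simp
  then have "T + star T = 2 *\<^sub>R cscale c 1"
    by simp
  then have star_T: "star T = 2 *\<^sub>R cscale c 1 - T"
    by (simp add: eq_diff_eq add.commute)
  have vN: "von_neumann_algebra M"
    using factor by (simp add: factor_def)
  interpret vna "cops M"
    by (rule vna_cops[OF vN])
  have gen: "Q = cops M" if "vna Q" "Q \<subseteq> cops M" "T \<in> Q" for Q
    using W_star_generates[OF vN _ that(1,2), of "{T}"] T(2) that(3) by simp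
  have "cops M \<inter> {R. \<forall>S\<in>{T, star T}. R * S = S * R} = cops M"
  proof (rule gen)
    show "vna (cops M \<inter> {R. \<forall>S\<in>{T, star T}. R * S = S * R})"
      by (intro vna_inter vna_axioms vna_commutant) auto
    have "T * star T = star T * T"
      unfolding star_T by (simp add: left_diff_distrib right_diff_distrib)
    then show "T \<in> cops M \<inter> {R. \<forall>S\<in>{T, star T}. R * S = S * R}"
      using T(1) by simp
  qed auto
  then have comm: "R * T = T * R" if "R \<in> cops M" for R
    using that by blast
  have "cops M \<inter> {R. \<forall>S\<in>cops M. R * S = S * R} = cops M"
  proof (rule gen)
    show "vna (cops M \<inter> {R. \<forall>S\<in>cops M. R * S = S * R})"
      by (intro vna_inter vna_axioms vna_commutant) auto
    show "T \<in> cops M \<inter> {R. \<forall>S\<in>cops M. R * S = S * R}"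
      using T(1) comm by simp
  qed auto
  then have comm: "R * S = S * R" if "R \<in> cops M" "S \<in> cops M" for R S
    using that by blast
  have RepM: "Rep_cop ` cops M = M"
    by (rule cops_image) (use vN in \<open>simp add: von_neumann_algebra_def\<close>)
  have "M \<subseteq> center M"
  proof
    fix Z
    assume "Z \<in> M"
    have "Z o\<^sub>L R = R o\<^sub>L Z" if "R \<in> M" for R
    proof -
      obtain Z' R' where "Z = Rep_cop Z'" "Z' \<in> cops M" "R = Rep_cop R'" "R' \<in> cops M"
        using RepM \<open>Z \<in> M\<close> \<open>R \<in> M\<close> by (metis imageE)
      then show ?thesis
        using comm[of Z' R'] by (metis times_cop.rep_eq)
    qed
    with \<open>Z \<in> M\<close> show "Z \<in> center M"
      by (simp add: center_def)
  qed
  then have "M \<subseteq> range (\<lambda>c. scale_op c (id_blinfun :: 'h operator))"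
    using factor by (simp add: factor_def)
  then have "B \<subseteq> op.span {id_blinfun}"
    using dim(1) by (auto simp: op.span_singleton)
  then have "card B \<le> card {id_blinfun :: 'h operator}"
    using op.independent_span_bound[of "{id_blinfun}" B] dim(2) by simp
  with dim(4) show False
    by simp
qed

theorem proposition3p10:
  fixes M :: "('h::complex_hilbert) operator set" and A :: "'h operator"
  assumes "factor M" and "separable_predual M"
    and "\<exists>B. B \<subseteq> M \<and> op.independent B \<and> finite B \<and> card B > 1"
    and "type_II1_factor M \<Longrightarrow> shen_G M = 0"
    and "A \<in> M" and "adj A = A"
  shows "(\<exists>T\<in>M. W_star M {T} = M \<and> A = (1 / 2) *\<^sub>R (T + adj T)) \<longleftrightarrow>
    \<not> (\<exists>c. A = scale_op c id_blinfun)"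
proof -
  have vN: "von_neumann_algebra M"
    using assms(1) by (simp add: factor_def)
  have Rep: "\<exists>T'. T = Rep_cop T' \<and> T' \<in> cops M" if "T \<in> M" for T
    using cops_image[of M] that vN unfolding von_neumann_algebra_def by blast
  obtain a where a: "A = Rep_cop a" "a \<in> cops M"
    using Rep[OF assms(5)] by blast
  have scalar: "A = scale_op c id_blinfun \<longleftrightarrow> a = cscale c 1" for c
    by (simp add: a(1) one_cop.rep_eq[symmetric] cscale.rep_eq[symmetric] Rep_cop_inject)
  show ?thesis
  proof
    assume "\<exists>T\<in>M. W_star M {T} = M \<and> A = (1 / 2) *\<^sub>R (T + adj T)"
    then obtain T where T: "T \<in> cops M" "W_star M {Rep_cop T} = M" "A = (1 / 2) *\<^sub>R (Rep_cop T + adj (Rep_cop T))"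
      using Rep by metis
    have "Rep_cop a = Rep_cop ((1 / 2) *\<^sub>R (T + star T))"
      using T(3) by (simp add: a(1) scaleR_cop.rep_eq plus_cop.rep_eq star.rep_eq)
    then have "a = (1 / 2) *\<^sub>R (T + star T)"
      by (simp add: Rep_cop_inject)
    then show "\<not> (\<exists>c. A = scale_op c id_blinfun)"
      using not_scalar_real_part[OF assms(1) _ _ _ _ T(1,2)] assms(3) unfolding scalar by metis
  next
    assume nonscalar: "\<not> (\<exists>c. A = scale_op c id_blinfun)"
    obtain D where "separable_factor (cops M) D"
      by (rule separable_factor_cops[OF assms(1,2)])
    then interpret separable_factor "cops M" D .
    have "star a = a"
      using assms(6) by (simp add: a(1) star.rep_eq[symmetric] Rep_cop_inject)
    have ns: "a \<noteq> c *\<^sub>R 1" for c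
      using nonscalar unfolding scalar cscale_of_real[symmetric] by blast
    \<comment> \<open>\<open>e\<close> is recovered from the real part \<open>a\<close> alone, so
      \<open>b\<close> only has to supply the rest of \<open>M\<close>.\<close>
    obtain e where e: "proj e" "1 * e = e" "e \<noteq> 0" "e \<noteq> 1"
        "\<And>N. vna N \<Longrightarrow> a \<in> N \<Longrightarrow> 1 \<in> N \<Longrightarrow> e \<in> N"
      by (rule corner_projection[OF proj_one \<open>star a = a\<close> mult_1_left ns]) (assumption | rule that)+
    have eM: "e \<in> cops M"
      by (rule e(5)[OF vna_axioms a(2) one])
    have nonzero: "(1 :: 'h cop) \<noteq> 0"
      using e(2,3) by (metis mult_zero_left)
    have "\<exists>b\<in>cops M. star b = b \<and> (\<forall>Q. vna Q \<and> Q \<subseteq> cops M \<and> e \<in> Q \<and> b \<in> Q \<longrightarrow> Q = cops M)"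
    proof (rule generator_exists[OF _ eM e(1,3,4)])
      fix \<epsilon> :: real
      assume II1: "\<And>v. v \<in> cops M \<Longrightarrow> star v * v = 1 \<Longrightarrow> v * star v = 1"
        "\<And>a. a \<in> cops M \<Longrightarrow> proj a \<Longrightarrow>
          \<forall>S\<in>cops M. \<forall>T\<in>cops M. (a * S * a) * (a * T * a) = (a * T * a) * (a * S * a) \<Longrightarrow> a = 0"
        and "\<epsilon> > 0"
      have "type_II1_factor M"
        by (rule type_II1_factorI[OF assms(1) nonzero II1])
      from sparse_generators_exist[OF vN assms(4)[OF this] \<open>\<epsilon> > 0\<close>]
      show "\<exists>tr k P X. sparse_generators (cops M) \<epsilon> tr k P X" .
    qed
    then obtain b where b: "b \<in> cops M" "star b = b"
        "\<And>Q. vna Q \<Longrightarrow> Q \<subseteq> cops M \<Longrightarrow> e \<in> Q \<Longrightarrow> b \<in> Q \<Longrightarrow> Q = cops M"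
      by blast
    define t where "t = a + cscale \<i> b"
    have "t \<in> cops M"
      using a(2) b(1) by (simp add: t_def)
    have star_t: "star t = a + cscale (- \<i>) b"
      by (simp add: t_def \<open>star a = a\<close> b(2))
    have re: "a = (1/2) *\<^sub>R (t + star t)"
    proof -
      have "t + star t = (a + a) + (cscale \<i> b + cscale (- \<i>) b)"
        unfolding star_t by (simp add: t_def)
      also have "\<dots> = 2 *\<^sub>R a"
        unfolding cscale_add_left scaleR_2 using cscale_of_real[of 0 b] by simp
      finally show ?thesis
        by simp
    qed
    have im: "b = cscale (- \<i>) (t - a)"
      by (simp add: t_def cscale_cscale)
    have "W_star M {Rep_cop t} = M"
    proof (rule W_star_eqI[OF vN])
      show "{Rep_cop t} \<subseteq> M"
        using \<open>t \<in> cops M\<close> by (simp add: cops_def)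
      fix Q
      assume Q: "vna Q" "Q \<subseteq> cops M" and "\<And>T. Rep_cop T \<in> {Rep_cop t} \<Longrightarrow> T \<in> Q"
      then have "t \<in> Q"
        by simp
      interpret Q: vna Q by fact
      have "a \<in> Q"
        using \<open>t \<in> Q\<close> by (subst re) simp
      then have "b \<in> Q"
        using \<open>t \<in> Q\<close> by (subst im) simp
      moreover have "e \<in> Q"
        by (rule e(5)[OF Q(1) \<open>a \<in> Q\<close> Q.one])
      ultimately show "Q = cops M"
        by (intro b(3) Q)
    qed
    moreover have "A = (1 / 2) *\<^sub>R (Rep_cop t + adj (Rep_cop t))"
      using arg_cong[OF re, of Rep_cop] by (simp add: a(1) scaleR_cop.rep_eq plus_cop.rep_eq star.rep_eq)
    ultimately show "\<exists>T\<in>M. W_star M {T} = M \<and> A = (1 / 2) *\<^sub>R (T + adj T)"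
      using \<open>t \<in> cops M\<close> by (auto simp: cops_def)
  qed
qed

end
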